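(* Every finitely generated group is a quotient of an isolated group.
   Context: $F_m$ is the free group of rank $m$, and $\mathcal{G}_m$ is the set of normal subgroups of $F_m$ with the topology induced by the product topology on $\{0,1\}^{F_m}$; a point $N$ represents the marked group $F_m/N$. A group $G$ is isolated if it is finitely generated and, for some $m$ and some normal subgroup $N$ of $F_m$ with $F_m/N\cong G$, the point $N$ is isolated in $\mathcal{G}_m$ (this does not depend on the choice of $m$ and $N$). *)

theory Defs
  imports "HOL-Algebra.Generated_Groups" "HOL-Analysis.Function_Topology"
begin

text \<open>
  The free group of rank \<open>m\<close>: reduced words over the letters \<open>(i, b)\<close> with \<open>i < m\<close>, where
  \<open>(i, True)\<close> stands for the \<open>i\<close>-th basis element and \<open>(i, False)\<close> for its inverse. The product
  of two words is their concatenation, freely reduced.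
\<close>

type_synonym letter = "nat \<times> bool"
type_synonym word = "letter list"

definition letter_inv :: "letter \<Rightarrow> letter" where
  "letter_inv x = (fst x, \<not> snd x)"

definition reduced :: "word \<Rightarrow> bool" where
  "reduced w \<longleftrightarrow> successively (\<lambda>x y. y \<noteq> letter_inv x) w"

fun push :: "letter \<Rightarrow> word \<Rightarrow> word" where
  "push x [] = [x]"
| "push x (y # w) = (if y = letter_inv x then w else x # y # w)"

definition free_group :: "nat \<Rightarrow> word monoid" where
  "free_group m =
     \<lparr>carrier = {w. reduced w \<and> fst ` set w \<subseteq> {..<m}},
      mult = (\<lambda>u v. foldr push u v),
      one = []\<rparr>"

lemma letter_inv_inv [simp]: "letter_inv (letter_inv x) = x"
  by (simp add: letter_inv_def)

lemma letter_inv_neq [simp]: "letter_inv x \<noteq> x" "x \<noteq> letter_inv x"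
  by (metis letter_inv_def snd_conv)+

lemma fst_letter_inv [simp]: "fst (letter_inv x) = fst x"
  by (simp add: letter_inv_def)

lemma reduced_push: "reduced w \<Longrightarrow> reduced (push x w)"
  by (cases w) (auto simp: reduced_def successively_Cons)

lemma reduced_foldr_push: "reduced v \<Longrightarrow> reduced (foldr push u v)"
  by (induction u) (auto intro: reduced_push)

lemma letters_push: "set (push x w) \<subseteq> insert x (set w)"
  by (cases w) auto

lemma letters_foldr_push: "set (foldr push u v) \<subseteq> set u \<union> set v"
  by (induction u) (use letters_push in fastforce)+

lemma push_push_letter_inv: "reduced w \<Longrightarrow> push x (push (letter_inv x) w) = w"
  by (cases w; cases "tl w") (auto simp: reduced_def successively_Cons)

lemma foldr_push_push:
  assumes "reduced u" "reduced v"
  shows "foldr push (push x u) v = push x (foldr push u v)"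
proof (cases u)
  case (Cons y u')
  then show ?thesis
    using push_push_letter_inv[OF reduced_foldr_push[OF assms(2)], of x u'] by auto
qed auto

lemma foldr_push_assoc:
  assumes "reduced v" "reduced w"
  shows "foldr push (foldr push u v) w = foldr push u (foldr push v w)"
  using assms by (induction u) (auto simp: foldr_push_push reduced_foldr_push)

lemma foldr_push_Nil: "reduced w \<Longrightarrow> foldr push w [] = w"
proof (induction w)
  case (Cons x w)
  then show ?case
    by (cases w) (auto simp: reduced_def successively_Cons)
qed auto

lemma foldr_push_inverse:
  assumes "reduced v"
  shows "foldr push (map letter_inv (rev u)) (foldr push u v) = v"
  using assms
proof (induction u arbitrary: v)
  case (Cons x u)
  then show ?case
    using push_push_letter_inv[of "foldr push u v" "letter_inv x"]
    by (simp add: reduced_foldr_push)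
qed auto

lemma reduced_inverse:
  assumes "reduced u"
  shows "reduced (map letter_inv (rev u))"
proof -
  have "successively (\<lambda>x y. letter_inv y \<noteq> letter_inv (letter_inv x)) (rev u) \<longleftrightarrow>
        successively (\<lambda>x y. letter_inv x \<noteq> letter_inv (letter_inv y)) u"
    by (simp add: successively_rev)
  moreover have "successively (\<lambda>x y. letter_inv x \<noteq> letter_inv (letter_inv y)) u"
    using assms unfolding reduced_def
    by (rule successively_mono) (auto simp: letter_inv_inv)
  ultimately show ?thesis
    by (simp add: reduced_def successively_map)
qed

lemma group_free_group: "group (free_group m)"
proof (rule groupI)
  fix u assume "u \<in> carrier (free_group m)"
  then show "\<exists>v\<in>carrier (free_group m). v \<otimes>\<^bsub>free_group m\<^esub> u = \<one>\<^bsub>free_group m\<^esub>"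
    using foldr_push_inverse[of "[]" u] reduced_inverse[of u]
    by (intro bexI[of _ "map letter_inv (rev u)"])
       (auto simp: free_group_def foldr_push_Nil reduced_def[of "[]"] image_subset_iff)
next
  fix u v assume "u \<in> carrier (free_group m)" "v \<in> carrier (free_group m)"
  then show "u \<otimes>\<^bsub>free_group m\<^esub> v \<in> carrier (free_group m)"
    using letters_foldr_push[of u v] by (fastforce simp: free_group_def reduced_foldr_push)
qed (auto simp: free_group_def foldr_push_assoc reduced_def[of "[]"])

text \<open>
  The space of groups marked by \<open>m\<close> generators: normal subgroups of the free group, identified
  with their indicator functions in \<open>{0, 1}\<^sup>F\<close>.
\<close>

definition marked_groups :: "nat \<Rightarrow> word set topology" where
  "marked_groups m =
     pullback_topology {N. N \<lhd> free_group m}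
       (\<lambda>N. restrict (\<lambda>w. w \<in> N) (carrier (free_group m)))
       (product_topology (\<lambda>_. discrete_topology (UNIV :: bool set)) (carrier (free_group m)))"

lemma topspace_marked_groups: "topspace (marked_groups m) = {N. N \<lhd> free_group m}"
  by (auto simp: marked_groups_def topspace_pullback_topology)

definition finitely_generated :: "('a, 'b) monoid_scheme \<Rightarrow> bool" where
  "finitely_generated G \<longleftrightarrow>
     (\<exists>S. finite S \<and> S \<subseteq> carrier G \<and> generate G S = carrier G)"

text \<open>
  The groups \<open>free_group m Mod N\<close> are monoids over \<open>word set\<close>, and every finitely generated
  group is isomorphic to one of them. Since being isolated is invariant under isomorphism, it is no
  restriction to look for isolated groups on the type \<open>word set\<close> only.
\<close>

definition isolated_group :: "('a, 'b) monoid_scheme \<Rightarrow> bool" where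
  "isolated_group G \<longleftrightarrow>
     group G \<and> finitely_generated G \<and>
     (\<exists>m N. N \<lhd> free_group m \<and> free_group m Mod N \<cong> G \<and> openin (marked_groups m) {N})"

end

theory Submission
  imports Defs "HOL-Analysis.Product_Vector"
begin

text \<open>
  A finitely generated group is a quotient of a free group of some finite rank \<open>k\<close>, so it suffices to find
  an isolated group that maps onto the free group of rank \<open>k\<close>. A finitely presented group is
  isolated as soon as it has finitely many nontrivial elements such that every nontrivial normal
  subgroup contains one of them: the relators and these elements determine the normal subgroup
  of the free group. The group constructed here is a variant of Abels' solvable group, with room for a
  free group to act.

  Let \<open>\<Gamma>\<close> be the group of transformations of triples \<open>(p, y, z)\<close> in \<open>\<real>\<^sup>2 \<times> \<real> \<times> \<real>\<close> generated by the block upper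
  triangular unipotent transformations with entries in \<open>\<int>[1/2]\<close>, the doublings of \<open>y\<close> and of \<open>z\<close>, and \<open>k\<close>
  integral matrices (\<open>shear\<close>) that act on \<open>p\<close> and generate a free group. The translations of \<open>p\<close> by vectors in
  \<open>\<int>\<^sup>2\<close> form a normal subgroup of \<open>\<Gamma>\<close>, and the quotient by it is the desired group. It maps onto the free
  group by the linear action on \<open>p\<close>. (In the proof, the map to a given group with \<open>k\<close> generators comes from \<open>kernel_trivial\<close>:
  the relations hold there if the shears go to the generators and everything else to the identity.)

  Why is it finitely presented? Each root subgroup is a copy of \<open>\<int>[1/2]\<close> (or its square) that some
  doubling or its inverse contracts, so it is generated by its integral elements and a torus element
  (\<open>dyadic_multiple\<close>). The commutator relations between two root subgroups of linearly independent
  weights follow from one of them by conjugation with the torus (\<open>bracket_dyadic\<close>). The only root of weight zero is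
  that of the translations of \<open>p\<close>. There the torus is of no help, but the translations are commutators in two
  ways, and the Hall-Witt identity relating the two gives all relations (\<open>hall_witt\<close>, \<open>bracket_e14\<close>, \<open>commute_e14\<close>).
  Hence every element has a normal form (\<open>normal_form_ev\<close>), and in \<open>\<Gamma>\<close> the parameters of the normal form are determined
  (\<open>nf_rho_central\<close>, \<open>torus_word_trivial\<close>), the free part by ping-pong (\<open>rho_free\<close>). So no further relations
  are needed (\<open>kernel_trivial\<close>).

  Why does every nontrivial normal subgroup contain one of finitely many elements? Commutators move any nontrivial
  element to a nontrivial translation of \<open>p\<close>, that is, to a nonzero element of \<open>(\<int>[1/2]/\<int>)\<^sup>2\<close>, and this is a
  2-group with only three elements of order two (\<open>meets_half_lattice\<close>). It is for this purpose that
  the lattice \<open>\<int>\<^sup>2\<close> is divided out.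
\<close>

section \<open>Words in an additively written group\<close>

text \<open>
  The commutator calculations below take place in an unknown quotient of a free group. They are carried
  out in the type class \<^class>\<open>group_add\<close>, whose addition need not be commutative, because
  type-class rewriting needs no membership conditions; quotients of free groups enter through their
  regular permutation representation.
\<close>

fun ev :: "(nat \<Rightarrow> 'q::group_add) \<Rightarrow> word \<Rightarrow> 'q" where
  "ev f [] = 0"
| "ev f (l # w) = (if snd l then f (fst l) else - f (fst l)) + ev f w"

lemma ev_append: "ev f (u @ v) = ev f u + ev f v"
  by (induction u) (auto simp: add.assoc)

lemma ev_push: "ev f (push l w) = ev f (l # w)"
  by (cases w) (auto simp: letter_inv_def add.assoc [symmetric])

lemma ev_foldr_push: "ev f (foldr push u v) = ev f u + ev f v"
  by (induction u) (auto simp: ev_push add.assoc)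

lemma ev_inverse: "ev f (map letter_inv (rev u)) = - ev f u"
  by (induction u) (auto simp: ev_append letter_inv_def minus_add)

lemma add_self_eq_0: "(x::'q::group_add) = x + x \<Longrightarrow> x = 0"
  by (metis add.right_neutral add_left_cancel)

lemma ev_hom:
  assumes "\<And>x y. h (x + y) = h x + h y"
  shows "ev (\<lambda>i. h (f i)) w = h (ev f w)"
proof -
  have 0: "h 0 = 0"
    using assms[of 0 0] by (intro add_self_eq_0) simp
  have "h (- x) = - h x" for x
    using assms[of "- x" x] by (simp add: 0 eq_neg_iff_add_eq_0)
  then show ?thesis
    by (induction w) (auto simp: 0 assms)
qed

lemma ev_Pair: "ev (\<lambda>i. (f i, g i)) w = (ev f w, ev g w)"
  by (induction w) (auto simp: zero_prod_def)

definition conj_by :: "'q::group_add \<Rightarrow> 'q \<Rightarrow> 'q" where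
  "conj_by g x = g + x - g"

definition commute :: "'q::group_add \<Rightarrow> 'q \<Rightarrow> bool" where
  "commute x y \<longleftrightarrow> x + y = y + x"

lemma conj_by_add: "conj_by g (x + y) = conj_by g x + conj_by g y"
  by (simp add: conj_by_def add.assoc diff_conv_add_uminus del: add_uminus_conv_diff)

lemma conj_by_0 [simp]: "conj_by g 0 = 0" "conj_by 0 x = x"
  by (simp_all add: conj_by_def)

lemma conj_by_minus: "conj_by g (- x) = - conj_by g x"
  by (metis conj_by_0(1) conj_by_add eq_neg_iff_add_eq_0 neg_eq_iff_add_eq_0 add.left_inverse)

lemma conj_by_plus: "conj_by (g + h) x = conj_by g (conj_by h x)"
  by (simp add: conj_by_def add.assoc diff_conv_add_uminus minus_add del: add_uminus_conv_diff)

lemma conj_by_cancel [simp]: "conj_by (- g) (conj_by g x) = x" "conj_by g (conj_by (- g) x) = x"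
  by (simp_all flip: conj_by_plus)

lemma conj_by_inj: "conj_by g x = conj_by g y \<longleftrightarrow> x = y"
  by (metis conj_by_cancel(1))

lemma conj_by_eq_iff: "conj_by g x = y \<longleftrightarrow> g + x = y + g"
  by (auto simp: conj_by_def diff_eq_eq)

lemma commute_iff_conj_by: "commute g x \<longleftrightarrow> conj_by g x = x"
  by (simp add: conj_by_eq_iff commute_def)

lemma commute_sym: "commute x y \<longleftrightarrow> commute y x"
  by (auto simp: commute_def)

lemma commute_refl [simp]: "commute x x"
  by (simp add: commute_def)

lemma commute_0 [simp]: "commute x 0" "commute 0 x"
  by (simp_all add: commute_def)

lemma commute_add: "commute x y \<Longrightarrow> commute x z \<Longrightarrow> commute x (y + z)"
  by (simp add: commute_iff_conj_by conj_by_add)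

lemma commute_add_left: "commute y x \<Longrightarrow> commute z x \<Longrightarrow> commute (y + z) x"
  by (metis commute_add commute_sym)

lemma commute_minus: "commute x y \<Longrightarrow> commute x (- y)"
  by (simp add: commute_iff_conj_by conj_by_minus)

lemma commute_minus_left: "commute x y \<Longrightarrow> commute (- x) y"
  by (metis commute_minus commute_sym)

lemma commute_conj_by: "commute (conj_by g x) (conj_by g y) \<longleftrightarrow> commute x y"
  by (simp add: commute_def conj_by_inj flip: conj_by_add)

lemma conj_by_commute: "commute g h \<Longrightarrow> conj_by g (conj_by h x) = conj_by h (conj_by g x)"
  by (metis conj_by_plus commute_def)

text \<open>
  Conjugation by \<open>g\<close> is an automorphism, hence compatible with the conjugation action itself.
\<close>

lemma conj_by_distrib: "conj_by g (conj_by x y) = conj_by (conj_by g x) (conj_by g y)"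
proof -
  have "conj_by g x + g = g + x"
    by (simp add: conj_by_def)
  then show ?thesis
    by (metis conj_by_plus)
qed

lemma commute_commutator:
  assumes "commute g x" "commute g y"
  shows "commute g (conj_by x y - y)"
proof -
  have "commute g (conj_by x y)"
    using assms by (metis commute_iff_conj_by conj_by_distrib)
  then show ?thesis
    using assms(2) by (metis commute_add commute_minus diff_conv_add_uminus)
qed

lemma commute_shift: "commute g x \<Longrightarrow> g + (x + z) = x + (g + z)"
  by (metis commute_def add.assoc)

text \<open>
  With \<open>commute_shift\<close>, this moves a generator from left to right through a product that is
  associated to the right, leaving commutators behind.
\<close>

lemma bracket_shift: "conj_by x g = y + g \<Longrightarrow> g + (x + z) = - y + (x + (g + z))"
proof -
  assume "conj_by x g = y + g"
  then have "x + g = y + (g + x)"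
    by (simp add: conj_by_eq_iff add.assoc)
  then have "x + (g + z) = y + (g + x) + z"
    by (simp flip: add.assoc)
  then show ?thesis
    by (simp add: add.assoc)
qed

lemma conj_by_shift: "g + (x + z) = conj_by g x + (g + z)"
  by (simp add: conj_by_def flip: add.assoc)

section \<open>Integer multiples\<close>

definition zmul :: "int \<Rightarrow> 'q::group_add \<Rightarrow> 'q" where
  "zmul n x = (if n \<ge> 0 then ((+) x ^^ nat n) 0 else - (((+) x ^^ nat (- n)) 0))"

lemma zmul_0 [simp]: "zmul 0 x = 0"
  by (simp add: zmul_def)

lemma zmul_1 [simp]: "zmul 1 x = x"
  by (simp add: zmul_def)

lemma commute_funpow_add: "commute y x \<Longrightarrow> commute y (((+) x ^^ n) 0)"
  by (induction n) (auto intro: commute_add)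

lemma zmul_plus_1: "zmul (n + 1) x = x + zmul n x"
proof (cases "n \<ge> 0")
  case True
  then show ?thesis
    by (simp add: zmul_def nat_add_distrib)
next
  case False
  define m where "m = nat (- n - 1)"
  have n: "n = - int m - 1"
    using False by (simp add: m_def)
  have "commute x (((+) x ^^ m) 0)"
    by (rule commute_funpow_add) simp
  then have "x + - (x + ((+) x ^^ m) 0) = - (((+) x ^^ m) 0)"
    by (metis add_minus_cancel commute_def minus_add)
  moreover have "nat (1 + int m) = Suc m"
    by simp
  ultimately show ?thesis
    by (auto simp: n zmul_def simp del: add_uminus_conv_diff)
qed

lemma zmul_minus_1: "zmul (n - 1) x = - x + zmul n x"
  using zmul_plus_1[of "n - 1" x] by simp

lemma zmul_add: "zmul (m + n) x = zmul m x + zmul n x"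
proof (induction m rule: int_induct[where k = 0])
  case (step1 i)
  have "i + 1 + n = (i + n) + 1"
    by simp
  then show ?case
    using step1(2) by (metis zmul_plus_1 add.assoc)
next
  case (step2 i)
  have "i - 1 + n = (i + n) - 1"
    by simp
  then show ?case
    using step2(2) by (metis zmul_minus_1 add.assoc)
qed simp

lemma zmul_hom:
  assumes "\<And>x y. h (x + y) = h x + h y"
  shows "h (zmul n x) = zmul n (h x)"
proof -
  have 0: "h 0 = 0"
    using assms[of 0 0] by (intro add_self_eq_0) simp
  have *: "h (- x) = - h x" for x
    using assms[of "- x" x] by (simp add: 0 eq_neg_iff_add_eq_0)
  show ?thesis
    by (induction n rule: int_induct[where k = 0])
      (simp_all only: zmul_0 0 zmul_plus_1 zmul_minus_1 assms *)
qed

lemma conj_by_zmul: "conj_by g (zmul n x) = zmul n (conj_by g x)"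
  by (rule zmul_hom) (rule conj_by_add)

lemma commute_zmul: "commute x y \<Longrightarrow> commute x (zmul n y)"
  by (simp add: commute_iff_conj_by conj_by_zmul)

lemma zmul_double: "zmul (2 * n) x = zmul n (x + x)"
proof -
  have *: "zmul (2 * n) x = zmul n x + zmul n x"
    using zmul_add[of n n x] by simp
  have "zmul n x + zmul n x = zmul n (x + x)"
  proof (induction n rule: int_induct[where k = 0])
    case (step1 i)
    have "commute x (zmul i x)"
      by (simp add: commute_zmul)
    then show ?case
      using step1 by (simp add: zmul_plus_1 commute_def add.assoc) (metis add.assoc)
  next
    case (step2 i)
    have "commute (- x) (zmul i x)"
      by (simp add: commute_zmul commute_minus_left)
    then show ?case
      using step2 by (simp only: zmul_minus_1 commute_def add.assoc minus_add) (metis add.assoc)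
  qed simp
  with * show ?thesis
    by simp
qed

section \<open>Dyadic multiples\<close>

definition dyadic :: "real set" where
  "dyadic = {r. \<exists>(n::int) (k::nat). r = n / 2 ^ k}"

lemma dyadic_quotient [simp]: "of_int n / 2 ^ k \<in> dyadic"
  by (auto simp: dyadic_def)

lemma dyadic_of_int [simp]: "of_int n \<in> dyadic"
  using dyadic_quotient[of n 0] by simp

lemma dyadic_simps [simp]: "0 \<in> dyadic" "1 \<in> dyadic" "numeral j \<in> dyadic" "1 / 2 ^ k \<in> dyadic"
  using dyadic_of_int[of 0] dyadic_of_int[of 1] dyadic_of_int[of "numeral j"]
    dyadic_quotient[of 1 k] by simp_all

lemma dyadic_common:
  assumes "r \<in> dyadic" "s \<in> dyadic"
  obtains m n :: int and k :: nat where "r = m / 2 ^ k" "s = n / 2 ^ k"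
proof -
  obtain m i n j where "r = of_int m / 2 ^ i" "s = of_int n / 2 ^ j"
    using assms by (auto simp: dyadic_def)
  then have "r = of_int (m * 2 ^ j) / 2 ^ (i + j)" "s = of_int (n * 2 ^ i) / 2 ^ (i + j)"
    by (simp_all add: power_add)
  then show ?thesis
    by (rule that)
qed

lemma dyadic_add [simp]: "r \<in> dyadic \<Longrightarrow> s \<in> dyadic \<Longrightarrow> r + s \<in> dyadic"
  by (erule (1) dyadic_common) (metis add_divide_distrib dyadic_quotient of_int_add)

lemma dyadic_mult [simp]: "r \<in> dyadic \<Longrightarrow> s \<in> dyadic \<Longrightarrow> r * s \<in> dyadic"
proof -
  have "of_int m / 2 ^ i * (of_int n / 2 ^ j) = (of_int (m * n) / 2 ^ (i + j) :: real)" for m n i j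
    by (simp add: power_add)
  then show "r \<in> dyadic \<Longrightarrow> s \<in> dyadic \<Longrightarrow> r * s \<in> dyadic"
    unfolding dyadic_def mem_Collect_eq by (metis (no_types))
qed

lemma dyadic_minus [simp]: "r \<in> dyadic \<Longrightarrow> - r \<in> dyadic"
  using dyadic_mult[of "of_int (- 1)" r] dyadic_of_int[of "- 1"] by simp

lemma dyadic_diff [simp]: "r \<in> dyadic \<Longrightarrow> s \<in> dyadic \<Longrightarrow> r - s \<in> dyadic"
  using dyadic_add[of r "- s"] by simp

lemma dyadic_divide_power [simp]: "r \<in> dyadic \<Longrightarrow> r / 2 ^ k \<in> dyadic"
  using dyadic_mult[of r "1 / 2 ^ k"] by simp

lemma dyadic_half [simp]: "r \<in> dyadic \<Longrightarrow> r / 2 \<in> dyadic"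
  using dyadic_divide_power[of r 1] by simp

definition dyadic_hom :: "(real \<Rightarrow> 'q::group_add) \<Rightarrow> bool" where
  "dyadic_hom f \<longleftrightarrow> (\<forall>r\<in>dyadic. \<forall>s\<in>dyadic. f (r + s) = f r + f s)"

lemma dyadic_homD: "dyadic_hom f \<Longrightarrow> r \<in> dyadic \<Longrightarrow> s \<in> dyadic \<Longrightarrow> f (r + s) = f r + f s"
  by (simp add: dyadic_hom_def)

lemma dyadic_hom_0: "dyadic_hom f \<Longrightarrow> f 0 = 0"
  using dyadic_homD[of f 0 0] by (intro add_self_eq_0) simp

lemma dyadic_hom_minus: "dyadic_hom f \<Longrightarrow> r \<in> dyadic \<Longrightarrow> f (- r) = - f r"
  using dyadic_homD[of f "- r" r] by (simp add: dyadic_hom_0 eq_neg_iff_add_eq_0)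

lemma dyadic_hom_zmul:
  assumes "dyadic_hom f" "r \<in> dyadic"
  shows "f (of_int n * r) = zmul n (f r)"
proof (induction n rule: int_induct[where k = 0])
  case (step1 i)
  have "of_int (i + 1) * r = r + of_int i * r"
    by (simp add: distrib_right)
  moreover have "f (r + of_int i * r) = f r + f (of_int i * r)"
    using assms by (intro dyadic_homD) auto
  ultimately show ?case
    using step1 by (simp only: zmul_plus_1)
next
  case (step2 i)
  have "of_int (i - 1) * r = - r + of_int i * r"
    by (simp add: left_diff_distrib)
  moreover have "f (- r + of_int i * r) = f (- r) + f (of_int i * r)"
    using assms by (intro dyadic_homD) auto
  ultimately show ?case
    using step2 assms by (simp only: zmul_minus_1 dyadic_hom_minus)
qed (use assms in \<open>simp add: dyadic_hom_0\<close>)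

text \<open>
  The group of dyadic rationals is generated by the powers of one half.
\<close>

lemma dyadic_hom_eqI:
  assumes "dyadic_hom f" "dyadic_hom g" "\<And>k. f (1 / 2 ^ k) = g (1 / 2 ^ k)" "r \<in> dyadic"
  shows "f r = g r"
proof -
  obtain n k where r: "r = of_int n * (1 / 2 ^ k)"
    using assms(4) by (auto simp: dyadic_def)
  show ?thesis
    unfolding r using assms(1-3) by (simp only: dyadic_hom_zmul dyadic_simps)
qed

lemma dyadic_hom_conj_by: "dyadic_hom f \<Longrightarrow> dyadic_hom (\<lambda>r. conj_by g (f r))"
  by (simp add: dyadic_hom_def conj_by_add)

lemma dyadic_hom_scale: "dyadic_hom f \<Longrightarrow> s \<in> dyadic \<Longrightarrow> dyadic_hom (\<lambda>r. f (r * s))"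
  by (simp add: dyadic_hom_def distrib_right)

lemma dyadic_hom_scale_left: "dyadic_hom f \<Longrightarrow> s \<in> dyadic \<Longrightarrow> dyadic_hom (\<lambda>r. f (s * r))"
  by (simp add: dyadic_hom_def distrib_left)

lemma dyadic_hom_add:
  assumes "dyadic_hom f" "dyadic_hom g" "\<And>r s. r \<in> dyadic \<Longrightarrow> s \<in> dyadic \<Longrightarrow> commute (g s) (f r)"
  shows "dyadic_hom (\<lambda>r. f r + g r)"
  unfolding dyadic_hom_def
proof (intro ballI)
  fix r s assume rs: "r \<in> dyadic" "s \<in> dyadic"
  have "f s + g r = g r + f s"
    using assms(3) rs by (simp add: commute_def)
  then show "f (r + s) + g (r + s) = f r + g r + (f s + g s)"
    using assms(1,2) rs by (simp add: dyadic_homD add.assoc) (metis add.assoc)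
qed

text \<open>
  If \<open>s\<close> halves \<open>x\<close>, that is, \<open>s + (x + x) - s = x\<close>, then \<open>x\<close> has a \<open>2\<^sup>k\<close>-th part, namely its
  \<open>k\<close>-fold conjugate by \<open>s\<close>, and \<open>x\<close> and its conjugates generate an image of the group of dyadic
  rationals. So a single relation provides a whole one-parameter subgroup: \<open>r\<close> is sent to
  the multiple of \<open>x\<close> by \<open>r\<close>. The least exponent serves only to make a choice; any exponent gives the
  same value (\<open>dyadic_multiple_quotient\<close>).
\<close>

definition dyadic_multiple :: "'q::group_add \<Rightarrow> 'q \<Rightarrow> real \<Rightarrow> 'q" where
  "dyadic_multiple s x r = (let k = LEAST k. r * 2 ^ k \<in> \<int> in (conj_by s ^^ k) (zmul \<lfloor>r * 2 ^ k\<rfloor> x))"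

lemma conj_by_funpow_add: "(conj_by s ^^ k) (x + y) = (conj_by s ^^ k) x + (conj_by s ^^ k) y"
  by (induction k) (simp_all add: conj_by_add)

lemma conj_by_funpow_double:
  assumes "conj_by s (x + x) = x"
  shows "(conj_by s ^^ k) (zmul (n * 2 ^ k) x) = zmul n x"
proof (induction k)
  case (Suc k)
  have "zmul (n * 2 ^ Suc k) x = zmul (n * 2 ^ k) (x + x)"
    using zmul_double[of "n * 2 ^ k" x] by (simp add: algebra_simps)
  then have "(conj_by s ^^ Suc k) (zmul (n * 2 ^ Suc k) x) = (conj_by s ^^ k) (zmul (n * 2 ^ k) (conj_by s (x + x)))"
    by (simp add: funpow_swap1 conj_by_zmul)
  then show ?case
    using Suc assms by simp
qed simp

lemma dyadic_multiple_quotient: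
  assumes "conj_by s (x + x) = x"
  shows "dyadic_multiple s x (of_int n / 2 ^ k) = (conj_by s ^^ k) (zmul n x)"
proof -
  define r :: real where "r = of_int n / 2 ^ k"
  define K where "K = (LEAST k. r * 2 ^ k \<in> \<int>)"
  have k: "r * 2 ^ k \<in> \<int>"
    by (simp add: r_def)
  have "r * 2 ^ K \<in> \<int>" "K \<le> k"
    using LeastI[of "\<lambda>k. r * 2 ^ k \<in> \<int>", OF k] Least_le[of "\<lambda>k. r * 2 ^ k \<in> \<int>", OF k] by (simp_all add: K_def)
  then obtain m j where m: "r * 2 ^ K = of_int m" and j: "k = K + j"
    by (metis Ints_cases le_Suc_ex)
  have "real_of_int n = r * 2 ^ k"
    by (simp add: r_def)
  also have "\<dots> = of_int (m * 2 ^ j)"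
    using m by (simp add: j power_add flip: mult.assoc)
  finally have n: "n = m * 2 ^ j"
    by linarith
  have "dyadic_multiple s x r = (conj_by s ^^ K) (zmul m x)"
    by (simp add: dyadic_multiple_def Let_def flip: K_def) (simp add: m)
  also have "\<dots> = (conj_by s ^^ k) (zmul n x)"
    using assms by (simp add: j n funpow_add conj_by_funpow_double)
  finally show ?thesis
    by (simp add: r_def)
qed

lemma dyadic_multiple_1 [simp]: "conj_by s (x + x) = x \<Longrightarrow> dyadic_multiple s x 1 = x"
  using dyadic_multiple_quotient[of s x 1 0] by simp

lemma dyadic_hom_dyadic_multiple:
  assumes "conj_by s (x + x) = x"
  shows "dyadic_hom (dyadic_multiple s x)"
  unfolding dyadic_hom_def
proof (intro ballI)
  fix p q assume "p \<in> dyadic" "q \<in> dyadic"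
  then obtain m n k where pq: "p = of_int m / 2 ^ k" "q = of_int n / 2 ^ k"
    by (rule dyadic_common)
  then have "p + q = of_int (m + n) / 2 ^ k"
    by (simp add: add_divide_distrib)
  with pq assms show "dyadic_multiple s x (p + q) = dyadic_multiple s x p + dyadic_multiple s x q"
    by (simp only: dyadic_multiple_quotient zmul_add conj_by_funpow_add)
qed

lemma conj_by_dyadic_multiple_half:
  assumes "conj_by s (x + x) = x" "r \<in> dyadic"
  shows "conj_by s (dyadic_multiple s x r) = dyadic_multiple s x (r / 2)"
proof -
  obtain n k where "r = of_int n / 2 ^ k"
    using assms(2) by (auto simp: dyadic_def)
  moreover from this have "r / 2 = of_int n / 2 ^ Suc k"
    by simp
  ultimately show ?thesis
    using assms(1) by (simp only: dyadic_multiple_quotient) simp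
qed

text \<open>
  This serves to rescale the generator \<open>x\<close> and to recognise the dyadic multiples in concrete groups.
\<close>

lemma dyadic_multiple_unique:
  assumes f: "dyadic_hom f" "\<And>r. r \<in> dyadic \<Longrightarrow> conj_by s (f r) = f (r / 2)" "f 1 = x"
    and r: "r \<in> dyadic"
  shows "dyadic_multiple s x r = f r"
proof -
  have x: "conj_by s (x + x) = x"
    using f(1,3) f(2)[of 2] dyadic_homD[of f 1 1] by simp
  have "dyadic_multiple s x (1 / 2 ^ k) = f (1 / 2 ^ k)" for k
  proof (induction k)
    case (Suc k)
    then have "conj_by s (dyadic_multiple s x (1 / 2 ^ k)) = conj_by s (f (1 / 2 ^ k))"
      by simp
    then show ?case
      using f(2)[of "1 / 2 ^ k"] conj_by_dyadic_multiple_half[OF x, of "1 / 2 ^ k"] by (simp add: field_simps)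
  qed (simp add: x f(3))
  then show ?thesis
    using dyadic_hom_eqI[OF dyadic_hom_dyadic_multiple[OF x] f(1)] r by blast
qed

lemma dyadic_multiple_dyadic_multiple:
  assumes "conj_by s (x + x) = x" "q \<in> dyadic" "r \<in> dyadic"
  shows "dyadic_multiple s (dyadic_multiple s x q) r = dyadic_multiple s x (r * q)"
proof (rule dyadic_multiple_unique[of "\<lambda>r. dyadic_multiple s x (r * q)"])
  show "conj_by s (dyadic_multiple s x (r * q)) = dyadic_multiple s x (r / 2 * q)" if "r \<in> dyadic" for r
    using conj_by_dyadic_multiple_half[OF assms(1), of "r * q"] that assms(2) by simp
  show "dyadic_hom (\<lambda>r. dyadic_multiple s x (r * q))"
    using assms by (intro dyadic_hom_scale dyadic_hom_dyadic_multiple)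
qed (use assms in simp_all)

lemma conj_by_dyadic_multiple:
  assumes "commute g s"
  shows "conj_by g (dyadic_multiple s x r) = dyadic_multiple s (conj_by g x) r"
proof -
  have "conj_by g ((conj_by s ^^ k) y) = (conj_by s ^^ k) (conj_by g y)" for k y
  proof (induction k)
    case (Suc k)
    then show ?case
      using conj_by_commute[OF assms, of "(conj_by s ^^ k) y"] by simp
  qed simp
  then show ?thesis
    by (simp add: dyadic_multiple_def Let_def conj_by_zmul)
qed

text \<open>
  Two one-parameter subgroups contracted by the same element commute as soon as their generators do:
  any two of their elements lie in a common conjugate of the subgroup generated by \<open>x\<close> and \<open>y\<close>.
\<close>

lemma commute_dyadic_multiple:
  assumes "conj_by s (x + x) = x" "conj_by s (y + y) = y" "commute x y" "p \<in> dyadic" "q \<in> dyadic"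
  shows "commute (dyadic_multiple s x p) (dyadic_multiple s y q)"
proof -
  obtain m n k where "p = of_int m / 2 ^ k" "q = of_int n / 2 ^ k"
    using assms(4,5) by (rule dyadic_common)
  moreover have "commute (zmul m x) (zmul n y)"
    using assms(3) by (metis commute_zmul commute_sym)
  then have "commute ((conj_by s ^^ k) (zmul m x)) ((conj_by s ^^ k) (zmul n y))"
    by (induction k) (simp_all add: commute_conj_by)
  ultimately show ?thesis
    using assms(1,2) by (simp only: dyadic_multiple_quotient)
qed

lemma dyadic_multiple_map:
  assumes "\<And>x y. h (x + y) = h x + h y"
  shows "h (dyadic_multiple s x r) = dyadic_multiple (h s) (h x) r"
proof -
  have 0: "h 0 = 0"
    using assms[of 0 0] by (intro add_self_eq_0) simp
  have m: "h (- x) = - h x" for x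
    using assms[of "- x" x] by (simp add: 0 eq_neg_iff_add_eq_0)
  have c: "h (conj_by g y) = conj_by (h g) (h y)" for g y
    using assms m by (simp add: conj_by_def diff_conv_add_uminus del: add_uminus_conv_diff)
  have "h ((conj_by s ^^ k) y) = (conj_by (h s) ^^ k) (h y)" for k y
    by (induction k) (simp_all add: c)
  then show ?thesis
    using zmul_hom[of h, OF assms] by (simp add: dyadic_multiple_def Let_def)
qed

text \<open>
  The key to finite presentability. Suppose that some element \<open>\<sigma>\<close> scales the one-parameter subgroup \<open>f\<close> and
  fixes \<open>g\<close>, and another element \<open>\<tau>\<close> fixes \<open>f\<close> and scales \<open>g\<close>. Conjugating one commutator relation
  between \<open>f 1\<close> and \<open>g 1\<close> by \<open>\<sigma>\<close> and \<open>\<tau>\<close> yields the relation for \<open>f (2\<^sup>-\<^sup>i)\<close> and \<open>g (2\<^sup>-\<^sup>j)\<close> for all \<open>i\<close> and \<open>j\<close>;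
  bilinearity of the commutator, available since its values \<open>h\<close> commute with \<open>f\<close> and \<open>g\<close>, yields
  all others.
\<close>

lemma bracket_dyadic:
  assumes hom: "dyadic_hom f" "dyadic_hom g" "dyadic_hom h"
    and comm: "\<And>r s. r \<in> dyadic \<Longrightarrow> s \<in> dyadic \<Longrightarrow> commute (f r) (h s)"
      "\<And>r s. r \<in> dyadic \<Longrightarrow> s \<in> dyadic \<Longrightarrow> commute (g r) (h s)"
    and sigma: "\<And>r. r \<in> dyadic \<Longrightarrow> conj_by \<sigma> (f r) = f (r / 2)"
      "\<And>r. r \<in> dyadic \<Longrightarrow> conj_by \<sigma> (g r) = g r"
      "\<And>r. r \<in> dyadic \<Longrightarrow> conj_by \<sigma> (h r) = h (r / 2)"
    and tau: "\<And>r. r \<in> dyadic \<Longrightarrow> conj_by \<tau> (f r) = f r"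
      "\<And>r. r \<in> dyadic \<Longrightarrow> conj_by \<tau> (g r) = g (r / 2)"
      "\<And>r. r \<in> dyadic \<Longrightarrow> conj_by \<tau> (h r) = h (r / 2)"
    and base: "conj_by (f 1) (g 1) = h 1 + g 1"
    and "r \<in> dyadic" "s \<in> dyadic"
  shows "conj_by (f r) (g s) = h (r * s) + g s"
proof -
  \<comment> \<open>The commutator relation is symmetric in \<open>f\<close> and \<open>g\<close>, so additivity can be used in either variable.\<close>
  have flip: "conj_by (f r) (g s) = h (r * s) + g s \<longleftrightarrow> conj_by (- g s) (f r) = h (r * s) + f r"
    if "r \<in> dyadic" "s \<in> dyadic" for r s
  proof -
    have "h (r * s) + g s = g s + h (r * s)"
      using that comm(2)[of s "r * s"] by (simp add: commute_def)
    then have "h (r * s) + g s + f r = g s + (h (r * s) + f r)"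
      by (simp only: add.assoc)
    then have "f r + g s = h (r * s) + g s + f r \<longleftrightarrow> - g s + (f r + g s) = h (r * s) + f r"
      by (metis add_minus_cancel minus_add_cancel)
    moreover have "conj_by (- g s) (f r) = - g s + (f r + g s)"
      by (simp add: conj_by_def add.assoc)
    ultimately show ?thesis
      unfolding conj_by_eq_iff[of "f r"] by simp
  qed
  have step: "conj_by (f (1 / 2 ^ i)) (g (1 / 2 ^ j)) = h (1 / 2 ^ i * (1 / 2 ^ j)) + g (1 / 2 ^ j)" for i j
  proof (induction i)
    case 0
    show ?case
    proof (induction j)
      case 0
      then show ?case
        using base by simp
    next
      case (Suc j)
      have "conj_by \<tau> (f 1) = f 1" "conj_by \<tau> (g (1 / 2 ^ j)) = g (1 / 2 ^ Suc j)"
        "conj_by \<tau> (h (1 / 2 ^ 0 * (1 / 2 ^ j))) = h (1 / 2 ^ 0 * (1 / 2 ^ Suc j))"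
        using tau(1)[of 1] tau(2,3)[of "1 / 2 ^ j"] by (simp_all add: mult.commute)
      then show ?case
        using arg_cong[OF Suc, of "conj_by \<tau>"]
        by (simp only: conj_by_distrib[of \<tau>] conj_by_add power_0 div_by_1)
    qed
  next
    case (Suc i)
    have "conj_by \<sigma> (f (1 / 2 ^ i)) = f (1 / 2 ^ Suc i)"
      "conj_by \<sigma> (g (1 / 2 ^ j)) = g (1 / 2 ^ j)"
      "conj_by \<sigma> (h (1 / 2 ^ i * (1 / 2 ^ j))) = h (1 / 2 ^ Suc i * (1 / 2 ^ j))"
      using sigma(1)[of "1 / 2 ^ i"] sigma(2)[of "1 / 2 ^ j"]
        sigma(3)[OF dyadic_mult[OF dyadic_simps(4)[of i] dyadic_simps(4)[of j]]]
      by (simp_all add: mult_ac)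
    then show ?case
      using arg_cong[OF Suc, of "conj_by \<sigma>"]
      by (simp only: conj_by_distrib[of \<sigma>] conj_by_add)
  qed
  have "conj_by (f r) (g (1 / 2 ^ j)) = h (r * (1 / 2 ^ j)) + g (1 / 2 ^ j)" for j
  proof -
    have "conj_by (- g (1 / 2 ^ j)) (f r) = h (r * (1 / 2 ^ j)) + f r"
    proof (rule dyadic_hom_eqI[of "\<lambda>r. conj_by (- g (1 / 2 ^ j)) (f r)" "\<lambda>r. h (r * (1 / 2 ^ j)) + f r"])
      show "dyadic_hom (\<lambda>r. h (r * (1 / 2 ^ j)) + f r)"
        using hom comm(1) by (intro dyadic_hom_add dyadic_hom_scale) auto
      show "conj_by (- g (1 / 2 ^ j)) (f (1 / 2 ^ i)) = h (1 / 2 ^ i * (1 / 2 ^ j)) + f (1 / 2 ^ i)" for i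
        using step flip dyadic_simps(4) by metis
      show "dyadic_hom (\<lambda>r. conj_by (- g (1 / 2 ^ j)) (f r))"
        using hom(1) by (rule dyadic_hom_conj_by)
    qed fact
    then show ?thesis
      using flip[of r "1 / 2 ^ j"] \<open>r \<in> dyadic\<close> by simp
  qed
  note * = this
  show ?thesis
  proof (rule dyadic_hom_eqI[of "\<lambda>s. conj_by (f r) (g s)" "\<lambda>s. h (r * s) + g s"])
    show "dyadic_hom (\<lambda>s. h (r * s) + g s)"
      using hom comm(2) \<open>r \<in> dyadic\<close>
      by (intro dyadic_hom_add dyadic_hom_scale_left) auto
    show "dyadic_hom (\<lambda>s. conj_by (f r) (g s))"
      using hom(2) by (rule dyadic_hom_conj_by)
  qed (fact *, fact)
qed

text \<open>
  The case of trivial commutators.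
\<close>

lemma commute_dyadic:
  fixes g h :: "real \<Rightarrow> 'q::group_add"
  assumes "dyadic_hom g" "dyadic_hom h"
    and "\<And>r. r \<in> dyadic \<Longrightarrow> conj_by \<sigma> (g r) = g (r / 2)" "\<And>r. r \<in> dyadic \<Longrightarrow> conj_by \<sigma> (h r) = h r"
    and "\<And>r. r \<in> dyadic \<Longrightarrow> conj_by \<tau> (g r) = g r" "\<And>r. r \<in> dyadic \<Longrightarrow> conj_by \<tau> (h r) = h (r / 2)"
    and "commute (g 1) (h 1)" "r \<in> dyadic" "s \<in> dyadic"
  shows "commute (g r) (h s)"
proof -
  have 0: "dyadic_hom (\<lambda>_. 0 :: 'q)"
    by (simp add: dyadic_hom_def)
  have "conj_by (g r) (h s) = 0 + h s"
    by (rule bracket_dyadic[of g h "\<lambda>_. 0" \<sigma> \<tau> r s])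
      (use assms 0 in \<open>simp_all flip: commute_iff_conj_by\<close>)
  then show ?thesis
    by (simp add: commute_iff_conj_by)
qed

section \<open>The defining relations\<close>

lemma scaleR_dyadic: "r \<in> dyadic \<Longrightarrow> v \<in> dyadic \<times> dyadic \<Longrightarrow> r *\<^sub>R v \<in> dyadic \<times> dyadic"
  by auto

text \<open>
  The free group acts on the plane by conjugates of a parabolic matrix: in the coordinates
  \<open>h = fst v - j * snd v\<close> and \<open>snd v\<close>, the map \<open>shear j True\<close> fixes \<open>h\<close> and adds \<open>6 * h\<close> to \<open>snd v\<close>. Its fixed
  vectors are the multiples of \<open>(j, 1)\<close>, a different line for each \<open>j\<close>, and the factor \<open>6\<close> is large enough
  for a ping-pong argument with cones around these lines.
\<close>

definition shear :: "nat \<Rightarrow> bool \<Rightarrow> real \<times> real \<Rightarrow> real \<times> real" where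
  "shear j s v = (let h = (if s then 6 else - 6) * (fst v - real j * snd v)
                  in (fst v + real j * h, snd v + h))"

lemma shear_add: "shear j s (v + w) = shear j s v + shear j s w"
  by (simp add: shear_def Let_def prod_eq_iff algebra_simps)

lemma shear_cancel [simp]: "shear j (\<not> s) (shear j s v) = v" "shear j s (shear j (\<not> s) v) = v"
  by (simp_all add: shear_def Let_def prod_eq_iff algebra_simps)

lemma shear_dyadic: "v \<in> dyadic \<times> dyadic \<Longrightarrow> shear j s v \<in> dyadic \<times> dyadic"
  using dyadic_of_int[of "int j"] by (auto simp: shear_def Let_def mem_Times_iff)

text \<open>
  The letters stand for the following transformations of triples \<open>(p, y, z)\<close> with a vector \<open>p\<close> in the plane
  and two numbers \<open>y\<close> and \<open>z\<close>.
  \<^item> \<open>0\<close> and \<open>1\<close> add \<open>y\<close>, and \<open>6\<close> and \<open>7\<close> add \<open>z\<close>, to the first or second coordinate of \<open>p\<close>.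
  \<^item> \<open>2\<close> adds \<open>z\<close> to \<open>y\<close>, \<open>8\<close> adds \<open>1\<close> to \<open>y\<close>, and \<open>3\<close> adds \<open>1\<close> to \<open>z\<close>.
  \<^item> \<open>4\<close> doubles \<open>y\<close> and \<open>5\<close> doubles \<open>z\<close>; these two span the torus.
  \<^item> \<open>9 + j\<close> applies \<open>shear j\<close> to \<open>p\<close>.

  Numbering the blocks of the corresponding matrices by \<open>p, y, z, 1\<close>, the letters \<open>0\<close> and \<open>1\<close> generate the root
  subgroup \<open>12\<close>, the letters \<open>6\<close> and \<open>7\<close> the root subgroup \<open>13\<close>, and \<open>2\<close>, \<open>8\<close>, \<open>3\<close> the root subgroups \<open>23\<close>, \<open>24\<close>, \<open>34\<close>.
\<close>

definition commuting_letters :: "(nat \<times> nat) list" where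
  "commuting_letters =
    [(0, 1), (0, 3), (0, 5), (0, 6), (0, 7), (1, 3), (1, 5), (1, 6), (1, 7), (2, 6), (2, 7), (2, 8),
     (3, 4), (3, 8), (4, 5), (4, 6), (4, 7), (5, 8), (6, 7), (6, 8), (7, 8)]"

text \<open>
  Besides commutation, the relations say which torus element halves or doubles a root generator,
  list the three nontrivial commutators of generators, let the shears fix what they have to fix, and
  record their effect on the root \<open>12\<close> by the matrix with rows \<open>(1 + 6 * j, - 6 * j * j)\<close> and \<open>(6, 1 - 6 * j)\<close>. Their effect
  on the other roots is a consequence.
\<close>

definition relations :: "nat \<Rightarrow> (word \<times> word) set" where
  "relations k =
    (\<lambda>(i, j). ([(i, True), (j, True)], [(j, True), (i, True)])) ` set commuting_letters
    \<union> {([(4, True), (i, True), (i, True)], [(i, True), (4, True)]) | i. i \<in> {0, 1}}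
    \<union> {([(5, True), (i, True), (i, True)], [(i, True), (5, True)]) | i. i \<in> {2, 6, 7}}
    \<union> {([(4, True), (i, True)], [(i, True), (i, True), (4, True)]) | i. i \<in> {2, 8}}
    \<union> {([(5, True), (3, True)], [(3, True), (3, True), (5, True)])}
    \<union> {([(0, True), (2, True)], [(6, True), (2, True), (0, True)]),
       ([(1, True), (2, True)], [(7, True), (2, True), (1, True)]),
       ([(2, True), (3, True)], [(8, True), (3, True), (2, True)])}
    \<union> {([(9 + j, True), (i, True)], [(i, True), (9 + j, True)]) | i j. i \<in> {2, 3, 4, 5} \<and> j < k}
    \<union> {([(9 + j, True), (0, True)],
        replicate (1 + 6 * j) (0, True) @ replicate 6 (1, True) @ [(9 + j, True)]) | j. j < k}
    \<union> {([(9 + j, True), (1, True)],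
        replicate (6 * j * j) (0, False) @ replicate (6 * j) (1, False) @ [(1, True), (9 + j, True)]) | j. j < k}"

lemma finite_relations: "finite (relations k)"
proof -
  have "finite {g i j | i j. P i \<and> j < k}" if "finite {i. P i}" for g :: "nat \<Rightarrow> nat \<Rightarrow> word \<times> word" and P
  proof -
    have "{g i j | i j. P i \<and> j < k} = (\<lambda>(i, j). g i j) ` ({i. P i} \<times> {..<k})"
      by auto
    then show ?thesis
      using that by simp
  qed
  from this[of "\<lambda>i. i \<in> {2, 3, 4, 5}" "\<lambda>i j. ([(9 + j, True), (i, True)], [(i, True), (9 + j, True)])"]
  show ?thesis
    unfolding relations_def by simp
qed

lemma ev_replicate: "ev f (replicate n (i, s)) = zmul (if s then int n else - int n) (f i)"
proof (induction n)
  case (Suc n)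
  have "int (Suc n) = int n + 1" "- int (Suc n) = - int n - 1"
    by simp_all
  then have "zmul (int (Suc n)) y = y + zmul (int n) y" "zmul (- int (Suc n)) y = - y + zmul (- int n) y"
    for y :: 'a
    by (metis zmul_plus_1 zmul_minus_1)+
  then show ?case
    using Suc by (cases s) simp_all
qed simp

text \<open>
  The relations are put to work in the affine group, in the quotients of a free group by the normal subgroups that
  contain the relators, in the group that is to be covered, and in products with the affine group.
\<close>

locale abels_relations =
  fixes f :: "nat \<Rightarrow> 'q::group_add" and k :: nat
  assumes relation: "(l, r) \<in> relations k \<Longrightarrow> ev f l = ev f r"
begin

lemma commuting: "(i, j) \<in> set commuting_letters \<Longrightarrow> commute (f i) (f j)"
  using relation[of "[(i, True), (j, True)]" "[(j, True), (i, True)]"]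
  by (force simp: relations_def commute_def)

lemma halve:
  "i \<in> {0, 1} \<Longrightarrow> conj_by (f 4) (f i + f i) = f i"
  "i \<in> {2, 6, 7} \<Longrightarrow> conj_by (f 5) (f i + f i) = f i"
  using relation[of "[(4, True), (i, True), (i, True)]" "[(i, True), (4, True)]"]
    relation[of "[(5, True), (i, True), (i, True)]" "[(i, True), (5, True)]"]
  by (auto simp: relations_def conj_by_eq_iff)

lemma double:
  "i \<in> {2, 8} \<Longrightarrow> conj_by (f 4) (f i) = f i + f i"
  "conj_by (f 5) (f 3) = f 3 + f 3"
  using relation[of "[(4, True), (i, True)]" "[(i, True), (i, True), (4, True)]"]
    relation[of "[(5, True), (3, True)]" "[(3, True), (3, True), (5, True)]"]
  by (auto simp: relations_def conj_by_eq_iff add.assoc)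

lemma bracket:
  "conj_by (f 0) (f 2) = f 6 + f 2" "conj_by (f 1) (f 2) = f 7 + f 2" "conj_by (f 2) (f 3) = f 8 + f 3"
  using relation[of "[(0, True), (2, True)]" "[(6, True), (2, True), (0, True)]"]
    relation[of "[(1, True), (2, True)]" "[(7, True), (2, True), (1, True)]"]
    relation[of "[(2, True), (3, True)]" "[(8, True), (3, True), (2, True)]"]
  by (auto simp: relations_def conj_by_eq_iff add.assoc)

lemma commute_free: "i \<in> {2, 3, 4, 5} \<Longrightarrow> j < k \<Longrightarrow> commute (f (9 + j)) (f i)"
  using relation[of "[(9 + j, True), (i, True)]" "[(i, True), (9 + j, True)]"]
  by (auto simp: relations_def commute_def)

lemma shear_generators:
  assumes "j < k"
  shows "conj_by (f (9 + j)) (f 0) = zmul (1 + 6 * int j) (f 0) + zmul 6 (f 1)"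
    and "conj_by (f (9 + j)) (f 1) = zmul (- 6 * int j * int j) (f 0) + zmul (1 - 6 * int j) (f 1)"
proof -
  have "ev f [(9 + j, True), (0, True)]
      = ev f (replicate (1 + 6 * j) (0, True) @ replicate 6 (1, True) @ [(9 + j, True)])"
    using assms by (intro relation) (auto simp: relations_def)
  then show "conj_by (f (9 + j)) (f 0) = zmul (1 + 6 * int j) (f 0) + zmul 6 (f 1)"
    by (simp only: ev_append ev_replicate) (simp add: conj_by_eq_iff add.assoc)
  have "ev f [(9 + j, True), (1, True)]
      = ev f (replicate (6 * j * j) (0, False) @ replicate (6 * j) (1, False) @ [(1, True), (9 + j, True)])"
    using assms by (intro relation) (auto simp: relations_def)
  moreover have "zmul (1 - 6 * int j) (f 1) = zmul (- int (6 * j)) (f 1) + f 1"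
    using zmul_add[of "- int (6 * j)" 1 "f 1"] by simp
  ultimately show "conj_by (f (9 + j)) (f 1) = zmul (- 6 * int j * int j) (f 0) + zmul (1 - 6 * int j) (f 1)"
    by (simp only: ev_append ev_replicate) (simp add: conj_by_eq_iff add.assoc)
qed

section \<open>Root subgroups\<close>

definition e12 :: "bool \<Rightarrow> real \<Rightarrow> 'q" where "e12 i = dyadic_multiple (f 4) (f (of_bool i))"
definition e13 :: "bool \<Rightarrow> real \<Rightarrow> 'q" where "e13 i = dyadic_multiple (f 5) (f (6 + of_bool i))"
definition e23 :: "real \<Rightarrow> 'q" where "e23 = dyadic_multiple (f 5) (f 2)"
definition e24 :: "real \<Rightarrow> 'q" where "e24 = dyadic_multiple (- f 4) (f 8)"
definition e34 :: "real \<Rightarrow> 'q" where "e34 = dyadic_multiple (- f 5) (f 3)"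

lemma halving:
  "conj_by (f 4) (f (of_bool i) + f (of_bool i)) = f (of_bool i)"
  "conj_by (f 5) (f (6 + of_bool i) + f (6 + of_bool i)) = f (6 + of_bool i)"
  "conj_by (f 5) (f 2 + f 2) = f 2"
  "conj_by (- f 4) (f 8 + f 8) = f 8"
  "conj_by (- f 5) (f 3 + f 3) = f 3"
proof -
  show "conj_by (f 4) (f (of_bool i) + f (of_bool i)) = f (of_bool i)"
    "conj_by (f 5) (f (6 + of_bool i) + f (6 + of_bool i)) = f (6 + of_bool i)"
    by (cases i; simp add: halve)+
  show "conj_by (f 5) (f 2 + f 2) = f 2"
    by (simp add: halve)
  show "conj_by (- f 4) (f 8 + f 8) = f 8" "conj_by (- f 5) (f 3 + f 3) = f 3"
    using double(1)[of 8] double(2) by (metis conj_by_cancel(1) insertCI)+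
qed

lemma hom [simp]: "dyadic_hom (e12 i)" "dyadic_hom (e13 i)" "dyadic_hom e23" "dyadic_hom e24" "dyadic_hom e34"
  unfolding e12_def e13_def e23_def e24_def e34_def by (intro dyadic_hom_dyadic_multiple halving)+

lemma at_1 [simp]: "e12 i 1 = f (of_bool i)" "e13 i 1 = f (6 + of_bool i)" "e23 1 = f 2" "e24 1 = f 8" "e34 1 = f 3"
  unfolding e12_def e13_def e23_def e24_def e34_def by (intro dyadic_multiple_1 halving)+

text \<open>
  The pair of exponents of two by which \<open>f 4\<close> and \<open>f 5\<close> scale a root is its weight: \<open>(-1, 0)\<close> for \<open>12\<close>,
  \<open>(0, -1)\<close> for \<open>13\<close>, \<open>(1, -1)\<close> for \<open>23\<close>, \<open>(1, 0)\<close> for \<open>24\<close> and \<open>(0, 1)\<close> for \<open>34\<close>.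
\<close>

lemma torus_fixes:
  "conj_by (f 5) (e12 i r) = e12 i r" "conj_by (f 4) (e13 i r) = e13 i r"
  "conj_by (f 5) (e24 r) = e24 r" "conj_by (f 4) (e34 r) = e34 r"
proof -
  have 45: "commute (f 4) (f 5)" "commute (f 5) (f 4)"
    using commuting[of 4 5] by (simp_all add: commuting_letters_def commute_sym)
  have "conj_by (f 5) (f (of_bool i)) = f (of_bool i)" "conj_by (f 4) (f (6 + of_bool i)) = f (6 + of_bool i)"
    "conj_by (f 5) (f 8) = f 8" "conj_by (f 4) (f 3) = f 3"
    using commuting[of 0 5] commuting[of 1 5] commuting[of 6 4] commuting[of 4 7] commuting[of 4 6]
      commuting[of 5 8] commuting[of 3 4]
    by (cases i; simp add: commuting_letters_def commute_sym flip: commute_iff_conj_by)+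
  then show "conj_by (f 5) (e12 i r) = e12 i r" "conj_by (f 4) (e13 i r) = e13 i r"
    "conj_by (f 5) (e24 r) = e24 r" "conj_by (f 4) (e34 r) = e34 r"
    using conj_by_dyadic_multiple[OF 45(2), of "f (of_bool i)"] conj_by_dyadic_multiple[OF 45(1), of "f (6 + of_bool i)"]
      conj_by_dyadic_multiple[OF commute_minus[OF 45(2)], of "f 8"] conj_by_dyadic_multiple[OF commute_minus[OF 45(1)], of "f 3"]
    by (simp_all only: e12_def e13_def e24_def e34_def)
qed

lemma torus_halves:
  assumes "r \<in> dyadic"
  shows "conj_by (f 4) (e12 i r) = e12 i (r / 2)" "conj_by (f 5) (e13 i r) = e13 i (r / 2)"
    "conj_by (f 5) (e23 r) = e23 (r / 2)" "conj_by (- f 4) (e24 r) = e24 (r / 2)"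
    "conj_by (- f 5) (e34 r) = e34 (r / 2)"
  unfolding e12_def e13_def e23_def e24_def e34_def by (intro conj_by_dyadic_multiple_half halving assms)+

lemma torus_doubles:
  assumes "r \<in> dyadic"
  shows "conj_by (f 4) (e23 r) = e23 (r * 2)" "conj_by (f 4) (e24 r) = e24 (r * 2)"
    "conj_by (f 5) (e34 r) = e34 (r * 2)"
proof -
  have "commute (f 4) (f 5)"
    using commuting[of 4 5] by (simp add: commuting_letters_def)
  then have "conj_by (f 4) (e23 r) = dyadic_multiple (f 5) (f 2 + f 2) r"
    unfolding e23_def by (simp add: conj_by_dyadic_multiple double)
  also have "f 2 + f 2 = dyadic_multiple (f 5) (f 2) 2"
    using dyadic_homD[OF hom(3), of 1 1] at_1(3) by (simp add: e23_def)
  also have "dyadic_multiple (f 5) \<dots> r = e23 (r * 2)"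
    unfolding e23_def using assms by (simp add: dyadic_multiple_dyadic_multiple halving)
  finally show "conj_by (f 4) (e23 r) = e23 (r * 2)" .
  show "conj_by (f 4) (e24 r) = e24 (r * 2)" "conj_by (f 5) (e34 r) = e34 (r * 2)"
    using torus_halves(4,5)[of "r * 2"] assms by (metis conj_by_cancel(2) dyadic_mult dyadic_simps(3) nonzero_mult_div_cancel_right zero_neq_numeral)+
qed

lemma torus_neg:
  assumes "r \<in> dyadic"
  shows "conj_by (- f 4) (e13 i r) = e13 i r" "conj_by (- f 5) (e12 i r) = e12 i r"
    "conj_by (- f 5) (e24 r) = e24 r" "conj_by (- f 4) (e34 r) = e34 r"
    "conj_by (- f 4) (e23 r) = e23 (r / 2)"  "conj_by (- f 5) (e23 r) = e23 (r * 2)"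
    "conj_by (- f 4) (e12 i r) = e12 i (r * 2)" "conj_by (- f 5) (e13 i r) = e13 i (r * 2)"
proof -
  show "conj_by (- f 4) (e13 i r) = e13 i r" "conj_by (- f 5) (e12 i r) = e12 i r"
    "conj_by (- f 5) (e24 r) = e24 r" "conj_by (- f 4) (e34 r) = e34 r"
    by (metis torus_fixes conj_by_cancel(1))+
  have half: "r / 2 * 2 = r" "r * 2 / 2 = r" "r / 2 \<in> dyadic" "r * 2 \<in> dyadic"
    using assms by simp_all
  show "conj_by (- f 4) (e23 r) = e23 (r / 2)"  "conj_by (- f 5) (e23 r) = e23 (r * 2)"
    "conj_by (- f 4) (e12 i r) = e12 i (r * 2)" "conj_by (- f 5) (e13 i r) = e13 i (r * 2)"
    using torus_doubles(1)[OF half(3)] torus_halves[OF half(4)] by (metis half(1,2) conj_by_cancel(1))+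
qed

lemmas torus = torus_fixes torus_halves torus_doubles torus_neg

lemma commute_same:
  assumes "r \<in> dyadic" "s \<in> dyadic"
  shows "commute (e12 i r) (e12 j s)" "commute (e13 i r) (e13 j s)"
    "commute (e23 r) (e23 s)" "commute (e24 r) (e24 s)" "commute (e34 r) (e34 s)"
proof -
  have "commute (f (of_bool i)) (f (of_bool j))" "commute (f (6 + of_bool i)) (f (6 + of_bool j))"
    using commuting[of 0 1] commuting[of 6 7]
    by (auto simp: commuting_letters_def commute_sym of_bool_def)
  then show "commute (e12 i r) (e12 j s)" "commute (e13 i r) (e13 j s)"
    "commute (e23 r) (e23 s)" "commute (e24 r) (e24 s)" "commute (e34 r) (e34 s)"
    unfolding e12_def e13_def e23_def e24_def e34_def
    using assms by (intro commute_dyadic_multiple halving; simp)+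
qed

text \<open>
  The two weights involved are linearly independent in each case, so that suitable torus elements
  scale one root and fix the other.
\<close>

lemma commute_roots:
  assumes "r \<in> dyadic" "s \<in> dyadic"
  shows "commute (e12 i r) (e13 j s)" "commute (e23 r) (e13 i s)" "commute (e23 r) (e24 s)"
    "commute (e34 r) (e24 s)" "commute (e12 i r) (e34 s)" "commute (e13 i r) (e24 s)"
proof -
  have "commute (e12 i 1) (e13 j 1)" "commute (e23 1) (e13 i 1)" "commute (e23 1) (e24 1)"
    "commute (e34 1) (e24 1)" "commute (e12 i 1) (e34 1)" "commute (e13 i 1) (e24 1)"
    using commuting by (auto simp: commuting_letters_def of_bool_def)
  note base = this
  note [simp] = torus conj_by_plus
  show "commute (e12 i r) (e13 j s)"
    by (rule commute_dyadic[of _ _ "f 4" "f 5"]) (use assms base in auto)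
  show "commute (e23 r) (e13 i s)"
    by (rule commute_dyadic[of _ _ "- f 4" "f 4 + f 5"]) (use assms base in auto)
  show "commute (e23 r) (e24 s)"
    by (rule commute_dyadic[of _ _ "f 5" "- f 4 + - f 5"]) (use assms base in \<open>auto simp del: add_uminus_conv_diff\<close>)
  show "commute (e34 r) (e24 s)"
    by (rule commute_dyadic[of _ _ "- f 5" "- f 4"]) (use assms base in auto)
  show "commute (e12 i r) (e34 s)"
    by (rule commute_dyadic[of _ _ "f 4" "- f 5"]) (use assms base in auto)
  show "commute (e13 i r) (e24 s)"
    by (rule commute_dyadic[of _ _ "f 5" "- f 4"]) (use assms base in auto)
qed

lemma bracket_roots:
  assumes "r \<in> dyadic" "s \<in> dyadic"
  shows "conj_by (e12 i r) (e23 s) = e13 i (r * s) + e23 s"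
    and "conj_by (e23 r) (e34 s) = e24 (r * s) + e34 s"
proof -
  have "conj_by (e12 i 1) (e23 1) = e13 i 1 + e23 1" "conj_by (e23 1) (e34 1) = e24 1 + e34 1"
    using bracket by (simp_all add: of_bool_def)
  note base = this
  note [simp] = torus conj_by_plus commute_roots
  show "conj_by (e12 i r) (e23 s) = e13 i (r * s) + e23 s"
    by (rule bracket_dyadic[of _ _ _ "f 4 + f 5" "f 5"]) (use assms base in auto)
  show "conj_by (e23 r) (e34 s) = e24 (r * s) + e34 s"
    by (rule bracket_dyadic[of _ _ _ "- f 4" "- f 4 + - f 5"])
      (use assms base in \<open>auto simp del: add_uminus_conv_diff\<close>)
qed

end

context abels_relations
begin

lemma commute_roots':
  assumes "r \<in> dyadic" "s \<in> dyadic"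
  shows "commute (e13 j s) (e12 i r)" "commute (e13 i s) (e23 r)" "commute (e24 s) (e23 r)"
    "commute (e24 s) (e34 r)" "commute (e34 s) (e12 i r)" "commute (e24 s) (e13 i r)"
  using commute_roots[OF assms] commute_roots[OF assms(2,1)] by (simp_all add: commute_sym)

lemmas comm = commute_same commute_roots commute_roots'

section \<open>The central root subgroup\<close>

text \<open>
  The weights of \<open>12\<close> and \<open>24\<close> are opposite, and so are those of \<open>13\<close> and \<open>34\<close>: the torus acts trivially
  on the root \<open>14\<close>, and no conjugation can spread a relation about it.
\<close>

definition e14 :: "bool \<Rightarrow> real \<Rightarrow> 'q" where
  "e14 i r = conj_by (e12 i r) (e24 1) - e24 1"

text \<open>
  This replaces the missing torus action. Conjugating the relation \<open>[e23 s, e34 q] = e24 (s * q)\<close> by \<open>e12 i r\<close>, which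
  commutes with \<open>e34 q\<close>, compares the two ways to reach the root \<open>14\<close>, through \<open>24\<close> and through
  \<open>13\<close>. It is the Hall-Witt identity for these three roots.
\<close>

lemma hall_witt:
  assumes "r \<in> dyadic" "s \<in> dyadic" "q \<in> dyadic"
  shows "conj_by (e12 i r) (e24 (s * q)) - e24 (s * q) = conj_by (e13 i (r * s)) (e34 q) - e34 q"
proof -
  define \<beta> \<gamma> \<delta> \<epsilon> where "\<beta> = e23 s" and "\<gamma> = e34 q" and "\<delta> = e13 i (r * s)" and "\<epsilon> = e24 (s * q)"
  define \<phi> where "\<phi> = conj_by (e12 i r) \<epsilon> - \<epsilon>"
  have b: "conj_by (e12 i r) \<beta> = \<delta> + \<beta>" "conj_by \<beta> \<gamma> = \<epsilon> + \<gamma>"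
    using assms by (simp_all add: \<beta>_def \<gamma>_def \<delta>_def \<epsilon>_def bracket_roots)
  have c: "conj_by (e12 i r) \<gamma> = \<gamma>" "commute \<delta> \<epsilon>" "commute \<epsilon> \<gamma>" "commute \<epsilon> \<beta>" "commute \<beta> \<delta>"
    using assms by (simp_all add: \<beta>_def \<gamma>_def \<delta>_def \<epsilon>_def comm flip: commute_iff_conj_by)
  have "conj_by (e12 i r) (conj_by \<beta> \<gamma>) = conj_by (\<delta> + \<beta>) \<gamma>"
    by (subst conj_by_distrib) (simp add: b c)
  moreover have "conj_by (e12 i r) (conj_by \<beta> \<gamma>) = \<phi> + \<epsilon> + \<gamma>"
    by (simp add: b c conj_by_add \<phi>_def)
  moreover have "conj_by (\<delta> + \<beta>) \<gamma> = \<epsilon> + conj_by \<delta> \<gamma>"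
    using c(2) by (simp add: conj_by_plus b conj_by_add commute_iff_conj_by)
  ultimately have "\<phi> + \<epsilon> + \<gamma> = \<epsilon> + conj_by \<delta> \<gamma>"
    by simp
  moreover have "commute \<epsilon> (conj_by \<delta> \<gamma>)"
    using c(2,3) commute_conj_by[of \<delta> \<epsilon> \<gamma>] by (simp add: commute_iff_conj_by)
  ultimately have "\<phi> + \<epsilon> + \<gamma> = conj_by \<delta> \<gamma> + \<epsilon>"
    by (simp add: commute_def)
  moreover have "\<phi> + \<epsilon> + \<gamma> = \<phi> + \<gamma> + \<epsilon>"
    using c(3) by (simp add: commute_def add.assoc)
  ultimately have "\<phi> + \<gamma> = conj_by \<delta> \<gamma>"
    by simp
  then have "\<phi> = conj_by \<delta> \<gamma> - \<gamma>"
    by (simp add: eq_diff_eq)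
  then show ?thesis
    by (simp add: \<phi>_def \<gamma>_def \<delta>_def \<epsilon>_def)
qed

text \<open>
  By \<open>hall_witt\<close>, the commutator \<open>[e12 i r, e24 q]\<close> depends on \<open>r * q\<close> only, since both it and \<open>[e12 i (r * q), e24 1]\<close>
  equal \<open>[e13 i (r * q), e34 1]\<close>.
\<close>

lemma bracket_e14:
  assumes "r \<in> dyadic" "q \<in> dyadic"
  shows "conj_by (e12 i r) (e24 q) = e14 i (r * q) + e24 q"
    and "conj_by (e13 i r) (e34 q) = e14 i (r * q) + e34 q"
proof -
  have "conj_by (e12 i r) (e24 q) - e24 q = conj_by (e13 i (r * q)) (e34 1) - e34 1"
    using hall_witt[of r q 1 i] assms by simp
  also have "\<dots> = e14 i (r * q)"
    using hall_witt[of "r * q" 1 1 i] assms by (simp add: e14_def)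
  finally have *: "conj_by (e12 i r) (e24 q) - e24 q = e14 i (r * q)" .
  then show "conj_by (e12 i r) (e24 q) = e14 i (r * q) + e24 q"
    by (simp add: diff_eq_eq)
  show "conj_by (e13 i r) (e34 q) = e14 i (r * q) + e34 q"
    using hall_witt[of r 1 q i] assms * by (simp add: diff_eq_eq)
qed

lemma e14_alt: "r \<in> dyadic \<Longrightarrow> e14 i r = conj_by (e13 i r) (e34 1) - e34 1"
  using bracket_e14(2)[of r 1 i] by simp

text \<open>
  As a commutator of \<open>12\<close> and \<open>24\<close>, the root \<open>14\<close> commutes with whatever commutes with these two,
  and likewise for \<open>13\<close> and \<open>34\<close>. Only \<open>23\<close> commutes with neither pair; conjugation by it changes \<open>e34 1\<close> by an
  element of \<open>24\<close>, which does not affect the commutator.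
\<close>

lemma commute_e14:
  assumes r: "r \<in> dyadic" and s: "s \<in> dyadic"
  shows "commute (e12 j s) (e14 i r)" "commute (e13 j s) (e14 i r)" "commute (e24 s) (e14 i r)"
    "commute (e34 s) (e14 i r)" "commute (e23 s) (e14 i r)" "commute (e14 j s) (e14 i r)"
proof -
  show 12: "commute (e12 j s) (e14 i r)" and 24: "commute (e24 s) (e14 i r)"
    unfolding e14_alt[OF r] by (intro commute_commutator comm; use r s in simp)+
  show "commute (e13 j s) (e14 i r)" "commute (e34 s) (e14 i r)"
    unfolding e14_def by (intro commute_commutator comm; use r s in simp)+
  have 1: "commute (e24 1) (e14 i r)"
    unfolding e14_alt[OF r] by (intro commute_commutator comm; use r in simp)
  \<comment> \<open>Conjugation by \<open>e23 s\<close> fixes \<open>e13 i r\<close> and turns \<open>e34 1\<close> into \<open>e24 s + e34 1\<close>, where \<open>e24 s\<close> is harmless.\<close>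
  have "conj_by (e23 s) (conj_by (e13 i r) (e34 1)) = conj_by (e13 i r) (e24 s + e34 1)"
    using r s by (subst conj_by_distrib) (simp add: bracket_roots comm flip: commute_iff_conj_by del: at_1,
        simp add: comm commute_iff_conj_by[THEN iffD1] bracket_roots del: at_1)
  also have "\<dots> = e24 s + (e14 i r + e34 1)"
    using r s by (simp add: conj_by_add bracket_e14 comm commute_iff_conj_by[THEN iffD1] del: at_1)
  finally have "conj_by (e23 s) (e14 i r + e34 1) = e24 s + (e14 i r + e34 1)"
    using r by (simp add: bracket_e14 del: at_1)
  then have "conj_by (e23 s) (e14 i r) + e24 s = e24 s + e14 i r"
    using s by (simp add: conj_by_add bracket_roots del: at_1 flip: add.assoc)
  then show "commute (e23 s) (e14 i r)"
    using 24 by (metis commute_iff_conj_by commute_def add_right_cancel)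
  have "commute (e14 i r) (e14 j s)"
    unfolding e14_def[of j s] using 12 1 by (intro commute_commutator) (metis commute_sym)+
  then show "commute (e14 j s) (e14 i r)"
    by (metis commute_sym)
qed

lemma commute_e14':
  assumes "r \<in> dyadic" "s \<in> dyadic"
  shows "commute (e14 i r) (e12 j s)" "commute (e14 i r) (e13 j s)" "commute (e14 i r) (e24 s)"
    "commute (e14 i r) (e34 s)" "commute (e14 i r) (e23 s)"
  using commute_e14[OF assms] by (metis commute_sym)+

lemma hom_e14 [simp]: "dyadic_hom (e14 i)"
  unfolding dyadic_hom_def
proof (intro ballI)
  fix r s assume rs: "r \<in> dyadic" "s \<in> dyadic"
  have "e14 i (r + s) + e24 1 = conj_by (e12 i r) (conj_by (e12 i s) (e24 1))"
    using rs bracket_e14(1)[of "r + s" 1 i] by (simp add: dyadic_homD conj_by_plus del: at_1)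
  also have "\<dots> = e14 i s + (e14 i r + e24 1)"
    using rs by (simp add: bracket_e14 conj_by_add commute_e14 commute_iff_conj_by[THEN iffD1] del: at_1)
  finally show "e14 i (r + s) = e14 i r + e14 i s"
    using commute_e14(6)[OF rs] by (simp add: commute_def flip: add.assoc)
qed

lemma torus_e14:
  assumes "r \<in> dyadic"
  shows "conj_by (f 4) (e14 i r) = e14 i r" "conj_by (f 5) (e14 i r) = e14 i r"
    "conj_by (- f 4) (e14 i r) = e14 i r" "conj_by (- f 5) (e14 i r) = e14 i r"
proof -
  have "conj_by (f 4) (conj_by (e12 i r) (e24 1)) = conj_by (e12 i (r / 2)) (e24 2)"
    by (subst conj_by_distrib) (use assms in \<open>simp add: torus del: at_1\<close>)
  then have "conj_by (f 4) (e14 i r) + e24 2 = e14 i r + e24 2"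
    using assms by (simp add: bracket_e14 conj_by_add torus del: at_1)
  then show 4: "conj_by (f 4) (e14 i r) = e14 i r"
    by simp
  have "conj_by (f 5) (conj_by (e12 i r) (e24 1)) = conj_by (e12 i r) (e24 1)"
    by (subst conj_by_distrib) (use assms in \<open>simp add: torus del: at_1\<close>)
  then have "conj_by (f 5) (e14 i r) + e24 1 = e14 i r + e24 1"
    using assms by (simp add: bracket_e14 conj_by_add torus del: at_1)
  then show 5: "conj_by (f 5) (e14 i r) = e14 i r"
    by simp
  show "conj_by (- f 4) (e14 i r) = e14 i r" "conj_by (- f 5) (e14 i r) = e14 i r"
    by (metis 4 5 conj_by_cancel(1))+
qed

section \<open>Vector-valued root subgroups\<close>

text \<open>
  The roots \<open>12\<close>, \<open>13\<close> and \<open>14\<close> are two-dimensional; \<open>i\<close> selects the coordinate.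
\<close>

definition vec :: "(bool \<Rightarrow> real \<Rightarrow> 'q) \<Rightarrow> real \<times> real \<Rightarrow> 'q" where
  "vec X v = X False (fst v) + X True (snd v)"

lemma vec_add:
  assumes "\<And>i. dyadic_hom (X i)" "\<And>i j r s. r \<in> dyadic \<Longrightarrow> s \<in> dyadic \<Longrightarrow> commute (X i r) (X j s)"
    and "v \<in> dyadic \<times> dyadic" "w \<in> dyadic \<times> dyadic"
  shows "vec X (v + w) = vec X v + vec X w"
proof -
  have "commute (X True (snd v)) (X False (fst w))"
    using assms by auto
  then have "X True (snd v) + (X False (fst w) + X True (snd w)) = X False (fst w) + (X True (snd v) + X True (snd w))"
    by (simp add: commute_def flip: add.assoc)
  then show ?thesis
    using assms(3,4) dyadic_homD[OF assms(1)] by (auto simp: vec_def add.assoc)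
qed

lemma conj_by_vec:
  assumes "\<And>i r. r \<in> dyadic \<Longrightarrow> conj_by g (X i r) = X i (c * r)" "v \<in> dyadic \<times> dyadic"
  shows "conj_by g (vec X v) = vec X (c *\<^sub>R v)"
  using assms by (auto simp: vec_def conj_by_add)

lemma vec_bracket:
  assumes "\<And>i r. r \<in> dyadic \<Longrightarrow> conj_by (X i r) y = Y i (q * r) + y"
    "\<And>i j r s. r \<in> dyadic \<Longrightarrow> s \<in> dyadic \<Longrightarrow> commute (X i r) (Y j s)"
    "\<And>i j r s. r \<in> dyadic \<Longrightarrow> s \<in> dyadic \<Longrightarrow> commute (Y i r) (Y j s)"
    "v \<in> dyadic \<times> dyadic" "q \<in> dyadic"
  shows "conj_by (vec X v) y = vec Y (q *\<^sub>R v) + y"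
proof -
  let ?p = "fst v" and ?p' = "snd v"
  have "commute (X False ?p) (Y True (q * ?p'))" and Y: "commute (Y False (q * ?p)) (Y True (q * ?p'))"
    using assms by auto
  then have "conj_by (X False ?p) (Y True (q * ?p') + y) = Y True (q * ?p') + (Y False (q * ?p) + y)"
    using assms(1)[of ?p False] assms(4) by (auto simp: conj_by_add commute_iff_conj_by)
  also have "\<dots> = Y False (q * ?p) + Y True (q * ?p') + y"
    using Y by (simp add: commute_def flip: add.assoc)
  finally show ?thesis
    using assms(1)[of ?p' True] assms(4) by (auto simp: vec_def conj_by_plus)
qed

lemma vec_brackets:
  assumes "v \<in> dyadic \<times> dyadic" "r \<in> dyadic"
  shows "conj_by (vec e12 v) (e23 r) = vec e13 (r *\<^sub>R v) + e23 r"
    "conj_by (vec e13 v) (e34 r) = vec e14 (r *\<^sub>R v) + e34 r"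
    "conj_by (vec e12 v) (e24 r) = vec e14 (r *\<^sub>R v) + e24 r"
  using assms
  by (intro vec_bracket; simp add: bracket_roots bracket_e14 comm commute_e14 commute_e14' mult.commute)+

text \<open>
  Both sides are dyadic multiples, so it is enough to compare them on the generators, where the
  relations apply; this needs that shears commute with the torus.
\<close>

lemma shear_e12:
  assumes j: "j < k" and v: "v \<in> dyadic \<times> dyadic"
  shows "conj_by (f (9 + j)) (vec e12 v) = vec e12 (shear j True v)"
proof -
  let ?x = "f (9 + j)"
  have x4: "commute ?x (f 4)"
    using commute_free[of 4 j] j by simp
  have D: "real_of_int n \<in> dyadic" for n
    by simp
  have *: "conj_by ?x (e12 i r) = vec e12 (r *\<^sub>R (real_of_int m, real_of_int n))"
    if x: "conj_by ?x (f (of_bool i)) = zmul m (f 0) + zmul n (f 1)" and r: "r \<in> dyadic" for i m n r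
  proof -
    have "dyadic_multiple (f 4) (conj_by ?x (f (of_bool i))) r = vec e12 (r *\<^sub>R (real_of_int m, real_of_int n))"
    proof (rule dyadic_multiple_unique[OF _ _ _ r])
      show "dyadic_hom (\<lambda>r. vec e12 (r *\<^sub>R (real_of_int m, real_of_int n)))"
        unfolding dyadic_hom_def scaleR_left_distrib
        by (intro ballI vec_add) (auto simp: comm)
      show "conj_by (f 4) (vec e12 (r *\<^sub>R (real_of_int m, real_of_int n)))
          = vec e12 ((r / 2) *\<^sub>R (real_of_int m, real_of_int n))" if "r \<in> dyadic" for r
        using that by (subst conj_by_vec[where c = "1 / 2"]) (auto simp: torus)
      show "vec e12 (1 *\<^sub>R (real_of_int m, real_of_int n)) = conj_by ?x (f (of_bool i))"
        using dyadic_hom_zmul[OF hom(1), of 1 False m] dyadic_hom_zmul[OF hom(1), of 1 True n]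
        by (simp add: vec_def x)
    qed
    then show ?thesis
      using x4 by (simp add: e12_def conj_by_dyadic_multiple)
  qed
  have "conj_by ?x (e12 False (fst v)) = vec e12 (fst v *\<^sub>R (1 + 6 * real j, 6))"
    using *[of False "1 + 6 * int j" 6 "fst v"] v shear_generators(1)[OF j] by auto
  moreover have "conj_by ?x (e12 True (snd v)) = vec e12 (snd v *\<^sub>R (- 6 * real j * real j, 1 - 6 * real j))"
    using *[of True "- 6 * int j * int j" "1 - 6 * int j" "snd v"] v shear_generators(2)[OF j] by auto
  ultimately have "conj_by ?x (vec e12 v)
      = vec e12 (fst v *\<^sub>R (1 + 6 * real j, 6)) + vec e12 (snd v *\<^sub>R (- 6 * real j * real j, 1 - 6 * real j))"
    by (simp add: vec_def[of _ v] conj_by_add)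
  also have "\<dots> = vec e12 (fst v *\<^sub>R (1 + 6 * real j, 6) + snd v *\<^sub>R (- 6 * real j * real j, 1 - 6 * real j))"
    using v D[of "int j"] by (subst vec_add) (auto simp: comm)
  also have "fst v *\<^sub>R (1 + 6 * real j, 6) + snd v *\<^sub>R (- 6 * real j * real j, 1 - 6 * real j) = shear j True v"
    by (simp add: shear_def Let_def prod_eq_iff algebra_simps)
  finally show ?thesis .
qed

lemma free_fixes:
  assumes "j < k"
  shows "conj_by (f (9 + j)) (e23 r) = e23 r" "conj_by (f (9 + j)) (e34 r) = e34 r"
    "conj_by (f (9 + j)) (e24 r) = e24 r"
proof -
  let ?x = "f (9 + j)"
  have x: "commute ?x (f i)" if "i \<in> {2, 3, 4, 5}" for i
    using commute_free that assms by blast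
  have fix2: "conj_by ?x (f i) = f i" if "i \<in> {2, 3, 4, 5}" for i
    using x[OF that] by (simp add: commute_iff_conj_by)
  have "conj_by ?x (conj_by (f 2) (f 3)) = conj_by (f 2) (f 3)"
    by (subst conj_by_distrib) (simp add: fix2)
  then have "conj_by ?x (f 8) = f 8"
    by (simp add: bracket conj_by_add fix2)
  then show "conj_by ?x (e23 r) = e23 r" "conj_by ?x (e34 r) = e34 r" "conj_by ?x (e24 r) = e24 r"
    unfolding e23_def e34_def e24_def using x by (simp_all add: conj_by_dyadic_multiple commute_minus fix2)
qed

text \<open>
  The roots \<open>13\<close> and \<open>14\<close> are commutators of \<open>12\<close> with elements fixed by the shears.
\<close>

lemma shear_e13_e14:
  assumes j: "j < k" and v: "v \<in> dyadic \<times> dyadic"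
  shows "conj_by (f (9 + j)) (vec e13 v) = vec e13 (shear j True v)"
    "conj_by (f (9 + j)) (vec e14 v) = vec e14 (shear j True v)"
proof -
  let ?x = "f (9 + j)"
  have S: "shear j True v \<in> dyadic \<times> dyadic"
    using v by (rule shear_dyadic)
  have "conj_by ?x (conj_by (vec e12 v) (e23 1)) = conj_by (vec e12 (shear j True v)) (e23 1)"
    by (subst conj_by_distrib) (simp only: free_fixes[OF j] shear_e12[OF assms])
  then show "conj_by ?x (vec e13 v) = vec e13 (shear j True v)"
    using S v by (simp add: vec_brackets conj_by_add free_fixes[OF j] del: at_1)
  have "conj_by ?x (conj_by (vec e12 v) (e24 1)) = conj_by (vec e12 (shear j True v)) (e24 1)"
    by (subst conj_by_distrib) (simp only: free_fixes[OF j] shear_e12[OF assms])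
  then show "conj_by ?x (vec e14 v) = vec e14 (shear j True v)"
    using S v by (simp add: vec_brackets conj_by_add free_fixes[OF j] del: at_1)
qed

section \<open>The normal form\<close>

definition torus_letters :: "letter set" where
  "torus_letters = ({4, 5} \<union> {9..<9 + k}) \<times> UNIV"

text \<open>
  Since the six root subgroups normalise each other in a suitable order, words collapse to products of
  this shape. The torus and the free group are kept together as one word \<open>l\<close>.
\<close>

definition nf :: "real \<times> real \<Rightarrow> real \<times> real \<Rightarrow> real \<times> real \<Rightarrow> real \<Rightarrow> real \<Rightarrow> real \<Rightarrow> word \<Rightarrow> 'q" where
  "nf w v a q r s l = vec e14 w + vec e13 v + vec e12 a + e24 q + e23 r + e34 s + ev f l"

definition normal_form :: "'q \<Rightarrow> bool" where
  "normal_form y \<longleftrightarrow> (\<exists>w v a q r s l. y = nf w v a q r s l \<and> w \<in> dyadic \<times> dyadic \<and> v \<in> dyadic \<times> dyadic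
     \<and> a \<in> dyadic \<times> dyadic \<and> q \<in> dyadic \<and> r \<in> dyadic \<and> s \<in> dyadic \<and> set l \<subseteq> torus_letters)"


lemma vec_comm:
  assumes "w \<in> dyadic \<times> dyadic" "v \<in> dyadic \<times> dyadic" "r \<in> dyadic"
  shows "commute (vec e12 v) (vec e14 w)" "commute (vec e13 v) (vec e14 w)" "commute (e24 r) (vec e14 w)"
    "commute (e34 r) (vec e14 w)" "commute (e23 r) (vec e14 w)" "commute (vec e12 v) (vec e13 w)"
    "commute (e24 r) (vec e13 v)" "commute (e23 r) (vec e13 v)" "commute (e34 r) (vec e12 v)"
  using assms unfolding vec_def
  by (auto intro!: commute_add commute_add_left simp: commute_e14 comm)

lemma vec_hom:
  assumes "v \<in> dyadic \<times> dyadic" "w \<in> dyadic \<times> dyadic"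
  shows "vec e12 (v + w) = vec e12 v + vec e12 w" "vec e13 (v + w) = vec e13 v + vec e13 w"
    "vec e14 (v + w) = vec e14 v + vec e14 w"
  using assms by (intro vec_add; simp add: comm commute_e14)+

lemma vec_diff:
  assumes "v \<in> dyadic \<times> dyadic" "w \<in> dyadic \<times> dyadic"
  shows "vec e13 (v - w) = vec e13 v + - vec e13 w" "vec e14 (v - w) = vec e14 v + - vec e14 w"
proof -
  have "v - w \<in> dyadic \<times> dyadic"
    using assms by auto
  then show "vec e13 (v - w) = vec e13 v + - vec e13 w" "vec e14 (v - w) = vec e14 v + - vec e14 w"
    using vec_hom(2,3)[of "v - w" w] assms by (simp_all add: eq_diff_eq)
qed

text \<open>
  A generator is moved to the factor that it belongs to; the commutators that appear on the way are
  absorbed further left.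
\<close>

lemma nf_left:
  assumes D: "w \<in> dyadic \<times> dyadic" "v \<in> dyadic \<times> dyadic" "a \<in> dyadic \<times> dyadic" "q \<in> dyadic" "r \<in> dyadic" "s \<in> dyadic"
  shows nf_e12: "x \<in> dyadic \<times> dyadic \<Longrightarrow> vec e12 x + nf w v a q r s l = nf w v (x + a) q r s l"
    and nf_e13: "x \<in> dyadic \<times> dyadic \<Longrightarrow> vec e13 x + nf w v a q r s l = nf w (x + v) a q r s l"
    and nf_e24: "h \<in> dyadic \<Longrightarrow> e24 h + nf w v a q r s l = nf (w - h *\<^sub>R a) v a (h + q) r s l"
    and nf_e23: "h \<in> dyadic \<Longrightarrow> e23 h + nf w v a q r s l = nf w (v - h *\<^sub>R a) a q (h + r) s l"
    and nf_e34: "h \<in> dyadic \<Longrightarrow> e34 h + nf w v a q r s l = nf (w - h *\<^sub>R v) v a (q - r * h) r (h + s) l"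
proof -
  note W = commute_shift[OF vec_comm(1)] commute_shift[OF vec_comm(2)] commute_shift[OF vec_comm(3)]
    commute_shift[OF vec_comm(4)] commute_shift[OF vec_comm(5)]
  note V = commute_shift[OF vec_comm(6)] commute_shift[OF vec_comm(7)] commute_shift[OF vec_comm(8)]
  show "vec e12 x + nf w v a q r s l = nf w v (x + a) q r s l" if "x \<in> dyadic \<times> dyadic"
    using D that by (simp only: nf_def add.assoc W V vec_hom)
  show "vec e13 x + nf w v a q r s l = nf w (x + v) a q r s l" if "x \<in> dyadic \<times> dyadic"
    using D that by (simp only: nf_def add.assoc W vec_hom)
  show "e24 h + nf w v a q r s l = nf (w - h *\<^sub>R a) v a (h + q) r s l" if h: "h \<in> dyadic"
  proof -
    have ha: "h *\<^sub>R a \<in> dyadic \<times> dyadic"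
      using h D(3) by (rule scaleR_dyadic)
    have "e24 h + nf w v a q r s l
        = vec e14 w + (vec e13 v + (- vec e14 (h *\<^sub>R a) + (vec e12 a + (e24 h + (e24 q + (e23 r + (e34 s + ev f l)))))))"
      using D h by (simp only: nf_def add.assoc W V bracket_shift[OF vec_brackets(3)])
    also have "\<dots> = vec e14 w + (- vec e14 (h *\<^sub>R a) + (vec e13 v + (vec e12 a + (e24 h + (e24 q + (e23 r + (e34 s + ev f l)))))))"
      by (subst commute_shift[OF commute_minus[OF vec_comm(2)[OF ha D(2) h]]]) simp
    also have "\<dots> = nf (w - h *\<^sub>R a) v a (h + q) r s l"
      using D h ha by (simp only: nf_def add.assoc vec_diff dyadic_homD[OF hom(3)] dyadic_homD[OF hom(4)])
    finally show ?thesis .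
  qed
  show "e23 h + nf w v a q r s l = nf w (v - h *\<^sub>R a) a q (h + r) s l" if h: "h \<in> dyadic"
  proof -
    have ha: "h *\<^sub>R a \<in> dyadic \<times> dyadic"
      using h D(3) by (rule scaleR_dyadic)
    have "e23 h + nf w v a q r s l
        = vec e14 w + (vec e13 v + (- vec e13 (h *\<^sub>R a) + (vec e12 a + (e24 q + (e23 h + (e23 r + (e34 s + ev f l)))))))"
      using D h by (simp only: nf_def add.assoc W V bracket_shift[OF vec_brackets(1)] commute_shift[OF commute_roots(3)])
    also have "\<dots> = nf w (v - h *\<^sub>R a) a q (h + r) s l"
      using D h ha by (simp only: nf_def add.assoc vec_diff dyadic_homD[OF hom(3)] dyadic_homD[OF hom(4)])
    finally show ?thesis .
  qed
  show "e34 h + nf w v a q r s l = nf (w - h *\<^sub>R v) v a (q - r * h) r (h + s) l" if h: "h \<in> dyadic"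
  proof -
    have hv: "h *\<^sub>R v \<in> dyadic \<times> dyadic"
      using h D(2) by (rule scaleR_dyadic)
    have "e34 h + nf w v a q r s l
        = vec e14 w + (- vec e14 (h *\<^sub>R v) + (vec e13 v + (vec e12 a + (e24 q + (- e24 (r * h) + (e23 r + (e34 h + (e34 s + ev f l))))))))"
      using D h by (simp only: nf_def add.assoc W bracket_shift[OF vec_brackets(2)] commute_shift[OF vec_comm(9)]
          commute_shift[OF commute_roots(4)] bracket_shift[OF bracket_roots(2)])
    also have "\<dots> = nf (w - h *\<^sub>R v) v a (q - r * h) r (h + s) l"
    proof -
      have "e24 (q - r * h) = e24 q + - e24 (r * h)"
        using D h dyadic_homD[OF hom(4), of q "- (r * h)"] by (simp add: dyadic_hom_minus)
      then show ?thesis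
        using D h hv by (simp only: nf_def add.assoc vec_diff dyadic_homD[OF hom(5)])
    qed
    finally show ?thesis .
  qed
qed

lemma nf_torus:
  assumes "conj_by g (vec e14 w) = vec e14 w'" "conj_by g (vec e13 v) = vec e13 v'" "conj_by g (vec e12 a) = vec e12 a'"
    "conj_by g (e24 q) = e24 q'" "conj_by g (e23 r) = e23 r'" "conj_by g (e34 s) = e34 s'" "ev f [x] = g"
  shows "g + nf w v a q r s l = nf w' v' a' q' r' s' (x # l)"
proof -
  have "g + nf w v a q r s l
      = conj_by g (vec e14 w + vec e13 v + vec e12 a + e24 q + e23 r + e34 s) + (g + ev f l)"
    unfolding nf_def by (rule conj_by_shift)
  also have "g + ev f l = ev f (x # l)"
    using ev_append[of f "[x]" l] assms(7) by simp
  finally show ?thesis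
    using assms(1-6) by (simp only: nf_def conj_by_add)
qed

lemma conj_by_torus_vec:
  assumes "v \<in> dyadic \<times> dyadic"
  shows "conj_by (f 4) (vec e14 v) = vec e14 v" "conj_by (f 4) (vec e13 v) = vec e13 v"
    "conj_by (f 4) (vec e12 v) = vec e12 ((1 / 2) *\<^sub>R v)" "conj_by (- f 4) (vec e14 v) = vec e14 v"
    "conj_by (- f 4) (vec e13 v) = vec e13 v" "conj_by (- f 4) (vec e12 v) = vec e12 (2 *\<^sub>R v)"
    "conj_by (f 5) (vec e14 v) = vec e14 v" "conj_by (f 5) (vec e12 v) = vec e12 v"
    "conj_by (f 5) (vec e13 v) = vec e13 ((1 / 2) *\<^sub>R v)" "conj_by (- f 5) (vec e14 v) = vec e14 v"
    "conj_by (- f 5) (vec e12 v) = vec e12 v" "conj_by (- f 5) (vec e13 v) = vec e13 (2 *\<^sub>R v)"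
  using assms by (auto simp: vec_def conj_by_add torus torus_e14 mult.commute)

lemma conj_by_free:
  fixes b :: bool
  assumes j: "j < k"
  defines "g \<equiv> (if b then f (9 + j) else - f (9 + j))"
  shows "v \<in> dyadic \<times> dyadic \<Longrightarrow> conj_by g (vec e12 v) = vec e12 (shear j b v)"
    "v \<in> dyadic \<times> dyadic \<Longrightarrow> conj_by g (vec e13 v) = vec e13 (shear j b v)"
    "v \<in> dyadic \<times> dyadic \<Longrightarrow> conj_by g (vec e14 v) = vec e14 (shear j b v)"
    "conj_by g (e23 r) = e23 r" "conj_by g (e34 r) = e34 r" "conj_by g (e24 r) = e24 r"
proof -
  have *: "conj_by g (vec X v) = vec X (shear j b v)"
    if "\<And>v. v \<in> dyadic \<times> dyadic \<Longrightarrow> conj_by (f (9 + j)) (vec X v) = vec X (shear j True v)"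
      "v \<in> dyadic \<times> dyadic" for X v
  proof (cases b)
    case False
    have "conj_by (f (9 + j)) (vec X (shear j False v)) = vec X v"
      using that shear_cancel(2)[of j True v] shear_dyadic by simp
    then have "conj_by (- f (9 + j)) (vec X v) = vec X (shear j False v)"
      using conj_by_cancel(1)[of "f (9 + j)" "vec X (shear j False v)"] by simp
    then show ?thesis
      using False by (simp add: g_def)
  qed (simp add: g_def that)
  show "v \<in> dyadic \<times> dyadic \<Longrightarrow> conj_by g (vec e12 v) = vec e12 (shear j b v)"
    "v \<in> dyadic \<times> dyadic \<Longrightarrow> conj_by g (vec e13 v) = vec e13 (shear j b v)"
    "v \<in> dyadic \<times> dyadic \<Longrightarrow> conj_by g (vec e14 v) = vec e14 (shear j b v)"
    using * shear_e12[OF j] shear_e13_e14[OF j] by blast+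
  show "conj_by g (e23 r) = e23 r" "conj_by g (e34 r) = e34 r" "conj_by g (e24 r) = e24 r"
    using conj_by_cancel(1)[of "f (9 + j)" "e23 r"] conj_by_cancel(1)[of "f (9 + j)" "e34 r"]
      conj_by_cancel(1)[of "f (9 + j)" "e24 r"]
    by (cases b; simp add: g_def free_fixes[OF j])+
qed

lemma normal_form_letter:
  assumes y: "normal_form y" and i: "i < 9 + k"
  shows "normal_form (ev f [(i, b)] + y)"
proof -
  obtain w v a q r s l where y: "y = nf w v a q r s l" and D: "w \<in> dyadic \<times> dyadic" "v \<in> dyadic \<times> dyadic"
     "a \<in> dyadic \<times> dyadic" "q \<in> dyadic" "r \<in> dyadic" "s \<in> dyadic" and l: "set l \<subseteq> torus_letters"
    using y by (auto simp: normal_form_def)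
  have intro: "normal_form (nf w v a q r s l)" if "w \<in> dyadic \<times> dyadic" "v \<in> dyadic \<times> dyadic"
     "a \<in> dyadic \<times> dyadic" "q \<in> dyadic" "r \<in> dyadic" "s \<in> dyadic" "set l \<subseteq> torus_letters" for w v a q r s l
    using that unfolding normal_form_def by blast
  define \<sigma> :: real where "\<sigma> = (if b then 1 else - 1)"
  have \<sigma>: "\<sigma> \<in> dyadic"
    by (simp add: \<sigma>_def)
  have sgn: "X \<sigma> = (if b then X 1 else - X 1)" if "dyadic_hom X" for X :: "real \<Rightarrow> 'q"
    using dyadic_hom_minus[OF that, of 1] by (simp add: \<sigma>_def)
  note h0 = dyadic_hom_0[OF hom(1)] dyadic_hom_0[OF hom(2)]
  consider "i = 0" | "i = 1" | "i = 2" | "i = 3" | "i = 4" | "i = 5" | "i = 6" | "i = 7" | "i = 8" | "i \<ge> 9"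
    by linarith
  then show ?thesis
  proof cases
    assume "i = 0"
    then have "ev f [(i, b)] = vec e12 (\<sigma>, 0)"
      by (simp add: vec_def sgn h0)
    then show ?thesis
      using D l \<sigma> by (auto simp: y nf_e12 intro!: intro)
  next
    assume "i = 1"
    then have "ev f [(i, b)] = vec e12 (0, \<sigma>)"
      by (simp add: vec_def sgn h0)
    then show ?thesis
      using D l \<sigma> by (auto simp: y nf_e12 intro!: intro)
  next
    assume "i = 6"
    then have "ev f [(i, b)] = vec e13 (\<sigma>, 0)"
      by (simp add: vec_def sgn h0)
    then show ?thesis
      using D l \<sigma> by (auto simp: y nf_e13 intro!: intro)
  next
    assume "i = 7"
    then have "ev f [(i, b)] = vec e13 (0, \<sigma>)"
      by (simp add: vec_def sgn h0)
    then show ?thesis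
      using D l \<sigma> by (auto simp: y nf_e13 intro!: intro)
  next
    assume "i = 2"
    then have "ev f [(i, b)] = e23 \<sigma>"
      by (simp add: sgn)
    then show ?thesis
      using D l \<sigma> by (auto simp: y nf_e23 intro!: intro)
  next
    assume "i = 3"
    then have "ev f [(i, b)] = e34 \<sigma>"
      by (simp add: sgn)
    then show ?thesis
      using D l \<sigma> by (auto simp: y nf_e34 intro!: intro)
  next
    assume "i = 8"
    then have "ev f [(i, b)] = e24 \<sigma>"
      by (simp add: sgn)
    then show ?thesis
      using D l \<sigma> by (auto simp: y nf_e24 intro!: intro)
  next
    assume i: "i = 4"
    have x: "set ((i, b) # l) \<subseteq> torus_letters"
      using l i by (simp add: torus_letters_def)
    show ?thesis
    proof (cases b)
      case True
      then have "ev f [(i, b)] + y = nf w v ((1 / 2) *\<^sub>R a) (q * 2) (r * 2) s ((i, b) # l)"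
        unfolding y using D i by (subst nf_torus) (auto simp: conj_by_torus_vec torus)
      then show ?thesis
        using D x by (auto intro!: intro)
    next
      case False
      then have "ev f [(i, b)] + y = nf w v (2 *\<^sub>R a) (q / 2) (r / 2) s ((i, b) # l)"
        unfolding y using D i by (subst nf_torus) (auto simp: conj_by_torus_vec torus)
      then show ?thesis
        using D x by (auto intro!: intro)
    qed
  next
    assume i: "i = 5"
    have x: "set ((i, b) # l) \<subseteq> torus_letters"
      using l i by (simp add: torus_letters_def)
    show ?thesis
    proof (cases b)
      case True
      then have "ev f [(i, b)] + y = nf w ((1 / 2) *\<^sub>R v) a q (r / 2) (s * 2) ((i, b) # l)"
        unfolding y using D i by (subst nf_torus) (auto simp: conj_by_torus_vec torus)
      then show ?thesis
        using D x by (auto intro!: intro)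
    next
      case False
      then have "ev f [(i, b)] + y = nf w (2 *\<^sub>R v) a q (r * 2) (s / 2) ((i, b) # l)"
        unfolding y using D i by (subst nf_torus) (auto simp: conj_by_torus_vec torus)
      then show ?thesis
        using D x by (auto intro!: intro)
    qed
  next
    assume "i \<ge> 9"
    then obtain j where j: "i = 9 + j" "j < k"
      using i le_Suc_ex by force
    have x: "set ((i, b) # l) \<subseteq> torus_letters"
      using l j by (simp add: torus_letters_def)
    have "ev f [(i, b)] = (if b then f (9 + j) else - f (9 + j))"
      by (simp add: j(1))
    then have "ev f [(i, b)] + y = nf (shear j b w) (shear j b v) (shear j b a) q r s ((i, b) # l)"
      unfolding y by (intro nf_torus) (simp_all only: conj_by_free[OF j(2)] D)
    then show ?thesis
      using D x shear_dyadic by (auto intro!: intro simp del: mem_Times_iff)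
  qed
qed

theorem normal_form_ev:
  assumes "fst ` set w \<subseteq> {..<9 + k}"
  shows "normal_form (ev f w)"
  using assms
proof (induction w)
  case Nil
  have "vec e14 (0, 0) = 0" "vec e13 (0, 0) = 0" "vec e12 (0, 0) = 0" "e24 0 = 0" "e23 0 = 0" "e34 0 = 0"
    by (simp_all add: vec_def dyadic_hom_0)
  then have "0 = nf (0, 0) (0, 0) (0, 0) 0 0 0 []"
    by (simp add: nf_def)
  then show ?case
    unfolding normal_form_def by (intro exI[of _ "(0, 0)"] exI[of _ 0] exI[of _ "[]"]) simp
next
  case (Cons x w)
  then have "normal_form (ev f [(fst x, snd x)] + ev f w)"
    by (intro normal_form_letter) auto
  then show ?case
    by simp
qed

end

section \<open>Groups of permutations\<close>

text \<open>
  All permutations of a type form an instance of \<^class>\<open>group_add\<close>. It hosts both the concrete group and, by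
  Cayley's theorem, every group whose carrier is a subset of a type.
\<close>

typedef 'a symmetric = "{g :: 'a \<Rightarrow> 'a. bij g}" morphisms app Symmetric
  by (rule exI[of _ id]) simp

instantiation symmetric :: (type) group_add
begin

definition "0 = Symmetric id"
definition "g + h = Symmetric (app g \<circ> app h)"
definition "- g = Symmetric (inv_into UNIV (app g))"
definition "g - h = g + - (h :: 'a symmetric)"

lemma bij_app [simp]: "bij (app g)"
  using app[of g] by simp

lemma app_simps: "app 0 = id" "app (g + h) = app g \<circ> app h" "app (- g) = inv_into UNIV (app g)"
  by (simp_all add: zero_symmetric_def plus_symmetric_def uminus_symmetric_def Symmetric_inverse
      bij_comp bij_imp_bij_inv)

instance
proof
  fix a b c :: "'a symmetric"
  show "a + b + c = a + (b + c)" "0 + a = a" "a + 0 = a" "- a + a = 0" "a + - b = a - b"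
    using bij_is_inj[OF bij_app[of a]]
    by (simp_all add: minus_symmetric_def app_simps comp_assoc flip: app_inject)
qed

end

lemma app_0 [simp]: "app 0 p = p"
  and app_plus [simp]: "app (g + h) p = app g (app h p)"
  by (simp_all add: app_simps)

lemma app_minus: "app g p = q \<Longrightarrow> app (- g) q = p"
  using inv_f_f[OF bij_is_inj[OF bij_app]] by (auto simp: app_simps)

lemma symmetric_eqI: "(\<And>p. app g p = app h p) \<Longrightarrow> g = h"
  by (simp add: fun_eq_iff flip: app_inject)

section \<open>The affine representation\<close>

type_synonym point = "(real \<times> real) \<times> real \<times> real"

fun act :: "nat \<Rightarrow> bool \<Rightarrow> point \<Rightarrow> point" where
  "act i s (p, y, z) =
    (let \<epsilon> = if s then 1 else - 1 in
     if i = 0 then (p + (\<epsilon> * y, 0), y, z)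
     else if i = 1 then (p + (0, \<epsilon> * y), y, z)
     else if i = 2 then (p, y + \<epsilon> * z, z)
     else if i = 3 then (p, y, z + \<epsilon>)
     else if i = 4 then (p, if s then 2 * y else y / 2, z)
     else if i = 5 then (p, y, if s then 2 * z else z / 2)
     else if i = 6 then (p + (\<epsilon> * z, 0), y, z)
     else if i = 7 then (p + (0, \<epsilon> * z), y, z)
     else if i = 8 then (p, y + \<epsilon>, z)
     else (shear (i - 9) s p, y, z))"

definition rho :: "nat \<Rightarrow> point symmetric" where
  "rho i = Symmetric (act i True)"

lemma act_cancel: "act i (\<not> s) (act i s P) = P"
proof -
  obtain p y z where P: "P = (p, y, z)"
    by (cases P)
  show ?thesis
    using shear_cancel[of "i - 9" True p] unfolding P by (auto simp: Let_def zero_prod_def)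
qed

lemma app_rho: "app (rho i) P = act i True P" "app (- rho i) P = act i False P"
proof -
  have "bij (act i True)"
    using act_cancel[of i True] act_cancel[of i False] by (intro o_bij[of "act i False"]) auto
  then have *: "app (rho i) = act i True"
    by (simp add: rho_def Symmetric_inverse)
  then show "app (rho i) P = act i True P"
    by simp
  have "app (rho i) (act i False P) = P"
    using act_cancel[of i False P] by (simp add: *)
  then show "app (- rho i) P = act i False P"
    by (rule app_minus)
qed

lemma app_ev_Cons: "app (ev rho (x # w)) P = act (fst x) (snd x) (app (ev rho w) P)"
  by (simp add: app_rho)

text \<open>
  The unipotent transformations that are needed: \<open>a\<close>, \<open>v\<close>, \<open>w\<close>, \<open>r\<close>, \<open>q\<close>, \<open>s\<close> are the parameters of the roots \<open>12\<close>,
  \<open>13\<close>, \<open>14\<close>, \<open>23\<close>, \<open>24\<close>, \<open>34\<close>.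
\<close>

definition upper :: "real \<times> real \<Rightarrow> real \<times> real \<Rightarrow> real \<times> real \<Rightarrow> real \<Rightarrow> real \<Rightarrow> real \<Rightarrow> point symmetric" where
  "upper a v w r q s = Symmetric (\<lambda>(p, y, z). (p + y *\<^sub>R a + z *\<^sub>R v + w, y + r * z + q, z + s))"

lemma app_upper [simp]:
  "app (upper a v w r q s) (p, y, z) = (p + y *\<^sub>R a + z *\<^sub>R v + w, y + r * z + q, z + s)"
proof -
  let ?g = "\<lambda>(p, y, z). (p + y *\<^sub>R a + z *\<^sub>R v + w, y + r * z + q, z + s)"
  let ?h = "\<lambda>(p, y, z). let z' = z - s; y' = y - q - r * z' in (p - w - z' *\<^sub>R v - y' *\<^sub>R a, y', z')"
  have "bij ?g"
    by (rule o_bij[of ?h]) (auto simp: fun_eq_iff Let_def)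
  then show ?thesis
    by (simp add: upper_def Symmetric_inverse)
qed

lemma zmul_upper: "zmul n (upper a v w 0 0 0) = upper (real_of_int n *\<^sub>R a) (real_of_int n *\<^sub>R v) (real_of_int n *\<^sub>R w) 0 0 0"
proof (induction n rule: int_induct[where k = 0])
  case (step1 i)
  then show ?case
    unfolding zmul_plus_1 by (auto simp: algebra_simps intro!: symmetric_eqI)
next
  case (step2 i)
  have "- upper a v w 0 0 0 = upper (- a) (- v) (- w) 0 0 0"
    by (rule minus_unique, rule symmetric_eqI) (auto simp: prod_eq_iff)
  with step2 show ?case
    unfolding zmul_minus_1 by (auto simp: algebra_simps intro!: symmetric_eqI)
qed (auto intro!: symmetric_eqI simp: prod_eq_iff)

lemma rho_upper:
  "rho 0 = upper (1, 0) 0 0 0 0 0" "rho 1 = upper (0, 1) 0 0 0 0 0"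
  "rho 2 = upper 0 0 0 1 0 0" "rho 3 = upper 0 0 0 0 0 1"
  "rho 6 = upper 0 (1, 0) 0 0 0 0" "rho 7 = upper 0 (0, 1) 0 0 0 0" "rho 8 = upper 0 0 0 0 1 0"
  by (rule symmetric_eqI, auto simp: app_rho)+

interpretation rho: abels_relations rho k for k
proof
  fix l r assume lr: "(l, r) \<in> relations k"
  have sh: "ev rho [(9 + j, True), (0, True)]
      = ev rho (replicate (1 + 6 * j) (0, True) @ replicate 6 (1, True) @ [(9 + j, True)])"
    "ev rho [(9 + j, True), (1, True)]
      = ev rho (replicate (6 * j * j) (0, False) @ replicate (6 * j) (1, False) @ [(1, True), (9 + j, True)])" for j
    by (rule symmetric_eqI;
        simp only: ev_append ev_replicate rho_upper zmul_upper ev.simps fst_conv snd_conv if_True if_False;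
        auto simp: rho_upper app_rho shear_def Let_def algebra_simps)+
  show "ev rho l = ev rho r"
    using lr sh unfolding relations_def commuting_letters_def
    by (auto intro!: symmetric_eqI simp: app_rho)
qed

lemma abels_relations_map:
  assumes "abels_relations f k" and h: "\<And>x y. h (x + y) = h x + h y"
  shows "abels_relations (\<lambda>i. h (f i)) k"
proof
  show "ev (\<lambda>i. h (f i)) l = ev (\<lambda>i. h (f i)) r" if "(l, r) \<in> relations k" for l r
    using abels_relations.relation[OF assms(1) that] by (simp add: ev_hom[OF h])
qed

lemma nf_map:
  assumes f: "abels_relations f k" and h: "\<And>x y. h (x + y) = h x + h y"
  shows "h (abels_relations.nf f w v a q r s l) = abels_relations.nf (\<lambda>i. h (f i)) w v a q r s l"
proof -
  interpret f: abels_relations f k by fact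
  interpret g: abels_relations "\<lambda>i. h (f i)" k
    using f h by (rule abels_relations_map)
  have h0: "h 0 = 0"
    using h[of 0 0] by (intro add_self_eq_0) simp
  have hm: "h (- x) = - h x" for x
    using h[of "- x" x] by (simp add: h0 eq_neg_iff_add_eq_0)
  have hd: "h (x - y) = h x - h y" for x y
    using h[of x "- y"] by (simp add: hm)
  have e: "h (f.e12 i r) = g.e12 i r" "h (f.e13 i r) = g.e13 i r" "h (f.e23 r) = g.e23 r"
    "h (f.e24 r) = g.e24 r" "h (f.e34 r) = g.e34 r" for i r
    unfolding f.e12_def f.e13_def f.e23_def f.e24_def f.e34_def
      g.e12_def g.e13_def g.e23_def g.e24_def g.e34_def
    by (simp_all add: dyadic_multiple_map[of h, OF h] hm)
  have "h (f.e14 i r) = g.e14 i r" for i r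
    by (simp add: f.e14_def g.e14_def conj_by_def h hd e)
  then show ?thesis
    by (simp add: f.nf_def g.nf_def f.vec_def g.vec_def h e ev_hom[OF h])
qed

text \<open>
  Computing in the product of two groups that satisfy the relations gives the same parameters in
  both. This transports the faithful concrete description to an unknown group.
\<close>

lemma joint_normal_form:
  assumes f: "abels_relations f k" and u: "fst ` set u \<subseteq> {..<9 + k}"
  obtains w v a q r s l where "ev f u = abels_relations.nf f w v a q r s l" "ev rho u = abels_relations.nf rho w v a q r s l"
    "w \<in> dyadic \<times> dyadic" "v \<in> dyadic \<times> dyadic" "a \<in> dyadic \<times> dyadic"
    "q \<in> dyadic" "r \<in> dyadic" "s \<in> dyadic" "set l \<subseteq> abels_relations.torus_letters k"
proof -
  interpret f: abels_relations f k by fact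
  let ?g = "\<lambda>i. (f i, rho i)"
  interpret g: abels_relations ?g k
    by standard (simp add: ev_Pair f.relation rho.relation)
  obtain w v a q r s l where nf: "ev ?g u = g.nf w v a q r s l" and D:
    "w \<in> dyadic \<times> dyadic" "v \<in> dyadic \<times> dyadic" "a \<in> dyadic \<times> dyadic"
    "q \<in> dyadic" "r \<in> dyadic" "s \<in> dyadic" "set l \<subseteq> g.torus_letters"
    using g.normal_form_ev[OF u] by (auto simp: g.normal_form_def)
  have "ev f u = fst (g.nf w v a q r s l)" "ev rho u = snd (g.nf w v a q r s l)"
    by (simp_all flip: nf add: ev_Pair)
  then have "ev f u = f.nf w v a q r s l" "ev rho u = rho.nf w v a q r s l"
    using nf_map[OF g.abels_relations_axioms, of fst] nf_map[OF g.abels_relations_axioms, of snd] by simp_all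
  then show ?thesis
    using that D by (simp add: f.torus_letters_def g.torus_letters_def)
qed

definition unit_vec :: "bool \<Rightarrow> real \<times> real" where
  "unit_vec i = (if i then (0, 1) else (1, 0))"

lemma rho_root:
  assumes "r \<in> dyadic"
  shows "rho.e12 i r = upper (r *\<^sub>R unit_vec i) 0 0 0 0 0" "rho.e13 i r = upper 0 (r *\<^sub>R unit_vec i) 0 0 0 0"
    "rho.e23 r = upper 0 0 0 r 0 0" "rho.e24 r = upper 0 0 0 0 r 0" "rho.e34 r = upper 0 0 0 0 0 r"
proof -
  have rho4: "app (rho 4) (p, y, z) = (p, 2 * y, z)" "app (- rho 4) (p, y, z) = (p, y / 2, z)"
    "app (rho 5) (p, y, z) = (p, y, 2 * z)" "app (- rho 5) (p, y, z) = (p, y, z / 2)" for p y z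
    by (simp_all add: app_rho)
  show "rho.e12 i r = upper (r *\<^sub>R unit_vec i) 0 0 0 0 0"
    unfolding rho.e12_def
    by (rule dyadic_multiple_unique[OF _ _ _ assms])
      (auto simp: dyadic_hom_def conj_by_eq_iff rho4 rho_upper rho_upper(2)[unfolded One_nat_def]
        unit_vec_def algebra_simps intro!: symmetric_eqI)
  show "rho.e13 i r = upper 0 (r *\<^sub>R unit_vec i) 0 0 0 0"
    unfolding rho.e13_def
    by (rule dyadic_multiple_unique[OF _ _ _ assms])
      (auto simp: dyadic_hom_def conj_by_eq_iff rho4 rho_upper rho_upper(2)[unfolded One_nat_def]
        unit_vec_def algebra_simps intro!: symmetric_eqI)
  show "rho.e23 r = upper 0 0 0 r 0 0"
    unfolding rho.e23_def
    by (rule dyadic_multiple_unique[OF _ _ _ assms])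
      (auto simp: dyadic_hom_def conj_by_eq_iff rho4 rho_upper algebra_simps intro!: symmetric_eqI)
  show "rho.e24 r = upper 0 0 0 0 r 0"
    unfolding rho.e24_def
    by (rule dyadic_multiple_unique[OF _ _ _ assms])
      (auto simp: dyadic_hom_def conj_by_eq_iff rho4 rho_upper algebra_simps intro!: symmetric_eqI)
  show "rho.e34 r = upper 0 0 0 0 0 r"
    unfolding rho.e34_def
    by (rule dyadic_multiple_unique[OF _ _ _ assms])
      (auto simp: dyadic_hom_def conj_by_eq_iff rho4 rho_upper algebra_simps intro!: symmetric_eqI)
qed

lemma rho_e14:
  assumes "r \<in> dyadic"
  shows "rho.e14 i r = upper 0 0 (r *\<^sub>R unit_vec i) 0 0 0"
proof -
  have "conj_by (rho.e12 i r) (rho.e24 1) = upper 0 0 (r *\<^sub>R unit_vec i) 0 0 0 + rho.e24 1"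
    unfolding conj_by_eq_iff rho_root[OF assms] rho_root[OF dyadic_simps(2)]
    by (auto intro!: symmetric_eqI simp: algebra_simps)
  then show ?thesis
    by (simp add: rho.e14_def diff_eq_eq)
qed

lemma rho_vec:
  assumes "v \<in> dyadic \<times> dyadic"
  shows "rho.vec rho.e12 v = upper v 0 0 0 0 0" "rho.vec rho.e13 v = upper 0 v 0 0 0 0"
    "rho.vec rho.e14 v = upper 0 0 v 0 0 0"
  using assms
  by (auto simp: rho.vec_def rho_root rho_e14 unit_vec_def algebra_simps intro!: symmetric_eqI)

definition linear_map :: "(real \<times> real \<Rightarrow> real \<times> real) \<Rightarrow> bool" where
  "linear_map L \<longleftrightarrow> (\<forall>p p'. L (p + p') = L p + L p') \<and> (\<forall>c p. L (c *\<^sub>R p) = c *\<^sub>R L p)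
     \<and> L ` (\<int> \<times> \<int>) \<subseteq> \<int> \<times> \<int>"

lemma linear_mapD:
  assumes "linear_map L"
  shows "L (p + p') = L p + L p'" "L (c *\<^sub>R p) = c *\<^sub>R L p" "p \<in> \<int> \<times> \<int> \<Longrightarrow> L p \<in> \<int> \<times> \<int>"
  using assms by (simp_all only: linear_map_def image_subset_iff)

lemma shear_scale: "shear j b (c *\<^sub>R p) = c *\<^sub>R shear j b p"
  by (simp add: shear_def Let_def prod_eq_iff algebra_simps)

lemma shear_Ints: "p \<in> \<int> \<times> \<int> \<Longrightarrow> shear j b p \<in> \<int> \<times> \<int>"
  by (auto simp: shear_def Let_def)

lemma torus_word_app:
  assumes "set l \<subseteq> abels_relations.torus_letters k"
  obtains L \<kappa> \<mu> where "linear_map L" "\<kappa> \<noteq> 0" "1 / \<kappa> \<in> dyadic" "\<mu> \<noteq> 0" "1 / \<mu> \<in> dyadic"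
    "\<And>p y z. app (ev rho l) (p, y, z) = (L p, \<kappa> * y, \<mu> * z)"
proof -
  let ?P = "\<lambda>l L \<kappa> \<mu>. linear_map L \<and> \<kappa> \<noteq> 0 \<and> 1 / \<kappa> \<in> dyadic \<and> \<mu> \<noteq> 0 \<and> 1 / \<mu> \<in> dyadic
    \<and> (\<forall>p y z. app (ev rho l) (p, y, z) = (L p, \<kappa> * y, \<mu> * z))"
  define c :: "bool \<Rightarrow> real" where "c b = (if b then 2 else 1 / 2)" for b
  have c: "c b * x \<noteq> 0" "1 / (c b * x) \<in> dyadic" if "x \<noteq> 0" "1 / x \<in> dyadic" for b x
    using that dyadic_half[OF that(2)] dyadic_mult[OF dyadic_simps(3) that(2)]
    by (simp_all add: c_def mult.commute)
  have "\<exists>L \<kappa> \<mu>. ?P l L \<kappa> \<mu>"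
    using assms
  proof (induction l)
    case Nil
    have "?P [] id 1 1"
      by (auto simp: linear_map_def)
    then show ?case
      by blast
  next
    case (Cons x l)
    have "set l \<subseteq> abels_relations.torus_letters k"
      using Cons.prems by simp
    then obtain L \<kappa> \<mu> where L: "?P l L \<kappa> \<mu>"
      using Cons.IH by blast
    have ev: "app (ev rho l) (p, y, z) = (L p, \<kappa> * y, \<mu> * z)" for p y z
      using L by blast
    have L: "linear_map L" "\<kappa> \<noteq> 0" "1 / \<kappa> \<in> dyadic" "\<mu> \<noteq> 0" "1 / \<mu> \<in> dyadic"
      using L by blast+
    obtain i b where x: "x = (i, b)"
      by (cases x)
    have "i = 4 \<or> i = 5 \<or> i \<ge> 9"
      using Cons.prems by (auto simp: rho.torus_letters_def x)
    then show ?case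
    proof (elim disjE)
      assume i: "i = 4"
      have "app (ev rho (x # l)) (p, y, z) = (L p, c b * \<kappa> * y, \<mu> * z)" for p y z
        unfolding app_ev_Cons ev by (simp add: x i c_def)
      then have "?P (x # l) L (c b * \<kappa>) \<mu>"
        using L c(1)[OF L(2,3), of b] c(2)[OF L(2,3), of b] by blast
      then show ?thesis
        by blast
    next
      assume i: "i = 5"
      have "app (ev rho (x # l)) (p, y, z) = (L p, \<kappa> * y, c b * \<mu> * z)" for p y z
        unfolding app_ev_Cons ev by (simp add: x i c_def)
      then have "?P (x # l) L \<kappa> (c b * \<mu>)"
        using L c(1)[OF L(4,5), of b] c(2)[OF L(4,5), of b] by blast
      then show ?thesis
        by blast
    next
      assume i: "i \<ge> 9"
      have "app (ev rho (x # l)) (p, y, z) = (shear (i - 9) b (L p), \<kappa> * y, \<mu> * z)" for p y z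
        unfolding app_ev_Cons ev using i by (simp add: x)
      moreover have "linear_map (\<lambda>p. shear (i - 9) b (L p))"
        unfolding linear_map_def
      proof (intro conjI allI image_subsetI)
        have "L (p + p') = L p + L p'" "L (e *\<^sub>R p) = e *\<^sub>R L p" for p p' e
          using L(1) by (rule linear_mapD)+
        then show "shear (i - 9) b (L (p + p')) = shear (i - 9) b (L p) + shear (i - 9) b (L p')"
          "shear (i - 9) b (L (e *\<^sub>R p)) = e *\<^sub>R shear (i - 9) b (L p)" for p p' e
          by (simp_all only: shear_add shear_scale)
        fix p :: "real \<times> real" assume "p \<in> \<int> \<times> \<int>"
        then have "L p \<in> \<int> \<times> \<int>"
          by (rule linear_mapD(3)[OF L(1)])
        then show "shear (i - 9) b (L p) \<in> \<int> \<times> \<int>"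
          by (rule shear_Ints)
      qed
      ultimately have "?P (x # l) (\<lambda>p. shear (i - 9) b (L p)) \<kappa> \<mu>"
        using L by blast
      then show ?thesis
        by blast
    qed
  qed
  then show ?thesis
    using that by blast
qed

lemma app_rho_nf:
  assumes D: "w \<in> dyadic \<times> dyadic" "v \<in> dyadic \<times> dyadic" "a \<in> dyadic \<times> dyadic" "q \<in> dyadic" "r \<in> dyadic" "s \<in> dyadic"
    and L: "\<And>p y z. app (ev rho l) (p, y, z) = (L p, \<kappa> * y, \<mu> * z)"
  shows "app (rho.nf w v a q r s l) (p, y, z)
    = (L p + (\<kappa> * y + r * (\<mu> * z + s) + q) *\<^sub>R a + (\<mu> * z + s) *\<^sub>R v + w,
       \<kappa> * y + r * (\<mu> * z + s) + q, \<mu> * z + s)"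
  using D by (simp add: rho.nf_def rho_vec rho_root L)

text \<open>
  The parameters of a transformation can be read off from its values; torus words scale \<open>y\<close> and \<open>z\<close> and act
  linearly on \<open>p\<close>.
\<close>

lemma nf_rho_central:
  assumes D: "w \<in> dyadic \<times> dyadic" "v \<in> dyadic \<times> dyadic" "a \<in> dyadic \<times> dyadic"
    "q \<in> dyadic" "r \<in> dyadic" "s \<in> dyadic" "set l \<subseteq> abels_relations.torus_letters k"
    and eq: "rho.nf w v a q r s l = upper 0 0 n 0 0 0"
  shows "w = n" "v = 0" "a = 0" "q = 0" "r = 0" "s = 0" "ev rho l = 0"
proof -
  obtain L \<kappa> \<mu> where lin: "linear_map L" and "\<kappa> \<noteq> 0" "1 / \<kappa> \<in> dyadic" "\<mu> \<noteq> 0" "1 / \<mu> \<in> dyadic"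
    and app: "\<And>p y z. app (ev rho l) (p, y, z) = (L p, \<kappa> * y, \<mu> * z)"
    using that by (rule torus_word_app[OF D(7)])
  have "L (0 *\<^sub>R 0) = 0 *\<^sub>R L 0"
    using lin by (rule linear_mapD)
  then have "L 0 = 0"
    by simp
  note L = this app
  have *: "L p + (\<kappa> * y + r * (\<mu> * z + s) + q) *\<^sub>R a + (\<mu> * z + s) *\<^sub>R v + w = p + n
      \<and> \<kappa> * y + r * (\<mu> * z + s) + q = y \<and> \<mu> * z + s = z" for p y z
  proof -
    have "app (rho.nf w v a q r s l) (p, y, z)
        = (L p + (\<kappa> * y + r * (\<mu> * z + s) + q) *\<^sub>R a + (\<mu> * z + s) *\<^sub>R v + w,
           \<kappa> * y + r * (\<mu> * z + s) + q, \<mu> * z + s)"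
      by (rule app_rho_nf[OF D(1-6), of l L \<kappa> \<mu>]) (rule app)
    from this[symmetric] have "(L p + (\<kappa> * y + r * (\<mu> * z + s) + q) *\<^sub>R a + (\<mu> * z + s) *\<^sub>R v + w,
           \<kappa> * y + r * (\<mu> * z + s) + q, \<mu> * z + s) = (p + n, y, z)"
      by (rule trans) (simp add: eq)
    then show ?thesis
      unfolding prod.inject .
  qed
  have s: "s = 0" "\<mu> = 1" and q: "q = 0" "\<kappa> = 1"
    using *[of 0 0 0] *[of 0 0 1] *[of 0 1 0] by auto
  show "s = 0" "q = 0" by fact+
  show r: "r = 0"
    using *[of 0 0 1] s q by auto
  show w: "w = n"
    using *[of 0 0 0] s q L(1) by auto
  show "a = 0" "v = 0"
    using *[of 0 1 0] *[of 0 0 1] s q r w L(1) by auto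
  have "L p = p" for p
    using *[of p 0 0] s q w by auto
  then show "ev rho l = 0"
    using s q by (auto intro!: symmetric_eqI simp: L)
qed

section \<open>Freeness of the shears\<close>

text \<open>
  One half, depending on the sign \<open>b\<close>, of a cone around the fixed line of \<open>shear j\<close>, without that line. The map \<open>shear j b\<close> pushes into
  it all vectors that lie neither on the line nor in the opposite half. The vector \<open>(1, 0)\<close> lies in
  none of the cones.
\<close>

definition pingpong :: "nat \<Rightarrow> bool \<Rightarrow> (real \<times> real) set" where
  "pingpong j b = {v. let h = fst v - real j * snd v in
     h \<noteq> 0 \<and> 3 * \<bar>h\<bar> \<le> \<bar>snd v\<bar> \<and> (if b then h * snd v > 0 else h * snd v < 0)}"

lemma shear_pingpong_start: "shear j b (1, 0) \<in> pingpong j b"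
  by (simp add: pingpong_def shear_def Let_def)

lemma shear_invariant: "fst (shear j b v) - real j * snd (shear j b v) = fst v - real j * snd v"
  by (simp add: shear_def Let_def algebra_simps)

lemma shear_pingpong:
  assumes v: "v \<in> pingpong i c" and ne: "\<not> (i = j \<and> c = (\<not> b))"
  shows "shear j b v \<in> pingpong j b"
proof -
  define h where "h = fst v - real j * snd v"
  have snd: "snd (shear j b v) = snd v + (if b then 6 else - 6) * h"
    by (simp add: shear_def Let_def h_def)
  have "h \<noteq> 0 \<and> 3 * \<bar>h\<bar> \<le> \<bar>snd (shear j b v)\<bar> \<and> (if b then h * snd (shear j b v) > 0 else h * snd (shear j b v) < 0)"
  proof (cases "i = j")
    case True
    then have "c = b"
      using ne by auto
    then have "h \<noteq> 0" "3 * \<bar>h\<bar> \<le> \<bar>snd v\<bar>" "if b then h * snd v > 0 else h * snd v < 0"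
      using v True by (auto simp: pingpong_def h_def Let_def)
    then show ?thesis
      unfolding snd by (cases b; cases "h > 0") (auto simp: zero_less_mult_iff mult_less_0_iff)
  next
    case False
    define g where "g = fst v - real i * snd v"
    have g: "g \<noteq> 0" "3 * \<bar>g\<bar> \<le> \<bar>snd v\<bar>"
      using v by (auto simp: pingpong_def g_def Let_def)
    have "\<bar>real i - real j\<bar> \<ge> 1"
      using False by (simp add: abs_if)
    define m where "m = (real i - real j) * snd v"
    have "\<bar>m\<bar> \<ge> \<bar>snd v\<bar>"
      using \<open>\<bar>real i - real j\<bar> \<ge> 1\<close> by (simp add: m_def abs_mult mult_le_cancel_right1)
    moreover have "h = g + m"
      by (simp add: h_def g_def m_def algebra_simps)
    ultimately have "3 * \<bar>h\<bar> \<ge> 2 * \<bar>snd v\<bar>" "snd v \<noteq> 0"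
      using g by (auto simp: abs_if split: if_splits)
    then show ?thesis
      unfolding snd by (cases b; cases "h > 0") (auto simp: zero_less_mult_iff mult_less_0_iff abs_if split: if_splits)
  qed
  then show ?thesis
    unfolding pingpong_def mem_Collect_eq shear_invariant Let_def h_def[symmetric] .
qed

lemma ev_rho_pingpong:
  assumes "reduced w" "w \<noteq> []" "\<And>x. x \<in> set w \<Longrightarrow> fst x \<ge> 9"
  shows "fst (app (ev rho w) ((1, 0), y, z)) \<in> pingpong (fst (hd w) - 9) (snd (hd w))"
  using assms
proof (induction w)
  case (Cons x w)
  obtain p y' z' where P: "app (ev rho w) ((1, 0), y, z) = (p, y', z')"
    by (cases "app (ev rho w) ((1, 0), y, z)")
  have x: "fst x \<ge> 9"
    using Cons.prems by simp
  have "fst (app (ev rho (x # w)) ((1, 0), y, z)) = shear (fst x - 9) (snd x) p"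
    unfolding app_ev_Cons P using x by simp
  moreover have "shear (fst x - 9) (snd x) p \<in> pingpong (fst x - 9) (snd x)"
  proof (cases w)
    case Nil
    then show ?thesis
      using P shear_pingpong_start by auto
  next
    case (Cons x' w')
    have "reduced w" "x' \<noteq> letter_inv x"
      using Cons.prems(1) by (simp_all add: reduced_def Cons successively_Cons)
    have p: "p \<in> pingpong (fst x' - 9) (snd x')"
      using Cons.IH[OF \<open>reduced w\<close>] Cons.prems(3) P Cons by simp
    have "fst x' \<ge> 9"
      using Cons.prems(3) Cons by simp
    then have "\<not> (fst x' - 9 = fst x - 9 \<and> snd x' = (\<not> snd x))"
      using x \<open>x' \<noteq> letter_inv x\<close> by (auto simp: letter_inv_def prod_eq_iff)
    then show ?thesis
      using shear_pingpong[OF p] by blast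
  qed
  ultimately show ?case
    by simp
qed simp

text \<open>
  A nonempty reduced word moves \<open>(1, 0)\<close> into a cone, so the word must reduce to the empty one.
\<close>

lemma rho_free:
  assumes "ev rho w = 0" "\<And>x. x \<in> set w \<Longrightarrow> fst x \<ge> 9"
  shows "ev f w = 0"
proof -
  let ?w = "foldr push w []"
  have "?w = []"
  proof (rule ccontr)
    assume "?w \<noteq> []"
    moreover have "reduced ?w"
      by (rule reduced_foldr_push) (simp add: reduced_def)
    moreover have "fst x \<ge> 9" if "x \<in> set ?w" for x
      using that assms(2)[of x] letters_foldr_push[of w "[]"] by auto
    ultimately have "fst (app (ev rho ?w) ((1, 0), 0, 0)) \<in> pingpong (fst (hd ?w) - 9) (snd (hd ?w))"
      by (intro ev_rho_pingpong)
    then show False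
      using assms(1) by (simp add: ev_foldr_push pingpong_def)
  qed
  then show ?thesis
    using ev_foldr_push[of f w "[]"] by simp
qed

section \<open>Faithfulness of the affine representation\<close>

fun exponent_sum :: "nat \<Rightarrow> word \<Rightarrow> int" where
  "exponent_sum i [] = 0"
| "exponent_sum i (x # w) = (if fst x = i then if snd x then 1 else - 1 else 0) + exponent_sum i w"

text \<open>
  The torus letters commute with each other and with the shears, so they can be collected.
\<close>

lemma (in abels_relations) ev_torus_word:
  assumes "set l \<subseteq> torus_letters"
  shows "ev f l = zmul (exponent_sum 4 l) (f 4) + (zmul (exponent_sum 5 l) (f 5) + ev f (filter (\<lambda>x. fst x \<ge> 9) l))"
  using assms
proof (induction l)
  case (Cons x l)
  obtain i b where x: "x = (i, b)"
    by (cases x)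
  let ?g = "if b then f i else - f i"
  have step: "ev f (x # l) = ?g + (zmul (exponent_sum 4 l) (f 4) + (zmul (exponent_sum 5 l) (f 5) + ev f (filter (\<lambda>x. fst x \<ge> 9) l)))"
    using Cons by (simp add: x)
  have zm: "?g + zmul n (f i) = zmul ((if b then 1 else - 1) + n) (f i)" for n
    using zmul_plus_1[of n "f i"] zmul_minus_1[of n "f i"] by (simp add: add.commute[of 1 n])
  have shift: "?g + (zmul n y + z) = zmul n y + (?g + z)" if "commute (f i) y" for n y z
    using that by (intro commute_shift) (auto intro: commute_zmul commute_minus_left)
  consider "i = 4" | "i = 5" | j where "i = 9 + j" "j < k"
    using Cons.prems le_Suc_ex[of 9 i] by (force simp: torus_letters_def x)
  then show ?case
  proof cases
    case 1
    then show ?thesis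
      unfolding step using zm by (simp add: x flip: add.assoc)
  next
    case 2
    have "commute (f i) (f 4)"
      using commuting[of 4 5] 2 by (simp add: commuting_letters_def commute_sym)
    then show ?thesis
      unfolding step shift[OF \<open>commute (f i) (f 4)\<close>] using zm 2 by (simp add: x flip: add.assoc)
  next
    case (3 j)
    have "commute (f i) (f 4)" "commute (f i) (f 5)"
      using commute_free 3 by simp_all
    then show ?thesis
      unfolding step using shift 3 by (simp add: x)
  qed
qed simp

lemma app_zmul_rho:
  "app (zmul n (rho 4)) (p, y, z) = (p, 2 powr of_int n * y, z)"
  "app (zmul n (rho 5)) (p, y, z) = (p, y, 2 powr of_int n * z)"
  by (induction n arbitrary: y z rule: int_induct[where k = 0])
    (simp_all only: zmul_0 zmul_plus_1 zmul_minus_1,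
     simp_all add: app_rho powr_add powr_diff)

lemma snd_app_free_word:
  "(\<And>x. x \<in> set l \<Longrightarrow> fst x \<ge> 9) \<Longrightarrow> snd (app (ev rho l) P) = snd P"
proof (induction l)
  case (Cons x l)
  obtain p y z where p: "app (ev rho l) P = (p, y, z)"
    by (cases "app (ev rho l) P")
  then have "snd P = (y, z)"
    using Cons by simp
  then show ?case
    unfolding app_ev_Cons p using Cons.prems[of x] by simp
qed simp

lemma torus_word_trivial:
  assumes "abels_relations f k" "set l \<subseteq> abels_relations.torus_letters k" "ev rho l = 0"
  shows "ev f l = 0"
proof -
  interpret f: abels_relations f k by fact
  let ?l = "filter (\<lambda>x. fst x \<ge> 9) l" and ?m = "exponent_sum 4 l" and ?n = "exponent_sum 5 l"
  have l: "set l \<subseteq> f.torus_letters"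
    using assms(2) by (simp add: f.torus_letters_def rho.torus_letters_def)
  have rho: "ev rho l = zmul ?m (rho 4) + (zmul ?n (rho 5) + ev rho ?l)"
    by (rule rho.ev_torus_word[OF assms(2)])
  obtain p where "app (ev rho ?l) ((0, 0), 1, 1) = (p, 1, 1)"
    using snd_app_free_word[of ?l "((0, 0), 1, 1)"] by (cases "app (ev rho ?l) ((0, 0), 1, 1)") auto
  then have "(p, 2 powr of_int ?m, 2 powr of_int ?n) = app (ev rho l) ((0, 0), 1, 1)"
    by (simp add: rho app_zmul_rho)
  then have "?m = 0" "?n = 0"
    by (simp_all add: assms(3) powr_eq_one_iff_gen)
  then have "ev rho ?l = 0"
    using rho assms(3) by simp
  then have "ev f ?l = 0"
    by (rule rho_free) simp
  then show ?thesis
    using f.ev_torus_word[OF l] \<open>?m = 0\<close> \<open>?n = 0\<close> by simp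
qed

definition central_lattice :: "point symmetric set" where
  "central_lattice = {upper 0 0 w 0 0 0 | w. w \<in> \<int> \<times> \<int>}"

text \<open>
  The finite presentation: the relations, together with the commutation of the letters \<open>0\<close> and \<open>1\<close> with \<open>8\<close>,
  which kills the lattice in the root \<open>14\<close>, imply every relation that holds in the affine group
  modulo that lattice.
\<close>

theorem kernel_trivial:
  assumes f: "abels_relations f k" and central: "commute (f 0) (f 8)" "commute (f 1) (f 8)"
    and u: "fst ` set u \<subseteq> {..<9 + k}" "ev rho u \<in> central_lattice"
  shows "ev f u = 0"
proof -
  interpret f: abels_relations f k by fact
  obtain n where n: "ev rho u = upper 0 0 n 0 0 0" "n \<in> \<int> \<times> \<int>"
    using u(2) by (auto simp: central_lattice_def)
  obtain w v a q r s l where nf: "ev f u = f.nf w v a q r s l" "ev rho u = rho.nf w v a q r s l"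
    and D: "w \<in> dyadic \<times> dyadic" "v \<in> dyadic \<times> dyadic" "a \<in> dyadic \<times> dyadic"
      "q \<in> dyadic" "r \<in> dyadic" "s \<in> dyadic" "set l \<subseteq> abels_relations.torus_letters k"
    using joint_normal_form[OF f u(1)] by blast
  have triv: "w = n" "v = 0" "a = 0" "q = 0" "r = 0" "s = 0" "ev rho l = 0"
    using nf_rho_central[OF D, of n] nf(2) n(1) by simp_all
  have "ev f l = 0"
    using f D(7) triv(7) by (rule torus_word_trivial)
  moreover have "f.e14 i (of_int m) = 0" for i m
  proof -
    have "f.e14 i 1 = 0"
      using central by (auto simp: f.e14_def of_bool_def commute_iff_conj_by)
    then show ?thesis
      using dyadic_hom_zmul[OF f.hom_e14, of 1 i m] zmul_hom[of "\<lambda>_. 0" m 0] by simp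
  qed
  then have "f.vec f.e14 n = 0"
    using n(2) by (auto simp: f.vec_def elim!: Ints_cases)
  ultimately show ?thesis
    unfolding nf(1) triv by (simp add: f.nf_def f.vec_def dyadic_hom_0)
qed

section \<open>Normal subgroups of the affine group\<close>

definition rho_group :: "nat \<Rightarrow> point symmetric set" where
  "rho_group k = {ev rho u | u. fst ` set u \<subseteq> {..<9 + k}}"

lemma rho_group_closed:
  shows rho_group_rho: "i < 9 + k \<Longrightarrow> rho i \<in> rho_group k"
    and rho_group_plus: "g \<in> rho_group k \<Longrightarrow> h \<in> rho_group k \<Longrightarrow> g + h \<in> rho_group k"
    and rho_group_minus: "g \<in> rho_group k \<Longrightarrow> - g \<in> rho_group k"
proof -
  show "i < 9 + k \<Longrightarrow> rho i \<in> rho_group k"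
    unfolding rho_group_def by (intro CollectI exI[of _ "[(i, True)]"]) simp
  show "g \<in> rho_group k \<Longrightarrow> h \<in> rho_group k \<Longrightarrow> g + h \<in> rho_group k"
    unfolding rho_group_def by (auto simp flip: ev_append) (metis image_Un set_append Un_least)
  assume "g \<in> rho_group k"
  then obtain u where u: "fst ` set u \<subseteq> {..<9 + k}" "g = ev rho u"
    by (auto simp: rho_group_def)
  then have "fst ` set (map letter_inv (rev u)) \<subseteq> {..<9 + k}"
    by auto
  then show "- g \<in> rho_group k"
    unfolding rho_group_def u(2) ev_inverse[symmetric] by blast
qed

lemma rho_group_dyadic_multiple:
  assumes "s \<in> rho_group k" "x \<in> rho_group k"
  shows "dyadic_multiple s x r \<in> rho_group k"
proof -
  have 0: "0 \<in> rho_group k"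
    unfolding rho_group_def by (intro CollectI exI[of _ "[]"]) simp
  have "((+) x ^^ n) 0 \<in> rho_group k" for n
    by (induction n) (auto simp: 0 assms rho_group_plus)
  then have z: "zmul m x \<in> rho_group k" for m
    by (simp add: zmul_def rho_group_minus)
  have "(conj_by s ^^ n) (zmul m x) \<in> rho_group k" for n m
    by (induction n) (auto simp: z conj_by_def diff_conv_add_uminus assms
        simp del: add_uminus_conv_diff intro!: rho_group_plus rho_group_minus)
  then show ?thesis
    by (simp add: dyadic_multiple_def Let_def)
qed

lemma upper_in_rho_group:
  assumes "w \<in> dyadic \<times> dyadic" "q \<in> dyadic"
  shows "upper w 0 0 0 0 0 \<in> rho_group k" "upper 0 w 0 0 0 0 \<in> rho_group k" "upper 0 0 w 0 0 0 \<in> rho_group k"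
    "upper 0 0 0 0 q 0 \<in> rho_group k" "upper 0 0 0 0 0 q \<in> rho_group k"
proof -
  have e: "rho.e12 i r \<in> rho_group k" "rho.e13 i r \<in> rho_group k" "rho.e24 r \<in> rho_group k" "rho.e34 r \<in> rho_group k" for i r
    unfolding rho.e12_def rho.e13_def rho.e24_def rho.e34_def
    by (intro rho_group_dyadic_multiple rho_group_minus rho_group_rho; simp)+
  then have "rho.e14 i r \<in> rho_group k" for i r
    unfolding rho.e14_def conj_by_def diff_conv_add_uminus by (intro rho_group_plus rho_group_minus)
  then have "rho.vec rho.e12 w \<in> rho_group k" "rho.vec rho.e13 w \<in> rho_group k" "rho.vec rho.e14 w \<in> rho_group k"
    using e by (simp_all add: rho.vec_def rho_group_plus)
  then show "upper w 0 0 0 0 0 \<in> rho_group k" "upper 0 w 0 0 0 0 \<in> rho_group k" "upper 0 0 w 0 0 0 \<in> rho_group k"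
    using assms by (simp_all add: rho_vec)
  show "upper 0 0 0 0 q 0 \<in> rho_group k" "upper 0 0 0 0 0 q \<in> rho_group k"
    using e assms by (simp_all flip: rho_root)
qed

lemma not_Ints_quotient:
  assumes "x \<noteq> (0 :: real)"
  obtains n :: nat where "x / 2 ^ n \<notin> \<int>"
proof -
  obtain n where "\<bar>x\<bar> < 2 ^ n"
    using real_arch_pow[of 2 "\<bar>x\<bar>"] by auto
  then have "\<bar>x / 2 ^ n\<bar> < 1"
    by (simp add: abs_divide)
  moreover have "x / 2 ^ n \<noteq> 0"
    using assms by simp
  ultimately have "x / 2 ^ n \<notin> \<int>"
    using Ints_nonzero_abs_less1 by blast
  then show ?thesis
    by (rule that)
qed

lemma not_Ints_quotient_pair:
  assumes "v \<noteq> (0 :: real \<times> real)"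
  obtains n :: nat where "(1 / 2 ^ n) *\<^sub>R v \<notin> \<int> \<times> \<int>"
proof -
  have "fst v \<noteq> 0 \<or> snd v \<noteq> 0"
    using assms by (simp add: prod_eq_iff)
  then obtain n where "fst v / 2 ^ n \<notin> \<int> \<or> snd v / 2 ^ n \<notin> \<int>"
    by (metis not_Ints_quotient)
  then have "(1 / 2 ^ n) *\<^sub>R v \<notin> \<int> \<times> \<int>"
    by (auto simp: mem_Times_iff)
  then show ?thesis
    by (rule that)
qed

definition half_lattice :: "(real \<times> real) set" where
  "half_lattice = {(1 / 2, 0), (0, 1 / 2), (1 / 2, 1 / 2)}"

text \<open>
  The image of a normal subgroup that contains the lattice in the root \<open>14\<close>.
\<close>

locale rho_normal =
  fixes k :: nat and S :: "point symmetric set"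
  assumes plus: "g \<in> S \<Longrightarrow> h \<in> S \<Longrightarrow> g + h \<in> S"
    and minus: "g \<in> S \<Longrightarrow> - g \<in> S"
    and conj: "g \<in> S \<Longrightarrow> h \<in> rho_group k \<Longrightarrow> conj_by h g \<in> S"
    and lattice: "central_lattice \<subseteq> S"
begin

lemma commutator:
  assumes "g \<in> S" "h \<in> rho_group k" "g + h = y + h + g"
  shows "y \<in> S"
proof -
  have "y + conj_by h g = g"
    by (simp add: conj_by_def add_diff_eq add.assoc[symmetric] assms(3)[symmetric])
  then have "y = g + - conj_by h g"
    by (metis add_uminus_conv_diff eq_diff_eq)
  moreover have "g + - conj_by h g \<in> S"
    using assms(1,2) by (intro plus minus conj)
  ultimately show ?thesis
    by simp
qed

text \<open>
  The quotient of \<open>\<int>[1/2]\<^sup>2\<close> by \<open>\<int>\<^sup>2\<close> is a 2-group whose elements of order two are the three classes of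
  \<^const>\<open>half_lattice\<close>; every nontrivial subgroup contains one of them.
\<close>

lemma meets_half_lattice_central:
  assumes "upper 0 0 w 0 0 0 \<in> S" "w \<in> dyadic \<times> dyadic" "w \<notin> \<int> \<times> \<int>"
  shows "\<exists>h\<in>half_lattice. upper 0 0 h 0 0 0 \<in> S"
proof -
  obtain m n K where w: "w = (of_int m / 2 ^ K, of_int n / 2 ^ K)"
    using assms(2) by (metis dyadic_common mem_Times_iff prod.collapse)
  then have ex: "2 ^ K *\<^sub>R w \<in> \<int> \<times> \<int>"
    by simp
  \<comment> \<open>The last multiple \<open>2 ^ i\<close> of \<open>w\<close> that is not yet integral is half-integral.\<close>
  define j where "j = (LEAST j. 2 ^ j *\<^sub>R w \<in> \<int> \<times> \<int>)"
  have j: "2 ^ j *\<^sub>R w \<in> \<int> \<times> \<int>"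
    unfolding j_def using ex by (rule LeastI)
  then have "j \<noteq> 0"
    using assms(3) by (auto intro!: gr0I)
  then obtain i where i: "j = Suc i"
    using not0_implies_Suc by blast
  then have ni: "2 ^ i *\<^sub>R w \<notin> \<int> \<times> \<int>"
    using not_less_Least[of i "\<lambda>j. 2 ^ j *\<^sub>R w \<in> \<int> \<times> \<int>"] by (simp add: j_def)
  have "zmul (2 ^ i) (upper 0 0 w 0 0 0) \<in> S"
  proof -
    have "((+) (upper 0 0 w 0 0 0) ^^ n) 0 \<in> S" for n
    proof (induction n)
      case 0
      have "upper 0 0 0 0 0 0 \<in> S"
        using lattice by (force simp: central_lattice_def zero_prod_def)
      moreover have "upper 0 0 0 0 0 0 = 0"
        by (auto intro!: symmetric_eqI)
      ultimately show ?case
        by simp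
    qed (auto intro: plus assms(1))
    then show ?thesis
      by (simp add: zmul_def)
  qed
  then have S: "upper 0 0 (2 ^ i *\<^sub>R w) 0 0 0 \<in> S"
    by (simp add: zmul_upper)
  obtain a b where ab: "2 ^ j *\<^sub>R w = (of_int a, of_int b)"
    using j by (auto elim!: Ints_cases)
  have half: "2 ^ i *\<^sub>R w = (of_int a / 2, of_int b / 2)"
    using ab unfolding i by (auto simp: prod_eq_iff field_simps)
  define h :: "real \<times> real" where "h = (of_int (a mod 2) / 2, of_int (b mod 2) / 2)"
  define d :: "real \<times> real" where "d = (of_int (- (a div 2)), of_int (- (b div 2)))"
  have "of_int x / 2 + of_int (- (x div 2)) = (of_int (x mod 2) / 2 :: real)" for x :: int
  proof -
    have "real_of_int x = of_int (2 * (x div 2) + x mod 2)"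
      by simp
    then have "real_of_int x = 2 * of_int (x div 2) + of_int (x mod 2)"
      by (simp only: of_int_add of_int_mult of_int_numeral)
    then show ?thesis
      unfolding of_int_minus by linarith
  qed
  then have "2 ^ i *\<^sub>R w + d = h"
    by (simp only: half d_def h_def add_Pair)
  then have "upper 0 0 d 0 0 0 + upper 0 0 (2 ^ i *\<^sub>R w) 0 0 0 = upper 0 0 h 0 0 0"
    by (auto intro!: symmetric_eqI simp: add.assoc)
  moreover have "d \<in> \<int> \<times> \<int>"
    by (simp add: d_def)
  then have "upper 0 0 d 0 0 0 \<in> S"
    using lattice unfolding central_lattice_def by blast
  ultimately have "upper 0 0 h 0 0 0 \<in> S"
    using plus[OF _ S] by metis
  moreover have "h \<in> half_lattice"
  proof -
    have "\<not> (even a \<and> even b)"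
      using ni half by (auto elim!: evenE)
    moreover have "x mod 2 = (if even x then 0 else 1)" for x :: int
      by presburger
    ultimately show ?thesis
      by (auto simp: h_def half_lattice_def)
  qed
  ultimately show ?thesis
    by blast
qed

text \<open>
  A commutator with the root \<open>24\<close> or \<open>34\<close> pushes a transformation of this kind into the root \<open>14\<close>; the
  element of that root is chosen so small that the result is not integral.
\<close>

lemma meets_half_lattice_upper:
  assumes S: "upper a v w 0 0 0 \<in> S" and D: "a \<in> dyadic \<times> dyadic" "v \<in> dyadic \<times> dyadic" "w \<in> dyadic \<times> dyadic"
    and nontrivial: "a \<noteq> 0 \<or> v \<noteq> 0 \<or> w \<notin> \<int> \<times> \<int>"
  shows "\<exists>h\<in>half_lattice. upper 0 0 h 0 0 0 \<in> S"
proof -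
  consider "a \<noteq> 0" | "a = 0" "v \<noteq> 0" | "a = 0" "v = 0" "w \<notin> \<int> \<times> \<int>"
    using nontrivial by blast
  then show ?thesis
  proof cases
    case 1
    then obtain n where n: "(1 / 2 ^ n) *\<^sub>R a \<notin> \<int> \<times> \<int>"
      by (rule not_Ints_quotient_pair)
    have "upper 0 0 ((1 / 2 ^ n) *\<^sub>R a) 0 0 0 \<in> S"
      by (rule commutator[OF S upper_in_rho_group(4)[of 0 "1 / 2 ^ n"]])
        (auto intro!: symmetric_eqI simp: algebra_simps zero_prod_def)
    then show ?thesis
      using n D by (intro meets_half_lattice_central) auto
  next
    case 2
    then obtain n where n: "(1 / 2 ^ n) *\<^sub>R v \<notin> \<int> \<times> \<int>"
      using not_Ints_quotient_pair by blast
    have "upper 0 0 ((1 / 2 ^ n) *\<^sub>R v) 0 0 0 \<in> S"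
      by (rule commutator[OF S upper_in_rho_group(5)[of 0 "1 / 2 ^ n"]])
        (auto intro!: symmetric_eqI simp: algebra_simps zero_prod_def \<open>a = 0\<close>)
    then show ?thesis
      using n D by (intro meets_half_lattice_central) auto
  next
    case 3
    then show ?thesis
      using S D meets_half_lattice_central by auto
  qed
qed

text \<open>
  The unipotent transformations \<open>upper a v w 0 0 0\<close> form a normal abelian subgroup that is its own
  centraliser, even modulo the lattice. A transformation outside of it therefore has a nontrivial
  commutator with a suitable element of it, and that commutator is covered by the previous lemma.
\<close>

theorem meets_half_lattice:
  assumes g: "g \<in> S" "g \<in> rho_group k" "g \<notin> central_lattice"
  shows "\<exists>h\<in>half_lattice. upper 0 0 h 0 0 0 \<in> S"
proof -
  obtain u where u: "g = ev rho u" "fst ` set u \<subseteq> {..<9 + k}"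
    using g(2) by (auto simp: rho_group_def)
  obtain w v a q r s l where nf: "g = rho.nf w v a q r s l"
    and D: "w \<in> dyadic \<times> dyadic" "v \<in> dyadic \<times> dyadic" "a \<in> dyadic \<times> dyadic" "q \<in> dyadic" "r \<in> dyadic" "s \<in> dyadic"
    and l: "set l \<subseteq> abels_relations.torus_letters k"
    using joint_normal_form[OF rho.abels_relations_axioms u(2)] u(1) by metis
  obtain L \<kappa> \<mu> where L: "linear_map L" and \<kappa>: "\<kappa> \<noteq> 0" "1 / \<kappa> \<in> dyadic" and \<mu>: "\<mu> \<noteq> 0" "1 / \<mu> \<in> dyadic"
    and app: "\<And>p y z. app (ev rho l) (p, y, z) = (L p, \<kappa> * y, \<mu> * z)"
    using that by (rule torus_word_app[OF l])
  define Z where "Z z = \<mu> * z + s" for z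
  define Y where "Y y z = \<kappa> * y + r * Z z + q" for y z
  have g_app: "app g (p, y, z) = (L p + Y y z *\<^sub>R a + Z z *\<^sub>R v + w, Y y z, Z z)" for p y z
    unfolding nf Y_def Z_def by (rule app_rho_nf[OF D, of l L \<kappa> \<mu>]) (rule app)
  note lin = linear_mapD(1,2)[OF L]
  show ?thesis
  proof (cases "L (1, 0) = (1, 0) \<and> L (0, 1) = (0, 1)")
    \<comment> \<open>A vector moved by the linear part gives a commutator in the root \<open>14\<close>.\<close>
    case False
    then obtain e where e: "e \<in> \<int> \<times> \<int>" "L e \<noteq> e"
      by (metis Ints_0 Ints_1 mem_Sigma_iff)
    then have "L e - e \<in> \<int> \<times> \<int>"
      using linear_mapD(3)[OF L e(1)] by (auto simp: mem_Times_iff)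
    then have Le: "L e - e \<in> dyadic \<times> dyadic" "e \<in> dyadic \<times> dyadic"
      using e(1) by (auto simp: mem_Times_iff elim!: Ints_cases)
    obtain n where n: "(1 / 2 ^ n) *\<^sub>R (L e - e) \<notin> \<int> \<times> \<int>"
      using e(2) not_Ints_quotient_pair[of "L e - e"] by auto
    have "upper 0 0 ((1 / 2 ^ n) *\<^sub>R (L e - e)) 0 0 0 \<in> S"
    proof (rule commutator[OF g(1) upper_in_rho_group(3)])
      show "(1 / 2 ^ n) *\<^sub>R e \<in> dyadic \<times> dyadic"
        using Le(2) by auto
      show "g + upper 0 0 ((1 / 2 ^ n) *\<^sub>R e) 0 0 0
          = upper 0 0 ((1 / 2 ^ n) *\<^sub>R (L e - e)) 0 0 0 + upper 0 0 ((1 / 2 ^ n) *\<^sub>R e) 0 0 0 + g"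
        by (auto intro!: symmetric_eqI simp: g_app lin algebra_simps)
    qed (rule dyadic_simps)
    moreover have "(1 / 2 ^ n) *\<^sub>R (L e - e) \<in> dyadic \<times> dyadic"
      using Le(1) dyadic_simps(4)[of n] by (intro scaleR_dyadic) auto
    ultimately show ?thesis
      using n by (rule meets_half_lattice_central)
  next
    case True
    have Lid: "L p = p" for p
    proof -
      have "L p = L (fst p *\<^sub>R (1, 0) + snd p *\<^sub>R (0, 1))"
        by simp
      also have "\<dots> = fst p *\<^sub>R L (1, 0) + snd p *\<^sub>R L (0, 1)"
        by (simp only: lin)
      also have "\<dots> = p"
        using True by simp
      finally show ?thesis .
    qed
    define e :: "nat \<Rightarrow> real \<times> real" where "e n = (1 / 2 ^ n, 0)" for n
    have e: "e n \<in> dyadic \<times> dyadic" "e n \<noteq> 0" for n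
      by (simp_all add: e_def zero_prod_def)
    have ce: "c *\<^sub>R e n \<in> dyadic \<times> dyadic" if "c \<in> dyadic" for c n
      using that by (simp add: e_def)
    have zero: "(0 :: real \<times> real) \<in> dyadic \<times> dyadic"
      by (simp add: zero_prod_def)
    \<comment> \<open>With trivial linear part, test against the root \<open>13\<close>, which sees the action on \<open>z\<close>, then against \<open>12\<close>, which sees the action on \<open>y\<close>.\<close>
    consider "\<mu> \<noteq> 1" | "\<mu> = 1" "s \<noteq> 0" | "\<mu> = 1" "s = 0" "\<kappa> \<noteq> 1"
      | "\<mu> = 1" "s = 0" "\<kappa> = 1" "r \<noteq> 0" | "\<mu> = 1" "s = 0" "\<kappa> = 1" "r = 0" "q \<noteq> 0"
      | "\<mu> = 1" "s = 0" "\<kappa> = 1" "r = 0" "q = 0"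
      by blast
    then show ?thesis
    proof cases
      case 1
      have S: "upper 0 ((1 / \<mu> - 1) *\<^sub>R e 0) (- (s * (1 / \<mu>)) *\<^sub>R e 0) 0 0 0 \<in> S"
      proof (rule commutator[OF g(1) upper_in_rho_group(2)[OF e(1)]])
        show "g + upper 0 (e 0) 0 0 0 0
          = upper 0 ((1 / \<mu> - 1) *\<^sub>R e 0) (- (s * (1 / \<mu>)) *\<^sub>R e 0) 0 0 0 + upper 0 (e 0) 0 0 0 0 + g"
          using \<mu>(1) by (auto intro!: symmetric_eqI simp: g_app Lid Z_def e_def field_simps)
      qed (rule dyadic_simps)
      have "(1 / \<mu> - 1) *\<^sub>R e 0 \<noteq> 0"
        using 1 \<mu>(1) by (simp add: e_def zero_prod_def field_simps)
      then show ?thesis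
        using D \<mu> by (intro meets_half_lattice_upper[OF S zero ce ce] disjI1 disjI2) (simp_all del: times_divide_eq_right mult_1_right)
    next
      case 2
      obtain n where n: "s / 2 ^ n \<notin> \<int>"
        using not_Ints_quotient[OF 2(2)] .
      have S: "upper 0 0 (- s *\<^sub>R e n) 0 0 0 \<in> S"
      proof (rule commutator[OF g(1) upper_in_rho_group(2)[OF e(1)]])
        show "g + upper 0 (e n) 0 0 0 0 = upper 0 0 (- s *\<^sub>R e n) 0 0 0 + upper 0 (e n) 0 0 0 0 + g"
          using 2 by (auto intro!: symmetric_eqI simp: g_app Lid Z_def e_def field_simps)
      qed (rule dyadic_simps)
      have "- s *\<^sub>R e n \<notin> \<int> \<times> \<int>"
        using n by (simp add: e_def)
      then show ?thesis
        using D by (intro meets_half_lattice_central[OF S ce]) simp_all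
    next
      case 3
      have S: "upper ((1 / \<kappa> - 1) *\<^sub>R e 0) (- (r * (1 / \<kappa>)) *\<^sub>R e 0) (- (q * (1 / \<kappa>)) *\<^sub>R e 0) 0 0 0 \<in> S"
      proof (rule commutator[OF g(1) upper_in_rho_group(1)[OF e(1)]])
        show "g + upper (e 0) 0 0 0 0 0 = upper ((1 / \<kappa> - 1) *\<^sub>R e 0) (- (r * (1 / \<kappa>)) *\<^sub>R e 0)
            (- (q * (1 / \<kappa>)) *\<^sub>R e 0) 0 0 0 + upper (e 0) 0 0 0 0 0 + g"
          using \<kappa>(1) 3 by (auto intro!: symmetric_eqI simp: g_app Lid Y_def Z_def e_def field_simps)
      qed (rule dyadic_simps)
      have "(1 / \<kappa> - 1) *\<^sub>R e 0 \<noteq> 0"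
        using 3 \<kappa>(1) by (simp add: e_def zero_prod_def field_simps)
      then show ?thesis
        using D \<kappa> by (intro meets_half_lattice_upper[OF S ce ce ce] disjI1) (simp_all del: times_divide_eq_right mult_1_right)
    next
      case 4
      have S: "upper 0 (- r *\<^sub>R e 0) (- q *\<^sub>R e 0) 0 0 0 \<in> S"
      proof (rule commutator[OF g(1) upper_in_rho_group(1)[OF e(1)]])
        show "g + upper (e 0) 0 0 0 0 0 = upper 0 (- r *\<^sub>R e 0) (- q *\<^sub>R e 0) 0 0 0 + upper (e 0) 0 0 0 0 0 + g"
          using 4 by (auto intro!: symmetric_eqI simp: g_app Lid Y_def Z_def e_def field_simps)
      qed (rule dyadic_simps)
      have "- r *\<^sub>R e 0 \<noteq> 0"
        using 4 by (simp add: e_def zero_prod_def)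
      then show ?thesis
        using D by (intro meets_half_lattice_upper[OF S zero ce ce]) simp_all
    next
      case 5
      obtain n where n: "q / 2 ^ n \<notin> \<int>"
        using not_Ints_quotient[OF 5(5)] .
      have S: "upper 0 0 (- q *\<^sub>R e n) 0 0 0 \<in> S"
      proof (rule commutator[OF g(1) upper_in_rho_group(1)[OF e(1)]])
        show "g + upper (e n) 0 0 0 0 0 = upper 0 0 (- q *\<^sub>R e n) 0 0 0 + upper (e n) 0 0 0 0 0 + g"
          using 5 by (auto intro!: symmetric_eqI simp: g_app Lid Y_def Z_def e_def field_simps)
      qed (rule dyadic_simps)
      have "- q *\<^sub>R e n \<notin> \<int> \<times> \<int>"
        using n by (simp add: e_def)
      then show ?thesis
        using D by (intro meets_half_lattice_central[OF S ce]) simp_all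
    next
      case 6
      have "g = upper a v w 0 0 0"
        using 6 by (auto intro!: symmetric_eqI simp: g_app Lid Y_def Z_def)
      moreover from this have "a \<noteq> 0 \<or> v \<noteq> 0 \<or> w \<notin> \<int> \<times> \<int>"
        using g(3) by (auto simp: central_lattice_def)
      ultimately show ?thesis
        using g(1) D meets_half_lattice_upper by metis
    qed
  qed
qed

end

section \<open>Free groups and their quotients\<close>

abbreviation reduce :: "word \<Rightarrow> word" where
  "reduce w \<equiv> foldr push w []"

lemma reduce_carrier: "fst ` set w \<subseteq> {..<m} \<Longrightarrow> reduce w \<in> carrier (free_group m)"
  using letters_foldr_push[of w "[]"] by (auto simp: free_group_def reduced_foldr_push reduced_def[of "[]"])

lemma reduce_id: "w \<in> carrier (free_group m) \<Longrightarrow> reduce w = w"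
  by (simp add: free_group_def foldr_push_Nil)

lemma ev_reduce: "ev f (reduce w) = ev f w"
  by (simp add: ev_foldr_push)

lemma carrier_letters: "w \<in> carrier (free_group m) \<Longrightarrow> fst ` set w \<subseteq> {..<m}"
  by (simp add: free_group_def)

lemma ev_mult: "ev f (u \<otimes>\<^bsub>free_group m\<^esub> v) = ev f u + ev f v"
  by (simp add: free_group_def ev_foldr_push)

lemma ev_one: "ev f \<one>\<^bsub>free_group m\<^esub> = 0"
  by (simp add: free_group_def)

lemma ev_inv:
  assumes "u \<in> carrier (free_group m)"
  shows "ev f (inv\<^bsub>free_group m\<^esub> u) = - ev f u"
proof -
  interpret group "free_group m"
    by (rule group_free_group)
  have "ev f (inv\<^bsub>free_group m\<^esub> u \<otimes>\<^bsub>free_group m\<^esub> u) = 0"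
    using assms by (simp add: ev_one)
  then show ?thesis
    by (simp only: ev_mult eq_neg_iff_add_eq_0)
qed

lemma letter_carrier: "i < m \<Longrightarrow> [(i, b)] \<in> carrier (free_group m)"
  by (simp add: free_group_def reduced_def)

lemma letter_inverse: "i < m \<Longrightarrow> inv\<^bsub>free_group m\<^esub> [(i, True)] = [(i, False)]"
proof -
  interpret group "free_group m"
    by (rule group_free_group)
  assume "i < m"
  moreover have "[(i, False)] \<otimes>\<^bsub>free_group m\<^esub> [(i, True)] = \<one>\<^bsub>free_group m\<^esub>"
    by (simp add: free_group_def letter_inv_def)
  ultimately show ?thesis
    using inv_equality letter_carrier by blast
qed

lemma free_group_Cons:
  assumes "x # w \<in> carrier (free_group m)"
  shows "x # w = [x] \<otimes>\<^bsub>free_group m\<^esub> w" "[x] \<in> carrier (free_group m)" "w \<in> carrier (free_group m)"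
proof -
  have "push x w = x # w"
    using assms by (cases w) (auto simp: free_group_def reduced_def successively_Cons)
  then show "x # w = [x] \<otimes>\<^bsub>free_group m\<^esub> w"
    by (simp add: free_group_def)
  show "[x] \<in> carrier (free_group m)" "w \<in> carrier (free_group m)"
    using assms by (auto simp: free_group_def reduced_def successively_Cons)
qed

lemma generate_free_group: "generate (free_group m) {[(i, True)] | i. i < m} = carrier (free_group m)"
proof
  interpret group "free_group m"
    by (rule group_free_group)
  let ?S = "{[(i, True)] | i. i < m}"
  have S: "?S \<subseteq> carrier (free_group m)"
    using letter_carrier by auto
  show "generate (free_group m) ?S \<subseteq> carrier (free_group m)"
    using generate_incl[OF S] .
  show "carrier (free_group m) \<subseteq> generate (free_group m) ?S"
  proof
    fix w assume "w \<in> carrier (free_group m)"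
    then show "w \<in> generate (free_group m) ?S"
    proof (induction w)
      case Nil
      have "\<one>\<^bsub>free_group m\<^esub> \<in> generate (free_group m) ?S"
        by (rule generate.one)
      then show ?case
        by (simp add: free_group_def)
    next
      case (Cons x w)
      obtain i b where x: "x = (i, b)"
        by (cases x)
      have i: "i < m"
        using carrier_letters[OF Cons.prems] by (simp add: x)
      then have "[(i, True)] \<in> generate (free_group m) ?S" "inv\<^bsub>free_group m\<^esub> [(i, True)] \<in> generate (free_group m) ?S"
        by (auto intro!: generate.incl generate.inv)
      then have "[x] \<in> generate (free_group m) ?S"
        using i by (cases b) (simp_all add: x letter_inverse)
      then show ?case
        unfolding free_group_Cons(1)[OF Cons.prems]
        using Cons.IH free_group_Cons(3)[OF Cons.prems] by (intro generate.eng)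
    qed
  qed
qed

text \<open>
  Outside the carrier the translation is continued by the identity, to be a permutation of the type.
\<close>

definition cayley :: "('a, 'b) monoid_scheme \<Rightarrow> 'a \<Rightarrow> 'a symmetric" where
  "cayley G x = Symmetric (\<lambda>y. if y \<in> carrier G then x \<otimes>\<^bsub>G\<^esub> y else y)"

context group
begin

lemma app_cayley:
  assumes "x \<in> carrier G"
  shows "app (cayley G x) y = (if y \<in> carrier G then x \<otimes> y else y)"
proof -
  have "bij (\<lambda>y. if y \<in> carrier G then x \<otimes> y else y)"
    using assms by (intro o_bij[of "\<lambda>y. if y \<in> carrier G then inv x \<otimes> y else y"])
      (auto simp: fun_eq_iff simp flip: m_assoc)
  then show ?thesis
    by (simp add: cayley_def Symmetric_inverse)
qed

lemma cayley_mult: "x \<in> carrier G \<Longrightarrow> y \<in> carrier G \<Longrightarrow> cayley G (x \<otimes> y) = cayley G x + cayley G y"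
  by (rule symmetric_eqI) (simp add: app_cayley m_assoc)

lemma cayley_one: "cayley G \<one> = 0"
  by (rule symmetric_eqI) (simp add: app_cayley)

lemma cayley_inv:
  assumes "x \<in> carrier G"
  shows "cayley G (inv x) = - cayley G x"
  using cayley_mult[of "inv x" x] assms by (simp add: cayley_one eq_neg_iff_add_eq_0)

lemma app_cayley_one: "x \<in> carrier G \<Longrightarrow> app (cayley G x) \<one> = x"
  by (simp add: app_cayley)

lemma ev_cayley:
  assumes "\<And>i. \<gamma> i \<in> carrier G"
  shows "\<exists>x\<in>carrier G. ev (\<lambda>i. cayley G (\<gamma> i)) w = cayley G x"
proof (induction w)
  case Nil
  show ?case
    using cayley_one by force
next
  case (Cons l w)
  then obtain x where x: "x \<in> carrier G" "ev (\<lambda>i. cayley G (\<gamma> i)) w = cayley G x"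
    by blast
  let ?y = "if snd l then \<gamma> (fst l) else inv \<gamma> (fst l)"
  have "?y \<otimes> x \<in> carrier G" "ev (\<lambda>i. cayley G (\<gamma> i)) (l # w) = cayley G (?y \<otimes> x)"
    using x assms by (simp_all add: cayley_mult cayley_inv)
  then show ?case
    by blast
qed

definition word_hom :: "(nat \<Rightarrow> 'a) \<Rightarrow> word \<Rightarrow> 'a" where
  "word_hom \<gamma> w = app (ev (\<lambda>i. cayley G (\<gamma> i)) w) \<one>"

lemma word_hom_cayley:
  assumes "\<And>i. \<gamma> i \<in> carrier G"
  shows "word_hom \<gamma> w \<in> carrier G" "ev (\<lambda>i. cayley G (\<gamma> i)) w = cayley G (word_hom \<gamma> w)"
  using ev_cayley[where w = w and \<gamma> = \<gamma>, OF assms] by (auto simp: word_hom_def app_cayley_one)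

lemma word_hom_letter: "\<gamma> i \<in> carrier G \<Longrightarrow> word_hom \<gamma> [(i, True)] = \<gamma> i"
  by (simp add: word_hom_def app_cayley_one)

lemma group_hom_word_hom:
  assumes "\<And>i. \<gamma> i \<in> carrier G"
  shows "group_hom (free_group m) G (word_hom \<gamma>)"
proof -
  have "word_hom \<gamma> (u \<otimes>\<^bsub>free_group m\<^esub> v) = word_hom \<gamma> u \<otimes> word_hom \<gamma> v" for u v
  proof -
    have "word_hom \<gamma> (u \<otimes>\<^bsub>free_group m\<^esub> v)
        = app (cayley G (word_hom \<gamma> u)) (app (cayley G (word_hom \<gamma> v)) \<one>)"
      unfolding word_hom_def[of _ "u \<otimes>\<^bsub>free_group m\<^esub> v"] ev_mult
      by (simp only: word_hom_cayley(2)[where \<gamma> = \<gamma>, OF assms] app_plus)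
    then show ?thesis
      using word_hom_cayley(1)[where \<gamma> = \<gamma>, OF assms] by (simp add: app_cayley)
  qed
  then have "word_hom \<gamma> \<in> hom (free_group m) G"
    using word_hom_cayley(1)[where \<gamma> = \<gamma>, OF assms] by (simp add: hom_def)
  then show ?thesis
    by (simp add: group_hom_def group_hom_axioms_def group_free_group is_group)
qed

end

text \<open>
  Through the regular representation of the quotient, results on type-class groups apply to an arbitrary
  normal subgroup of a free group.
\<close>

lemma ev_quotient:
  assumes N: "N \<lhd> free_group m" and w: "fst ` set w \<subseteq> {..<m}"
  shows "ev (\<lambda>i. cayley (free_group m Mod N) (N #>\<^bsub>free_group m\<^esub> [(i, True)])) w = 0 \<longleftrightarrow> reduce w \<in> N"
proof -
  let ?F = "free_group m" and ?Q = "free_group m Mod N"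
  let ?f = "\<lambda>i. cayley ?Q (N #>\<^bsub>?F\<^esub> [(i, True)])"
  interpret N: normal N ?F
    by fact
  interpret Q: group ?Q
    by (rule N.factorgroup_is_group)
  interpret q: group_hom ?F ?Q "\<lambda>a. N #>\<^bsub>?F\<^esub> a"
    using N.r_coset_hom_Mod by unfold_locales
  have *: "ev ?f w = cayley ?Q (N #>\<^bsub>?F\<^esub> w)" if "w \<in> carrier ?F" for w
    using that
  proof (induction w)
    case Nil
    have "[] = \<one>\<^bsub>?F\<^esub>"
      by (simp add: free_group_def)
    then have "N #>\<^bsub>?F\<^esub> [] = \<one>\<^bsub>?Q\<^esub>"
      using q.hom_one by (simp only:)
    then show ?case
      by (simp only: ev.simps Q.cayley_one)
  next
    case (Cons x w)
    obtain i b where x: "x = (i, b)"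
      by (cases x)
    have i: "i < m"
      using carrier_letters[OF Cons.prems] by (simp add: x)
    have c: "[(i, True)] \<in> carrier ?F" "[x] \<in> carrier ?F" "w \<in> carrier ?F"
      using letter_carrier[OF i] free_group_Cons[OF Cons.prems] by auto
    have "cayley ?Q (N #>\<^bsub>?F\<^esub> [x]) = (if b then ?f i else - ?f i)"
      using c(1) i q.hom_inv[OF c(1)] Q.cayley_inv[OF q.hom_closed[OF c(1)]]
      by (simp add: x letter_inverse del: q.hom_inv)
    then have "ev ?f (x # w) = cayley ?Q (N #>\<^bsub>?F\<^esub> [x]) + cayley ?Q (N #>\<^bsub>?F\<^esub> w)"
      using Cons.IH c(3) by (simp add: x)
    also have "\<dots> = cayley ?Q (N #>\<^bsub>?F\<^esub> (x # w))"
      unfolding free_group_Cons(1)[OF Cons.prems]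
      by (simp only: Q.cayley_mult[OF q.hom_closed q.hom_closed] q.hom_mult c)
    finally show ?case .
  qed
  have r: "reduce w \<in> carrier ?F"
    using w by (rule reduce_carrier)
  have "ev ?f w = cayley ?Q (N #>\<^bsub>?F\<^esub> reduce w)"
    using *[OF r] by (simp only: ev_reduce)
  also have "\<dots> = 0 \<longleftrightarrow> N #>\<^bsub>?F\<^esub> reduce w = \<one>\<^bsub>?Q\<^esub>"
  proof
    assume "cayley ?Q (N #>\<^bsub>?F\<^esub> reduce w) = 0"
    then have "app (cayley ?Q (N #>\<^bsub>?F\<^esub> reduce w)) \<one>\<^bsub>?Q\<^esub> = \<one>\<^bsub>?Q\<^esub>"
      by (simp only: app_0)
    then show "N #>\<^bsub>?F\<^esub> reduce w = \<one>\<^bsub>?Q\<^esub>"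
      by (simp only: Q.app_cayley_one[OF q.hom_closed[OF r]])
  qed (simp only: Q.cayley_one)
  also have "\<dots> \<longleftrightarrow> reduce w \<in> N"
  proof -
    have "\<one>\<^bsub>?Q\<^esub> = N"
      by (simp add: FactGroup_def)
    then show ?thesis
      using N.coset_join1[OF _ r N.subgroup_axioms] N.coset_join2[OF r N.subgroup_axioms] by metis
  qed
  finally show ?thesis .
qed

text \<open>
  Finitely many elements that are required to belong or not to belong to the subgroup define a basic open set.
\<close>

lemma openin_singleton_marked_groups:
  assumes N: "N \<lhd> free_group m" and "finite R" "finite S" "R \<subseteq> N" "S \<subseteq> carrier (free_group m) - N"
    and unique: "\<And>N'. N' \<lhd> free_group m \<Longrightarrow> R \<subseteq> N' \<Longrightarrow> S \<inter> N' = {} \<Longrightarrow> N' = N"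
  shows "openin (marked_groups m) {N}"
proof -
  let ?C = "carrier (free_group m)"
  \<comment> \<open>The prescribed values at the finitely many coordinates in \<open>R\<close> and \<open>S\<close>.\<close>
  define B where "B w = {b. (w \<in> R \<longrightarrow> b) \<and> (w \<in> S \<longrightarrow> \<not> b)}" for w
  have RC: "R \<subseteq> ?C"
    using assms(4) normal_imp_subgroup[OF N] subgroup.subset by blast
  have "{w \<in> ?C. B w \<noteq> UNIV} \<subseteq> R \<union> S"
    by (auto simp: B_def)
  then have "finite {w \<in> ?C. B w \<noteq> UNIV}"
    using assms(2,3) finite_subset by blast
  then have U: "openin (product_topology (\<lambda>_. discrete_topology (UNIV :: bool set)) ?C) (Pi\<^sub>E ?C B)"
    by (simp add: openin_PiE_gen)
  have "restrict (\<lambda>w. w \<in> N') ?C \<in> Pi\<^sub>E ?C B \<longleftrightarrow> (\<forall>w\<in>?C. (w \<in> R \<longrightarrow> w \<in> N') \<and> (w \<in> S \<longrightarrow> w \<notin> N'))" for N'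
    by (simp add: PiE_iff B_def)
  then have *: "restrict (\<lambda>w. w \<in> N') ?C \<in> Pi\<^sub>E ?C B \<longleftrightarrow> R \<subseteq> N' \<and> S \<inter> N' = {}" for N'
    using RC assms(5) by blast
  have "S \<inter> N = {}"
    using assms(5) by blast
  have "{N} = (\<lambda>N. restrict (\<lambda>w. w \<in> N) ?C) -` Pi\<^sub>E ?C B \<inter> {N. N \<lhd> free_group m}"
  proof (intro Set.set_eqI iffI)
    fix N' assume "N' \<in> {N}"
    then show "N' \<in> (\<lambda>N. restrict (\<lambda>w. w \<in> N) ?C) -` Pi\<^sub>E ?C B \<inter> {N. N \<lhd> free_group m}"
      using N assms(4) \<open>S \<inter> N = {}\<close> by (simp only: singleton_iff vimage_eq Int_iff mem_Collect_eq * simp_thms)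
  next
    fix N' assume "N' \<in> (\<lambda>N. restrict (\<lambda>w. w \<in> N) ?C) -` Pi\<^sub>E ?C B \<inter> {N. N \<lhd> free_group m}"
    then have "R \<subseteq> N'" "S \<inter> N' = {}" "N' \<lhd> free_group m"
      by (simp_all only: vimage_eq Int_iff mem_Collect_eq * simp_thms)
    then show "N' \<in> {N}"
      using unique by simp
  qed
  with U show ?thesis
    unfolding marked_groups_def openin_pullback_topology by blast
qed

section \<open>Isolation\<close>

text \<open>
  The kernel of the free group acting on triples \<open>(p, y, z)\<close> with \<open>p\<close> taken modulo \<open>\<int>\<^sup>2\<close>.
\<close>

definition monolith_kernel :: "nat \<Rightarrow> word set" where
  "monolith_kernel k = {w \<in> carrier (free_group (9 + k)). ev rho w \<in> central_lattice}"

lemma central_latticeI: "w \<in> \<int> \<times> \<int> \<Longrightarrow> upper 0 0 w 0 0 0 \<in> central_lattice"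
  unfolding central_lattice_def by blast

lemma central_lattice_closed:
  shows central_lattice_0: "0 \<in> central_lattice"
    and central_lattice_plus: "c \<in> central_lattice \<Longrightarrow> d \<in> central_lattice \<Longrightarrow> c + d \<in> central_lattice"
    and central_lattice_minus: "c \<in> central_lattice \<Longrightarrow> - c \<in> central_lattice"
proof -
  have *: "upper 0 0 v 0 0 0 + upper 0 0 w 0 0 0 = upper 0 0 (v + w) 0 0 0" for v w
    by (auto intro!: symmetric_eqI simp: add.assoc add.commute)
  have 0: "upper 0 0 0 0 0 0 = 0"
    by (auto intro!: symmetric_eqI)
  have "upper 0 0 0 0 0 0 \<in> central_lattice"
    by (rule central_latticeI) (simp add: zero_prod_def)
  then show "0 \<in> central_lattice"
    by (simp only: 0)
  show "c + d \<in> central_lattice" if c: "c \<in> central_lattice" and d: "d \<in> central_lattice"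
  proof -
    obtain v w where vw: "c = upper 0 0 v 0 0 0" "d = upper 0 0 w 0 0 0" "v \<in> \<int> \<times> \<int>" "w \<in> \<int> \<times> \<int>"
      using c d unfolding central_lattice_def by blast
    then have "v + w \<in> \<int> \<times> \<int>"
      by (auto simp: mem_Times_iff)
    then show ?thesis
      unfolding vw(1,2) * by (rule central_latticeI)
  qed
  show "- c \<in> central_lattice" if c: "c \<in> central_lattice"
  proof -
    obtain v where v: "c = upper 0 0 v 0 0 0" "v \<in> \<int> \<times> \<int>"
      using c unfolding central_lattice_def by blast
    have "- c = upper 0 0 (- v) 0 0 0"
      unfolding v by (rule minus_unique) (simp add: * 0)
    moreover have "- v \<in> \<int> \<times> \<int>"
      using v(2) by (auto simp: mem_Times_iff)
    ultimately show ?thesis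
      by (simp only: central_latticeI)
  qed
qed

lemma central_lattice_conj:
  assumes "c \<in> central_lattice"
  shows "conj_by (ev rho w) c \<in> central_lattice"
proof (induction w)
  case (Cons x w)
  obtain i b where x: "x = (i, b)"
    by (cases x)
  obtain v where v: "conj_by (ev rho w) c = upper 0 0 v 0 0 0" "v \<in> \<int> \<times> \<int>"
    using Cons unfolding central_lattice_def by blast
  define v' where "v' = (if i < 9 then v else shear (i - 9) b v)"
  have "v' \<in> \<int> \<times> \<int>"
    using v(2) shear_Ints by (simp add: v'_def)
  have "i \<in> {0, 1, 2, 3, 4, 5, 6, 7, 8}" if "i < 9"
    using that by auto
  then have act: "act i b (p + v, y, z) = (fst (act i b (p, y, z)) + v', snd (act i b (p, y, z)))" for p y z
    by (cases "i < 9") (auto simp: v'_def Let_def shear_add)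
  have app_x: "app (ev rho [x]) Q = act i b Q" for Q
    by (cases b) (simp_all add: x app_rho)
  have "ev rho [x] + upper 0 0 v 0 0 0 = upper 0 0 v' 0 0 0 + ev rho [x]"
  proof (rule symmetric_eqI)
    fix P :: point
    obtain p y z where P: "P = (p, y, z)"
      by (cases P)
    obtain p' y' z' where P': "act i b (p, y, z) = (p', y', z')"
      by (cases "act i b (p, y, z)")
    have "app (upper 0 0 v 0 0 0) P = (p + v, y, z)" "app (upper 0 0 v' 0 0 0) (p', y', z') = (p' + v', y', z')"
      by (simp_all add: P)
    then show "app (ev rho [x] + upper 0 0 v 0 0 0) P = app (upper 0 0 v' 0 0 0 + ev rho [x]) P"
      by (simp only: app_plus app_x act P P' fst_conv snd_conv)
  qed
  then have "conj_by (ev rho [x]) (upper 0 0 v 0 0 0) = upper 0 0 v' 0 0 0"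
    by (simp only: conj_by_eq_iff)
  then have "conj_by (ev rho (x # w)) c = upper 0 0 v' 0 0 0"
    using v(1) ev_append[of rho "[x]" w] by (simp add: conj_by_plus)
  then show ?case
    using \<open>v' \<in> \<int> \<times> \<int>\<close> by (simp only: central_latticeI)
qed (use assms in simp)

lemma normal_monolith_kernel: "monolith_kernel k \<lhd> free_group (9 + k)"
proof -
  interpret group "free_group (9 + k)"
    by (rule group_free_group)
  show ?thesis
  proof (rule normal_invI)
    show "subgroup (monolith_kernel k) (free_group (9 + k))"
      by (rule subgroupI)
        (auto simp: monolith_kernel_def ev_mult ev_inv central_lattice_closed
          intro!: exI[of _ "\<one>\<^bsub>free_group (9 + k)\<^esub>"] simp: ev_one)
  next
    fix x h assume "x \<in> carrier (free_group (9 + k))" "h \<in> monolith_kernel k"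
    then show "x \<otimes>\<^bsub>free_group (9 + k)\<^esub> h \<otimes>\<^bsub>free_group (9 + k)\<^esub> inv\<^bsub>free_group (9 + k)\<^esub> x \<in> monolith_kernel k"
      using central_lattice_conj[of "ev rho h" x] by (simp add: monolith_kernel_def ev_mult ev_inv conj_by_def)
  qed
qed

definition central_relations :: "(word \<times> word) set" where
  "central_relations = {([(0, True), (8, True)], [(8, True), (0, True)]), ([(1, True), (8, True)], [(8, True), (1, True)])}"

definition relators :: "nat \<Rightarrow> word set" where
  "relators k = (\<lambda>(l, r). reduce (l @ map letter_inv (rev r))) ` (relations k \<union> central_relations)"

lemma ev_relator: "ev f (l @ map letter_inv (rev r)) = 0 \<longleftrightarrow> ev f l = ev f r"
  by (simp add: ev_append ev_inverse)

lemma relation_letters: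
  assumes "(l, r) \<in> relations k \<union> central_relations"
  shows "fst ` set (l @ map letter_inv (rev r)) \<subseteq> {..<9 + k}"
  using assms unfolding relations_def central_relations_def commuting_letters_def
  by (auto split: if_splits)

text \<open>
  Containing the relators forces a normal subgroup to contain the kernel; avoiding three words that
  represent \<^const>\<open>half_lattice\<close> forces it to be no larger.
\<close>

theorem isolated_monolith_kernel: "openin (marked_groups (9 + k)) {monolith_kernel k}"
proof -
  let ?F = "free_group (9 + k)" and ?N = "monolith_kernel k"
  interpret F: group ?F
    by (rule group_free_group)
  \<comment> \<open>Words for the three half-integral translations, to be kept out of the subgroup.\<close>
  have "\<exists>s\<in>carrier ?F. ev rho s = upper 0 0 h 0 0 0" if "h \<in> half_lattice" for h
  proof -
    have "h \<in> dyadic \<times> dyadic"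
      using that dyadic_simps(4)[of 1] by (auto simp: half_lattice_def)
    then have "upper 0 0 h 0 0 0 \<in> rho_group k"
      using upper_in_rho_group(3)[of h 0] by simp
    then obtain u where "fst ` set u \<subseteq> {..<9 + k}" "ev rho u = upper 0 0 h 0 0 0"
      by (auto simp: rho_group_def)
    then show ?thesis
      using reduce_carrier ev_reduce by metis
  qed
  then obtain s where s: "\<And>h. h \<in> half_lattice \<Longrightarrow> s h \<in> carrier ?F"
      "\<And>h. h \<in> half_lattice \<Longrightarrow> ev rho (s h) = upper 0 0 h 0 0 0"
    by metis
  show ?thesis
  proof (rule openin_singleton_marked_groups[OF normal_monolith_kernel])
    have "finite (relations k \<union> central_relations)"
      by (simp add: finite_relations central_relations_def)
    then show "finite (relators k)"
      unfolding relators_def by (rule finite_imageI)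
    show "finite (s ` half_lattice)"
      by (simp add: half_lattice_def)
    show "relators k \<subseteq> ?N"
    proof
      fix w assume "w \<in> relators k"
      then obtain l r where lr: "(l, r) \<in> relations k \<union> central_relations" "w = reduce (l @ map letter_inv (rev r))"
        by (auto simp: relators_def)
      have "ev rho (l @ map letter_inv (rev r)) \<in> central_lattice"
      proof (cases "(l, r) \<in> relations k")
        case True
        then show ?thesis
          using rho.relation ev_relator central_lattice_0 by metis
      next
        case False
        \<comment> \<open>The commutator of \<open>12\<close> and \<open>24\<close> is an integral translation, which is trivial in the quotient.\<close>
        have "ev rho [(i, True), (8, True), (i, False), (8, False)] = upper 0 0 (unit_vec (i = 1)) 0 0 0"
          if "i \<in> {0, 1}" for i
        proof (rule symmetric_eqI)
          fix P :: point
          obtain p y z where P: "P = (p, y, z)"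
            by (cases P)
          show "app (ev rho [(i, True), (8, True), (i, False), (8, False)]) P = app (upper 0 0 (unit_vec (i = 1)) 0 0 0) P"
            unfolding P app_ev_Cons using that by (auto simp: unit_vec_def prod_eq_iff)
        qed
        moreover have "upper 0 0 (unit_vec i) 0 0 0 \<in> central_lattice" for i
          by (rule central_latticeI) (simp add: unit_vec_def)
        moreover have "\<exists>i\<in>{0, 1}. l @ map letter_inv (rev r) = [(i, True), (8, True), (i, False), (8, False)]"
          using False lr(1) by (auto simp: central_relations_def letter_inv_def)
        ultimately show ?thesis
          by (metis insert_iff)
      qed
      then show "w \<in> ?N"
        unfolding lr(2) monolith_kernel_def using relation_letters[OF lr(1)]
        by (simp only: ev_reduce mem_Collect_eq reduce_carrier simp_thms)
    qed
    have "upper 0 0 h 0 0 0 \<notin> central_lattice" if h: "h \<in> half_lattice" for h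
    proof
      have "(1 / 2 :: real) \<notin> \<int>"
        using Ints_nonzero_abs_less1[of "1 / 2 :: real"] by auto
      then have "h \<notin> \<int> \<times> \<int>"
        using h by (auto simp: half_lattice_def)
      moreover assume "upper 0 0 h 0 0 0 \<in> central_lattice"
      then obtain w where w: "upper 0 0 h 0 0 0 = upper 0 0 w 0 0 0" "w \<in> \<int> \<times> \<int>"
        unfolding central_lattice_def by blast
      have "h = w"
        using arg_cong[OF w(1), of "\<lambda>g. app g (0, 0, 0)"] by simp
      ultimately show False
        using w(2) by simp
    qed
    then show "s ` half_lattice \<subseteq> carrier ?F - ?N"
      using s by (auto simp: monolith_kernel_def)
  next
    fix N assume N: "N \<lhd> ?F" and R: "relators k \<subseteq> N" and S: "s ` half_lattice \<inter> N = {}"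
    interpret N: normal N ?F
      by fact
    let ?f = "\<lambda>i. cayley (?F Mod N) (N #>\<^bsub>?F\<^esub> [(i, True)])"
    have rel: "ev ?f l = ev ?f r" if "(l, r) \<in> relations k \<union> central_relations" for l r
    proof -
      have "reduce (l @ map letter_inv (rev r)) \<in> N"
        using that R unfolding relators_def by force
      then show ?thesis
        using ev_quotient[OF N relation_letters[OF that]] ev_relator by blast
    qed
    have f: "abels_relations ?f k"
      by standard (simp add: rel)
    have "commute (?f 0) (?f 8)" "commute (?f 1) (?f 8)"
      using rel[of "[(0, True), (8, True)]" "[(8, True), (0, True)]"]
        rel[of "[(1, True), (8, True)]" "[(8, True), (1, True)]"]
      by (simp_all add: central_relations_def commute_def)
    note kernel = kernel_trivial[OF f this]
    have sub: "?N \<subseteq> N"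
    proof
      fix w assume "w \<in> ?N"
      then have w: "w \<in> carrier ?F" "ev rho w \<in> central_lattice"
        by (simp_all add: monolith_kernel_def)
      then have "ev ?f w = 0"
        using kernel carrier_letters by blast
      then show "w \<in> N"
        using ev_quotient[OF N carrier_letters[OF w(1)]] reduce_id[OF w(1)] by simp
    qed
    have "N \<subseteq> ?N"
    proof
      fix w assume w: "w \<in> N"
      then have wc: "w \<in> carrier ?F"
        by (rule N.mem_carrier)
      show "w \<in> ?N"
      proof (rule ccontr)
        assume "w \<notin> ?N"
        then have "ev rho w \<notin> central_lattice"
          using wc by (simp add: monolith_kernel_def)
        interpret S: rho_normal k "ev rho ` N"
        proof
          fix g h assume "g \<in> ev rho ` N" "h \<in> ev rho ` N"
          then obtain a b where ab: "g = ev rho a" "h = ev rho b" "a \<in> N" "b \<in> N"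
            by blast
          then have "g + h = ev rho (a \<otimes>\<^bsub>?F\<^esub> b)" "- g = ev rho (inv\<^bsub>?F\<^esub> a)"
            by (simp_all add: ev_mult ev_inv)
          then show "g + h \<in> ev rho ` N" "- g \<in> ev rho ` N"
            using ab(3,4) N.m_closed N.m_inv_closed by blast+
        next
          fix g h assume "g \<in> ev rho ` N" "h \<in> rho_group k"
          then obtain a u where a: "g = ev rho a" "a \<in> N" and u: "h = ev rho u" "fst ` set u \<subseteq> {..<9 + k}"
            by (auto simp: rho_group_def)
          let ?u = "reduce u"
          have c: "?u \<in> carrier ?F" "a \<in> carrier ?F"
            using u(2) a(2) reduce_carrier by auto
          have "?u \<otimes>\<^bsub>?F\<^esub> a \<otimes>\<^bsub>?F\<^esub> inv\<^bsub>?F\<^esub> ?u \<in> N"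
            using N.inv_op_closed2[OF c(1) a(2)] .
          moreover have "conj_by h g = ev rho (?u \<otimes>\<^bsub>?F\<^esub> a \<otimes>\<^bsub>?F\<^esub> inv\<^bsub>?F\<^esub> ?u)"
            using c by (simp add: ev_mult ev_inv ev_reduce a(1) u(1) conj_by_def)
          ultimately show "conj_by h g \<in> ev rho ` N"
            by blast
        next
          show "central_lattice \<subseteq> ev rho ` N"
          proof
            fix c assume c: "c \<in> central_lattice"
            then obtain v where v: "c = upper 0 0 v 0 0 0" "v \<in> \<int> \<times> \<int>"
              unfolding central_lattice_def by blast
            have "v \<in> dyadic \<times> dyadic"
              using v(2) by (auto elim!: Ints_cases)
            then have "c \<in> rho_group k"
              using upper_in_rho_group(3)[of v 0] v(1) by simp
            then obtain u where u: "c = ev rho u" "fst ` set u \<subseteq> {..<9 + k}"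
              by (auto simp: rho_group_def)
            then have "reduce u \<in> ?N"
              using c by (simp add: monolith_kernel_def reduce_carrier ev_reduce)
            then show "c \<in> ev rho ` N"
              using sub u(1) ev_reduce by (metis image_eqI subsetD)
          qed
        qed
        have "ev rho w \<in> rho_group k"
          using carrier_letters[OF wc] by (auto simp: rho_group_def)
        then obtain h where h: "h \<in> half_lattice" "upper 0 0 h 0 0 0 \<in> ev rho ` N"
          using S.meets_half_lattice \<open>ev rho w \<notin> central_lattice\<close> w by blast
        from h(2) obtain n where n: "upper 0 0 h 0 0 0 = ev rho n" "n \<in> N"
          by (rule imageE)
        then have n: "n \<in> N" "ev rho n = ev rho (s h)"
          using s(2)[OF h(1)] by simp_all
        have nc: "n \<in> carrier ?F" "s h \<in> carrier ?F"
          using n(1) s(1)[OF h(1)] by auto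
        then have "s h \<otimes>\<^bsub>?F\<^esub> inv\<^bsub>?F\<^esub> n \<in> ?N"
          by (simp add: monolith_kernel_def ev_mult ev_inv n(2) central_lattice_0)
        then have "s h \<otimes>\<^bsub>?F\<^esub> inv\<^bsub>?F\<^esub> n \<otimes>\<^bsub>?F\<^esub> n \<in> N"
          using sub n(1) N.m_closed by blast
        then have "s h \<in> N"
          using nc by (simp add: F.m_assoc)
        then show False
          using S h(1) by blast
      qed
    qed
    with sub show "N = ?N"
      by blast
  qed
qed

lemma finitely_generated_quotient:
  assumes N: "N \<lhd> free_group m"
  shows "finitely_generated (free_group m Mod N)"
proof -
  let ?F = "free_group m" and ?h = "\<lambda>a. N #>\<^bsub>free_group m\<^esub> a" and ?S = "{[(i, True)] | i. i < m}"
  interpret N: normal N ?F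
    by fact
  interpret Q: group "?F Mod N"
    by (rule N.factorgroup_is_group)
  interpret q: group_hom ?F "?F Mod N" ?h
    using N.r_coset_hom_Mod by unfold_locales
  have S: "?S \<subseteq> carrier ?F"
    using letter_carrier by auto
  have "generate (?F Mod N) (?h ` ?S) = ?h ` carrier ?F"
    using q.generate_img[OF S] by (simp only: generate_free_group)
  also have "\<dots> = carrier (?F Mod N)"
    by (auto simp: FactGroup_def RCOSETS_def)
  finally have "generate (?F Mod N) (?h ` ?S) = carrier (?F Mod N)" .
  moreover have "?h ` ?S \<subseteq> carrier (?F Mod N)"
    using S by (blast intro: q.hom_closed)
  moreover have "finite (?h ` ?S)"
    by simp
  ultimately show ?thesis
    unfolding finitely_generated_def by blast
qed

text \<open>
  Every marking of a group by the last \<open>k\<close> letters extends to one that satisfies the relations, since they impose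
  nothing on the shears alone.
\<close>

lemma abels_relations_trivial:
  fixes f :: "nat \<Rightarrow> 'q::group_add"
  assumes "\<And>i. i < 9 \<Longrightarrow> f i = 0"
  shows "abels_relations f k"
proof
  have "zmul n (0 :: 'q) = 0" for n
    using zmul_hom[of "\<lambda>_. 0 :: 'q" n 0] by simp
  then have "ev f (replicate n (i, b)) = 0" if "i < 9" for n i b
    using assms that by (simp add: ev_replicate)
  then show "ev f l = ev f r" if "(l, r) \<in> relations k" for l r
    using that assms unfolding relations_def commuting_letters_def
    by (auto simp: ev_append)
qed

theorem theorem9:
  fixes G :: "('a, 'b) monoid_scheme"
  assumes "group G" and "finitely_generated G"
  shows "\<exists>(H :: word set monoid) K. isolated_group H \<and> K \<lhd> H \<and> H Mod K \<cong> G"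
proof -
  interpret G: group G
    by fact
  obtain S where S: "finite S" "S \<subseteq> carrier G" "generate G S = carrier G"
    using assms(2) by (auto simp: finitely_generated_def)
  obtain gs where gs: "set gs = S"
    using finite_list[OF S(1)] by blast
  define k where "k = length gs"
  define \<gamma> where "\<gamma> i = (if 9 \<le> i \<and> i < 9 + k then gs ! (i - 9) else \<one>\<^bsub>G\<^esub>)" for i
  have \<gamma>: "\<gamma> i \<in> carrier G" for i
    using S(2) gs by (force simp: \<gamma>_def k_def)
  let ?F = "free_group (9 + k)" and ?N = "monolith_kernel k" and ?\<phi> = "G.word_hom \<gamma>"
  let ?f = "\<lambda>i. cayley G (\<gamma> i)"
  interpret \<phi>: group_hom ?F G ?\<phi>
    using \<gamma> by (rule G.group_hom_word_hom)
  have f0: "?f i = 0" if "i < 9" for i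
    using that by (simp add: \<gamma>_def G.cayley_one)
  have "?N \<subseteq> kernel ?F G ?\<phi>"
  proof
    fix w assume "w \<in> ?N"
    then have w: "w \<in> carrier ?F" "ev rho w \<in> central_lattice"
      by (simp_all add: monolith_kernel_def)
    have "ev ?f w = 0"
      using w carrier_letters f0 by (intro kernel_trivial[OF abels_relations_trivial]) auto
    then show "w \<in> kernel ?F G ?\<phi>"
      using w(1) by (simp add: kernel_def G.word_hom_def)
  qed
  then obtain g where g: "g \<in> hom (?F Mod ?N) G" "\<And>w. w \<in> carrier ?F \<Longrightarrow> g (?N #>\<^bsub>?F\<^esub> w) = ?\<phi> w"
    using \<phi>.FactGroup_universal_kernel[OF normal_monolith_kernel] by blast
  have Q: "group (?F Mod ?N)"
    by (rule normal.factorgroup_is_group[OF normal_monolith_kernel])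
  interpret g: group_hom "?F Mod ?N" G g
    using Q g(1) by (simp add: group_hom_def group_hom_axioms_def G.is_group)
  have "S \<subseteq> g ` carrier (?F Mod ?N)"
  proof
    fix x assume "x \<in> S"
    then obtain i where i: "i < k" "gs ! i = x"
      using gs by (auto simp: in_set_conv_nth k_def)
    let ?w = "[(9 + i, True)]"
    have w: "?w \<in> carrier ?F"
      using i(1) by (intro letter_carrier) simp
    have "g (?N #>\<^bsub>?F\<^esub> ?w) = x"
      using g(2)[OF w] i by (simp add: G.word_hom_letter[OF \<gamma>]) (simp add: \<gamma>_def)
    moreover have "?N #>\<^bsub>?F\<^esub> ?w \<in> carrier (?F Mod ?N)"
      using w by (auto simp: FactGroup_def RCOSETS_def)
    ultimately show "x \<in> g ` carrier (?F Mod ?N)"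
      by blast
  qed
  then have "carrier G \<subseteq> g ` carrier (?F Mod ?N)"
    using G.generate_subgroup_incl[OF _ g.img_is_subgroup] S(3) by blast
  then have "g ` carrier (?F Mod ?N) = carrier G"
    using g.hom_closed by blast
  then have "(?F Mod ?N) Mod (kernel (?F Mod ?N) G g) \<cong> G"
    by (rule g.FactGroup_iso)
  moreover have "isolated_group (?F Mod ?N)"
    unfolding isolated_group_def
    using Q finitely_generated_quotient[OF normal_monolith_kernel] normal_monolith_kernel
      isolated_monolith_kernel iso_refl by blast
  ultimately show ?thesis
    using g.normal_kernel by blast
qed

end
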